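(* Let $B$ be a finite Kleene algebra, let $D(B)=(W,\preceq_W,M)$ be its dual Kleene space (relation $R$ omitted, since it plays no role), let $(\mathcal N(W),\omega)$ be the associated weighted abstract simplicial complex, and let $P^{\omega}_{\mathcal N(W)}$ be the companion polyhedron. Then the MV-algebra $F(B)$ freely generated by $B$ is isomorphic to the MV-algebra of $\mathbb Z$-maps on $P^{\omega}_{\mathcal N(W)}$: $$F(B)\cong \mathcal M\big(P^{\omega}_{\mathcal N(W)}\big).$$
   Context: An MV-algebra is a structure $(A,\oplus,\neg,0)$ with $(A,\oplus,0)$ a commutative monoid, $\neg\neg x=x$, $x\oplus 1=1$ where $1=\neg 0$, and $\neg(\neg x\oplus y)\oplus y=\neg(\neg y\oplus x)\oplus x$; it has an underlying distributive lattice with $x\vee y=\neg(\neg x\oplus y)\oplus y$, $x\wedge y=\neg(\neg x\vee\neg y)$. A Kleene algebra is a bounded distributive lattice $(A,\vee,\wedge,0,1)$ with a unary $\neg$ satisfying $\neg\neg x=x$, $\neg 0=1$, $\neg(x\wedge y)=\neg x\vee\neg y$ and $(x\wedge\neg x)\vee(y\vee\neg y)=y\vee\neg y$. Every MV-algebra $A$ has an underlying Kleene algebra $U(A)=(A,\vee,\wedge,\neg,0,1)$; this gives a forgetful functor $U$ from MV-algebras to Kleene algebras, and $F$ denotes its left adjoint; $F(B)$ is the MV-algebra freely generated by the Kleene algebra $B$. Let $K=\{0,\tfrac12,1\}$ be the three-element Kleene chain ($0<\tfrac12<1$, $\neg 0=1$, $\neg\tfrac12=\tfrac12$). Let $\preceq$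 be the partial order on $\{0,\tfrac12,1\}$ with $\tfrac12\preceq 0$, $\tfrac12\preceq 1$ and $0,1$ incomparable. For a finite Kleene algebra $B$, its dual Kleene space $D(B)$ has underlying set $W$ = the set of Kleene algebra homomorphisms $h\colon B\to K$, ordered pointwise by $\preceq$ ($h\preceq_W h'$ iff $h(b)\preceq h'(b)$ for all $b$), with distinguished subset $M=\{h\in W: h(B)\subseteq\{0,1\}\}$. The nerve $\mathcal N(W)$ is the abstract simplicial complex of all totally ordered subsets (chains) of the poset $(W,\preceq_W)$. The weight is $\omega(w)=1$ if $w\in M$ and $\omega(w)=2$ otherwise. Enumerate $W=\{w_1,\dots,w_d\}$ and let $e_1,\dots,e_d$ be the standard basis of $\mathbb R^d$; the companion polyhedron is $P^{\omega}_{\mathcal N(W)}=\bigcup_{S\in\mathcal N(W)}\mathrm{conv}\{e_i/\omega(w_i): w_i\in S\}\subseteq\mathbb R^d$. For $X\subseteq[0,1]^d$, a $\mathbb Z$-map on $X$ is the restriction to $X$ of a continuous function $\mathbb R^d\to\mathbb R$ that is piecewise linear with finitely many affine pieces, each an affine polynomial with integer coefficients; $\mathcal M(X)$ is the set of $\mathbb Z$-maps $X\to[0,1]$, an MV-algebra under pointwise operations $(f\oplus g)(x)=\min\{f(x)+g(x),1\}$, $(\neg f)(x)=1-f(x)$, $0$ the constant zero function. *)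

theory Defs
  imports "HOL-Algebra.Congruence" "HOL-Analysis.Analysis"
begin

section \<open>MV-algebras\<close>

record 'a mv = "'a partial_object" +
  mv_add :: "'a \<Rightarrow> 'a \<Rightarrow> 'a"
  mv_neg :: "'a \<Rightarrow> 'a"
  mv_zero :: 'a

definition mv_one :: "('a, 'm) mv_scheme \<Rightarrow> 'a" where
  "mv_one A = mv_neg A (mv_zero A)"

definition mv_join :: "('a, 'm) mv_scheme \<Rightarrow> 'a \<Rightarrow> 'a \<Rightarrow> 'a" where
  "mv_join A x y = mv_add A (mv_neg A (mv_add A (mv_neg A x) y)) y"

definition mv_meet :: "('a, 'm) mv_scheme \<Rightarrow> 'a \<Rightarrow> 'a \<Rightarrow> 'a" where
  "mv_meet A x y = mv_neg A (mv_join A (mv_neg A x) (mv_neg A y))"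

locale mv_algebra =
  fixes A :: "('a, 'm) mv_scheme"
  assumes add_closed: "x \<in> carrier A \<Longrightarrow> y \<in> carrier A \<Longrightarrow> mv_add A x y \<in> carrier A"
    and neg_closed: "x \<in> carrier A \<Longrightarrow> mv_neg A x \<in> carrier A"
    and zero_closed: "mv_zero A \<in> carrier A"
    and add_assoc: "x \<in> carrier A \<Longrightarrow> y \<in> carrier A \<Longrightarrow> z \<in> carrier A \<Longrightarrow>
      mv_add A (mv_add A x y) z = mv_add A x (mv_add A y z)"
    and add_comm: "x \<in> carrier A \<Longrightarrow> y \<in> carrier A \<Longrightarrow> mv_add A x y = mv_add A y x"
    and add_zero: "x \<in> carrier A \<Longrightarrow> mv_add A x (mv_zero A) = x"
    and neg_neg: "x \<in> carrier A \<Longrightarrow> mv_neg A (mv_neg A x) = x"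
    and add_one: "x \<in> carrier A \<Longrightarrow> mv_add A x (mv_one A) = mv_one A"
    and lukasiewicz: "x \<in> carrier A \<Longrightarrow> y \<in> carrier A \<Longrightarrow>
      mv_add A (mv_neg A (mv_add A (mv_neg A x) y)) y =
      mv_add A (mv_neg A (mv_add A (mv_neg A y) x)) x"

definition mv_hom :: "('a, 'm) mv_scheme \<Rightarrow> ('b, 'n) mv_scheme \<Rightarrow> ('a \<Rightarrow> 'b) set" where
  "mv_hom A B = {h \<in> carrier A \<rightarrow>\<^sub>E carrier B.
     (\<forall>x\<in>carrier A. \<forall>y\<in>carrier A. h (mv_add A x y) = mv_add B (h x) (h y)) \<and>
     (\<forall>x\<in>carrier A. h (mv_neg A x) = mv_neg B (h x)) \<and>
     h (mv_zero A) = mv_zero B}"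

definition mv_isomorphic :: "('a, 'm) mv_scheme \<Rightarrow> ('b, 'n) mv_scheme \<Rightarrow> bool" where
  "mv_isomorphic A B \<longleftrightarrow> (\<exists>h\<in>mv_hom A B. bij_betw h (carrier A) (carrier B))"

section \<open>Kleene algebras\<close>

record 'a kleene = "'a partial_object" +
  k_join :: "'a \<Rightarrow> 'a \<Rightarrow> 'a"
  k_meet :: "'a \<Rightarrow> 'a \<Rightarrow> 'a"
  k_neg :: "'a \<Rightarrow> 'a"
  k_zero :: 'a
  k_one :: 'a

locale kleene_algebra =
  fixes B :: "('a, 'm) kleene_scheme"
  assumes join_closed: "x \<in> carrier B \<Longrightarrow> y \<in> carrier B \<Longrightarrow> k_join B x y \<in> carrier B"
    and meet_closed: "x \<in> carrier B \<Longrightarrow> y \<in> carrier B \<Longrightarrow> k_meet B x y \<in> carrier B"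
    and neg_closed: "x \<in> carrier B \<Longrightarrow> k_neg B x \<in> carrier B"
    and zero_closed: "k_zero B \<in> carrier B"
    and one_closed: "k_one B \<in> carrier B"
    and join_assoc: "x \<in> carrier B \<Longrightarrow> y \<in> carrier B \<Longrightarrow> z \<in> carrier B \<Longrightarrow>
      k_join B (k_join B x y) z = k_join B x (k_join B y z)"
    and meet_assoc: "x \<in> carrier B \<Longrightarrow> y \<in> carrier B \<Longrightarrow> z \<in> carrier B \<Longrightarrow>
      k_meet B (k_meet B x y) z = k_meet B x (k_meet B y z)"
    and join_comm: "x \<in> carrier B \<Longrightarrow> y \<in> carrier B \<Longrightarrow> k_join B x y = k_join B y x"
    and meet_comm: "x \<in> carrier B \<Longrightarrow> y \<in> carrier B \<Longrightarrow> k_meet B x y = k_meet B y x"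
    and join_absorb: "x \<in> carrier B \<Longrightarrow> y \<in> carrier B \<Longrightarrow> k_join B x (k_meet B x y) = x"
    and meet_absorb: "x \<in> carrier B \<Longrightarrow> y \<in> carrier B \<Longrightarrow> k_meet B x (k_join B x y) = x"
    and distrib: "x \<in> carrier B \<Longrightarrow> y \<in> carrier B \<Longrightarrow> z \<in> carrier B \<Longrightarrow>
      k_meet B x (k_join B y z) = k_join B (k_meet B x y) (k_meet B x z)"
    and join_zero: "x \<in> carrier B \<Longrightarrow> k_join B x (k_zero B) = x"
    and meet_one: "x \<in> carrier B \<Longrightarrow> k_meet B x (k_one B) = x"
    and neg_neg: "x \<in> carrier B \<Longrightarrow> k_neg B (k_neg B x) = x"
    and neg_zero: "k_neg B (k_zero B) = k_one B"
    and de_morgan: "x \<in> carrier B \<Longrightarrow> y \<in> carrier B \<Longrightarrow>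
      k_neg B (k_meet B x y) = k_join B (k_neg B x) (k_neg B y)"
    and kleene: "x \<in> carrier B \<Longrightarrow> y \<in> carrier B \<Longrightarrow>
      k_join B (k_meet B x (k_neg B x)) (k_join B y (k_neg B y)) = k_join B y (k_neg B y)"

definition kleene_hom :: "('a, 'm) kleene_scheme \<Rightarrow> ('b, 'n) kleene_scheme \<Rightarrow> ('a \<Rightarrow> 'b) set" where
  "kleene_hom A B = {h \<in> carrier A \<rightarrow>\<^sub>E carrier B.
     (\<forall>x\<in>carrier A. \<forall>y\<in>carrier A. h (k_join A x y) = k_join B (h x) (h y)) \<and>
     (\<forall>x\<in>carrier A. \<forall>y\<in>carrier A. h (k_meet A x y) = k_meet B (h x) (h y)) \<and>
     (\<forall>x\<in>carrier A. h (k_neg A x) = k_neg B (h x)) \<and>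
     h (k_zero A) = k_zero B \<and> h (k_one A) = k_one B}"

definition underlying_kleene :: "('a, 'm) mv_scheme \<Rightarrow> 'a kleene" where
  "underlying_kleene A = \<lparr>carrier = carrier A, k_join = mv_join A, k_meet = mv_meet A,
     k_neg = mv_neg A, k_zero = mv_zero A, k_one = mv_one A\<rparr>"

section \<open>The MV-algebra freely generated by a Kleene algebra\<close>

text \<open>
  The value at \<open>B\<close> of the left adjoint of the forgetful functor is built by generators and
  relations: MV-terms over the elements of \<open>B\<close> modulo the least congruence that contains the
  MV-identities and makes \<open>b \<mapsto> [MV_Gen b]\<close> preserve the Kleene operations.  The
  universal property that characterizes it up to isomorphism is \<open>free_mv_universal\<close> below.
\<close>

datatype 'a mv_term = MV_Gen 'a | MV_Zero | MV_Neg "'a mv_term" | MV_Add "'a mv_term" "'a mv_term"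

definition mv_term_algebra :: "'a set \<Rightarrow> 'a mv_term mv" where
  "mv_term_algebra G = \<lparr>carrier = {t. set_mv_term t \<subseteq> G},
     mv_add = MV_Add, mv_neg = MV_Neg, mv_zero = MV_Zero\<rparr>"

abbreviation kleene_terms :: "('a, 'm) kleene_scheme \<Rightarrow> 'a mv_term mv" where
  "kleene_terms B \<equiv> mv_term_algebra (carrier B)"

inductive_set free_mv_cong :: "('a, 'm) kleene_scheme \<Rightarrow> ('a mv_term \<times> 'a mv_term) set"
  for B :: "('a, 'm) kleene_scheme"
  where
    refl: "s \<in> carrier (kleene_terms B) \<Longrightarrow> (s, s) \<in> free_mv_cong B"
  | sym: "(s, t) \<in> free_mv_cong B \<Longrightarrow> (t, s) \<in> free_mv_cong B"
  | trans: "(s, t) \<in> free_mv_cong B \<Longrightarrow> (t, u) \<in> free_mv_cong B \<Longrightarrow> (s, u) \<in> free_mv_cong B"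
  | neg: "(s, t) \<in> free_mv_cong B \<Longrightarrow> (mv_neg (kleene_terms B) s, mv_neg (kleene_terms B) t) \<in> free_mv_cong B"
  | add: "(s, s') \<in> free_mv_cong B \<Longrightarrow> (t, t') \<in> free_mv_cong B \<Longrightarrow>
      (mv_add (kleene_terms B) s t, mv_add (kleene_terms B) s' t') \<in> free_mv_cong B"
  | add_assoc: "s \<in> carrier (kleene_terms B) \<Longrightarrow> t \<in> carrier (kleene_terms B) \<Longrightarrow> u \<in> carrier (kleene_terms B) \<Longrightarrow>
      (mv_add (kleene_terms B) (mv_add (kleene_terms B) s t) u, mv_add (kleene_terms B) s (mv_add (kleene_terms B) t u)) \<in> free_mv_cong B"
  | add_comm: "s \<in> carrier (kleene_terms B) \<Longrightarrow> t \<in> carrier (kleene_terms B) \<Longrightarrow>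
      (mv_add (kleene_terms B) s t, mv_add (kleene_terms B) t s) \<in> free_mv_cong B"
  | add_zero: "s \<in> carrier (kleene_terms B) \<Longrightarrow> (mv_add (kleene_terms B) s (mv_zero (kleene_terms B)), s) \<in> free_mv_cong B"
  | neg_neg: "s \<in> carrier (kleene_terms B) \<Longrightarrow> (mv_neg (kleene_terms B) (mv_neg (kleene_terms B) s), s) \<in> free_mv_cong B"
  | add_one: "s \<in> carrier (kleene_terms B) \<Longrightarrow> (mv_add (kleene_terms B) s (mv_one (kleene_terms B)), mv_one (kleene_terms B)) \<in> free_mv_cong B"
  | lukasiewicz: "s \<in> carrier (kleene_terms B) \<Longrightarrow> t \<in> carrier (kleene_terms B) \<Longrightarrow>
      (mv_add (kleene_terms B) (mv_neg (kleene_terms B) (mv_add (kleene_terms B) (mv_neg (kleene_terms B) s) t)) t,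
       mv_add (kleene_terms B) (mv_neg (kleene_terms B) (mv_add (kleene_terms B) (mv_neg (kleene_terms B) t) s)) s) \<in> free_mv_cong B"
  | gen_join: "a \<in> carrier B \<Longrightarrow> b \<in> carrier B \<Longrightarrow>
      (MV_Gen (k_join B a b), mv_join (kleene_terms B) (MV_Gen a) (MV_Gen b)) \<in> free_mv_cong B"
  | gen_meet: "a \<in> carrier B \<Longrightarrow> b \<in> carrier B \<Longrightarrow>
      (MV_Gen (k_meet B a b), mv_meet (kleene_terms B) (MV_Gen a) (MV_Gen b)) \<in> free_mv_cong B"
  | gen_neg: "a \<in> carrier B \<Longrightarrow> (MV_Gen (k_neg B a), mv_neg (kleene_terms B) (MV_Gen a)) \<in> free_mv_cong B"
  | gen_zero: "(MV_Gen (k_zero B), mv_zero (kleene_terms B)) \<in> free_mv_cong B"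
  | gen_one: "(MV_Gen (k_one B), mv_one (kleene_terms B)) \<in> free_mv_cong B"

definition free_mv :: "('a, 'm) kleene_scheme \<Rightarrow> 'a mv_term set mv" where
  "free_mv B = \<lparr>carrier = carrier (kleene_terms B) // free_mv_cong B,
     mv_add = (\<lambda>X Y. \<Union>s\<in>X. \<Union>t\<in>Y. free_mv_cong B `` {MV_Add s t}),
     mv_neg = (\<lambda>X. \<Union>s\<in>X. free_mv_cong B `` {MV_Neg s}),
     mv_zero = free_mv_cong B `` {MV_Zero}\<rparr>"

definition free_mv_unit :: "('a, 'm) kleene_scheme \<Rightarrow> 'a \<Rightarrow> 'a mv_term set" where
  "free_mv_unit B = (\<lambda>b\<in>carrier B. free_mv_cong B `` {MV_Gen b})"

context
  fixes B :: "('a, 'm) kleene_scheme"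
  assumes B: "kleene_algebra B"
begin

interpretation kleene_algebra B by (rule B)

lemma free_mv_cong_carrier:
  "(s, t) \<in> free_mv_cong B \<Longrightarrow> s \<in> carrier (kleene_terms B) \<and> t \<in> carrier (kleene_terms B)"
  by (induction rule: free_mv_cong.induct)
     (auto simp: mv_term_algebra_def mv_one_def mv_join_def mv_meet_def
        join_closed meet_closed neg_closed zero_closed one_closed)

lemma equiv_free_mv_cong: "equiv (carrier (kleene_terms B)) (free_mv_cong B)"
proof (rule equivI)
  show "free_mv_cong B \<subseteq> carrier (kleene_terms B) \<times> carrier (kleene_terms B)"
    using free_mv_cong_carrier by auto
  show "refl_on (carrier (kleene_terms B)) (free_mv_cong B)"
    by (simp add: refl_on_def free_mv_cong.refl)
  show "Relation.sym (free_mv_cong B)"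
    by (rule symI) (rule free_mv_cong.sym)
  show "Relation.trans (free_mv_cong B)"
    by (rule transI) (rule free_mv_cong.trans)
qed

lemma free_mv_cong_class_eq:
  "(s, t) \<in> free_mv_cong B \<Longrightarrow> free_mv_cong B `` {s} = free_mv_cong B `` {t}"
  using equiv_class_eq[OF equiv_free_mv_cong] .

lemma free_mv_add_class:
  assumes "s \<in> carrier (kleene_terms B)" "t \<in> carrier (kleene_terms B)"
  shows "mv_add (free_mv B) (free_mv_cong B `` {s}) (free_mv_cong B `` {t}) =
    free_mv_cong B `` {MV_Add s t}"
proof -
  have "(\<lambda>s t. free_mv_cong B `` {MV_Add s t}) respects2 free_mv_cong B"
    using free_mv_cong.add[of _ _ B]
    by (intro congruent2I' free_mv_cong_class_eq) (auto simp: mv_term_algebra_def)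
  from UN_equiv_class2[OF equiv_free_mv_cong equiv_free_mv_cong this assms] show ?thesis
    by (simp add: free_mv_def)
qed

lemma free_mv_neg_class:
  assumes "s \<in> carrier (kleene_terms B)"
  shows "mv_neg (free_mv B) (free_mv_cong B `` {s}) = free_mv_cong B `` {MV_Neg s}"
proof -
  have "(\<lambda>s. free_mv_cong B `` {MV_Neg s}) respects free_mv_cong B"
    using free_mv_cong.neg[of _ _ B]
    by (intro congruentI free_mv_cong_class_eq) (auto simp: mv_term_algebra_def)
  from UN_equiv_class[OF equiv_free_mv_cong this assms] show ?thesis
    by (simp add: free_mv_def)
qed

lemma free_mv_carrierE:
  assumes "X \<in> carrier (free_mv B)"
  obtains s where "s \<in> carrier (kleene_terms B)" "X = free_mv_cong B `` {s}"
  using assms by (auto simp: free_mv_def elim: quotientE)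

lemma free_mv_class_closed:
  "s \<in> carrier (kleene_terms B) \<Longrightarrow> free_mv_cong B `` {s} \<in> carrier (free_mv B)"
  by (simp add: free_mv_def quotientI)

lemma kleene_terms_closed:
  "MV_Zero \<in> carrier (kleene_terms B)"
  "b \<in> carrier B \<Longrightarrow> MV_Gen b \<in> carrier (kleene_terms B)"
  "s \<in> carrier (kleene_terms B) \<Longrightarrow> MV_Neg s \<in> carrier (kleene_terms B)"
  "s \<in> carrier (kleene_terms B) \<Longrightarrow> t \<in> carrier (kleene_terms B) \<Longrightarrow>
    MV_Add s t \<in> carrier (kleene_terms B)"
  by (auto simp: mv_term_algebra_def)

lemma kleene_terms_ops:
  "mv_zero (kleene_terms B) = MV_Zero" "mv_neg (kleene_terms B) = MV_Neg"
  "mv_add (kleene_terms B) = MV_Add"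
  by (auto simp: mv_term_algebra_def)

lemma free_mv_zero_class: "mv_zero (free_mv B) = free_mv_cong B `` {MV_Zero}"
  by (simp add: free_mv_def)

lemmas free_mv_class_simps = free_mv_add_class free_mv_neg_class free_mv_zero_class
  free_mv_class_closed kleene_terms_closed

theorem mv_algebra_free_mv: "mv_algebra (free_mv B)"
proof
  fix X Y Z
  assume "X \<in> carrier (free_mv B)" "Y \<in> carrier (free_mv B)" "Z \<in> carrier (free_mv B)"
  then obtain s t u where st: "s \<in> carrier (kleene_terms B)" "t \<in> carrier (kleene_terms B)"
      "u \<in> carrier (kleene_terms B)" and eq: "X = free_mv_cong B `` {s}"
      "Y = free_mv_cong B `` {t}" "Z = free_mv_cong B `` {u}"
    by (metis free_mv_carrierE)
  show "mv_add (free_mv B) (mv_add (free_mv B) X Y) Z = mv_add (free_mv B) X (mv_add (free_mv B) Y Z)"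
    using free_mv_cong_class_eq[OF free_mv_cong.add_assoc[OF st]]
    by (simp add: eq st free_mv_class_simps kleene_terms_ops)
next
  fix X Y assume "X \<in> carrier (free_mv B)" "Y \<in> carrier (free_mv B)"
  then obtain s t where st: "s \<in> carrier (kleene_terms B)" "t \<in> carrier (kleene_terms B)"
      and eq: "X = free_mv_cong B `` {s}" "Y = free_mv_cong B `` {t}"
    by (metis free_mv_carrierE)
  show "mv_add (free_mv B) X Y \<in> carrier (free_mv B)"
    by (simp add: eq st free_mv_class_simps)
  show "mv_add (free_mv B) X Y = mv_add (free_mv B) Y X"
    using free_mv_cong_class_eq[OF free_mv_cong.add_comm[OF st]]
    by (simp add: eq st free_mv_class_simps kleene_terms_ops)
  show "mv_add (free_mv B) (mv_neg (free_mv B) (mv_add (free_mv B) (mv_neg (free_mv B) X) Y)) Y =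
      mv_add (free_mv B) (mv_neg (free_mv B) (mv_add (free_mv B) (mv_neg (free_mv B) Y) X)) X"
    using free_mv_cong_class_eq[OF free_mv_cong.lukasiewicz[OF st]]
    by (simp add: eq st free_mv_class_simps kleene_terms_ops)
next
  fix X assume "X \<in> carrier (free_mv B)"
  then obtain s where st: "s \<in> carrier (kleene_terms B)" and eq: "X = free_mv_cong B `` {s}"
    by (metis free_mv_carrierE)
  show "mv_neg (free_mv B) X \<in> carrier (free_mv B)"
    by (simp add: eq st free_mv_class_simps)
  show "mv_add (free_mv B) X (mv_zero (free_mv B)) = X"
    using free_mv_cong_class_eq[OF free_mv_cong.add_zero[OF st]]
    by (simp add: eq st free_mv_class_simps kleene_terms_ops)
  show "mv_neg (free_mv B) (mv_neg (free_mv B) X) = X"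
    using free_mv_cong_class_eq[OF free_mv_cong.neg_neg[OF st]]
    by (simp add: eq st free_mv_class_simps kleene_terms_ops)
  show "mv_add (free_mv B) X (mv_one (free_mv B)) = mv_one (free_mv B)"
    using free_mv_cong_class_eq[OF free_mv_cong.add_one[OF st]]
    by (simp add: eq st free_mv_class_simps kleene_terms_ops mv_one_def)
qed (simp add: free_mv_class_simps)

theorem free_mv_unit_hom: "free_mv_unit B \<in> kleene_hom B (underlying_kleene (free_mv B))"
proof -
  note defs = underlying_kleene_def mv_join_def mv_meet_def mv_one_def free_mv_unit_def
    free_mv_class_simps kleene_terms_ops join_closed meet_closed neg_closed zero_closed one_closed
  let ?U = "underlying_kleene (free_mv B)" and ?u = "free_mv_unit B"
  have "?u \<in> carrier B \<rightarrow>\<^sub>E carrier ?U"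
    by (auto simp: defs)
  moreover have "?u (k_join B x y) = k_join ?U (?u x) (?u y)"
    "?u (k_meet B x y) = k_meet ?U (?u x) (?u y)" if "x \<in> carrier B" "y \<in> carrier B" for x y
    using free_mv_cong_class_eq[OF free_mv_cong.gen_join[of x B y]]
      free_mv_cong_class_eq[OF free_mv_cong.gen_meet[of x B y]] that
    by (simp_all add: defs)
  moreover have "?u (k_neg B x) = k_neg ?U (?u x)" if "x \<in> carrier B" for x
    using free_mv_cong_class_eq[OF free_mv_cong.gen_neg[OF that]] that by (simp add: defs)
  moreover have "?u (k_zero B) = k_zero ?U"
    using free_mv_cong_class_eq[OF free_mv_cong.gen_zero] by (simp add: defs)
  moreover have "?u (k_one B) = k_one ?U"
    using free_mv_cong_class_eq[OF free_mv_cong.gen_one] by (simp add: defs)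
  ultimately show ?thesis
    unfolding kleene_hom_def by blast
qed

end

primrec mv_eval :: "('b, 'n) mv_scheme \<Rightarrow> ('a \<Rightarrow> 'b) \<Rightarrow> 'a mv_term \<Rightarrow> 'b" where
  "mv_eval A g (MV_Gen a) = g a"
| "mv_eval A g MV_Zero = mv_zero A"
| "mv_eval A g (MV_Neg t) = mv_neg A (mv_eval A g t)"
| "mv_eval A g (MV_Add s t) = mv_add A (mv_eval A g s) (mv_eval A g t)"

theorem free_mv_universal:
  fixes B :: "('a, 'm) kleene_scheme" and A :: "('b, 'n) mv_scheme"
  assumes B: "kleene_algebra B" and A: "mv_algebra A"
    and g: "g \<in> kleene_hom B (underlying_kleene A)"
  shows "\<exists>!h. h \<in> mv_hom (free_mv B) A \<and> (\<forall>b\<in>carrier B. h (free_mv_unit B b) = g b)"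
proof -
  interpret B: kleene_algebra B by (rule B)
  interpret A: mv_algebra A by (rule A)
  note cls = free_mv_class_simps[OF B]
  have g_closed: "g b \<in> carrier A" if "b \<in> carrier B" for b
    using g that by (auto simp: kleene_hom_def underlying_kleene_def)
  have ev_closed: "mv_eval A g s \<in> carrier A" if "s \<in> carrier (kleene_terms B)" for s
    using that by (induction s)
      (auto simp: mv_term_algebra_def g_closed A.add_closed A.neg_closed A.zero_closed)
  have ev_cong: "mv_eval A g s = mv_eval A g t" if "(s, t) \<in> free_mv_cong B" for s t
    using that
  proof (induction rule: free_mv_cong.induct)
    case (add_assoc s t u)
    then show ?case
      by (simp add: kleene_terms_ops[OF B] A.add_assoc ev_closed)
  next
    case (lukasiewicz s t)
    then show ?case
      using A.lukasiewicz ev_closed by (simp add: kleene_terms_ops[OF B])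
  next
    case (add_comm s t)
    then show ?case
      using A.add_comm ev_closed by (simp add: kleene_terms_ops[OF B])
  next
    case (add_one s)
    then show ?case
      using A.add_one ev_closed by (simp add: kleene_terms_ops[OF B] mv_one_def)
  qed (use g in \<open>simp_all add: kleene_terms_ops[OF B] A.add_zero A.neg_neg ev_closed
        mv_one_def mv_join_def mv_meet_def kleene_hom_def underlying_kleene_def\<close>)
  define h where "h = (\<lambda>X\<in>carrier (free_mv B). mv_eval A g (SOME s. s \<in> X))"
  have h_class: "h (free_mv_cong B `` {s}) = mv_eval A g s" if s: "s \<in> carrier (kleene_terms B)" for s
  proof -
    have "s \<in> free_mv_cong B `` {s}"
      using free_mv_cong.refl[OF s] by simp
    then have "(SOME t. t \<in> free_mv_cong B `` {s}) \<in> free_mv_cong B `` {s}"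
      by (rule someI)
    then have "(s, SOME t. t \<in> free_mv_cong B `` {s}) \<in> free_mv_cong B"
      by simp
    from ev_cong[OF this] show ?thesis
      using s by (simp add: h_def free_mv_class_closed[OF B] del: Image_singleton_iff)
  qed
  show ?thesis
  proof (rule ex1I[of _ h])
    have "h \<in> carrier (free_mv B) \<rightarrow>\<^sub>E carrier A"
    proof (rule PiE_I)
      show "h X \<in> carrier A" if "X \<in> carrier (free_mv B)" for X
        using that by (auto elim!: free_mv_carrierE[OF B] simp: h_class ev_closed)
    qed (simp add: h_def)
    then show "h \<in> mv_hom (free_mv B) A \<and> (\<forall>b\<in>carrier B. h (free_mv_unit B b) = g b)"
      by (auto simp: mv_hom_def free_mv_unit_def h_class cls elim!: free_mv_carrierE[OF B])
  next
    fix k assume k: "k \<in> mv_hom (free_mv B) A \<and> (\<forall>b\<in>carrier B. k (free_mv_unit B b) = g b)"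
    have k_class: "k (free_mv_cong B `` {s}) = mv_eval A g s" if "s \<in> carrier (kleene_terms B)" for s
      using that
    proof (induction s)
      case (MV_Gen b)
      then have "b \<in> carrier B" by (simp add: mv_term_algebra_def)
      moreover from this k have "k (free_mv_unit B b) = g b" by blast
      ultimately show ?case by (simp add: free_mv_unit_def)
    next
      case MV_Zero
      have "k (mv_zero (free_mv B)) = mv_zero A"
        using k by (simp add: mv_hom_def)
      then show ?case by (simp add: free_mv_zero_class[OF B])
    next
      case (MV_Neg s)
      then have s: "s \<in> carrier (kleene_terms B)" by (simp add: mv_term_algebra_def)
      have "k (mv_neg (free_mv B) (free_mv_cong B `` {s})) = mv_neg A (k (free_mv_cong B `` {s}))"
        using k free_mv_class_closed[OF B s] by (simp add: mv_hom_def)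
      then show ?case
        using MV_Neg.IH s by (simp add: free_mv_neg_class[OF B])
    next
      case (MV_Add s t)
      then have s: "s \<in> carrier (kleene_terms B)" and t: "t \<in> carrier (kleene_terms B)"
        by (simp_all add: mv_term_algebra_def)
      have "k (mv_add (free_mv B) (free_mv_cong B `` {s}) (free_mv_cong B `` {t})) =
          mv_add A (k (free_mv_cong B `` {s})) (k (free_mv_cong B `` {t}))"
        using k free_mv_class_closed[OF B s] free_mv_class_closed[OF B t] by (simp add: mv_hom_def)
      then show ?case
        using MV_Add.IH s t by (simp add: free_mv_add_class[OF B])
    qed
    show "k = h"
    proof
      fix X
      show "k X = h X"
      proof (cases "X \<in> carrier (free_mv B)")
        case True
        then show ?thesis
          by (auto elim!: free_mv_carrierE[OF B] simp: h_class k_class)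
      next
        case False
        then show ?thesis
          using k by (auto simp: h_def mv_hom_def PiE_def extensional_def)
      qed
    qed
  qed
qed

section \<open>The dual Kleene space of a finite Kleene algebra\<close>

definition K3 :: "real kleene" where
  "K3 = \<lparr>carrier = {0, 1/2, 1}, k_join = max, k_meet = min, k_neg = (\<lambda>x. 1 - x),
     k_zero = 0, k_one = 1\<rparr>"

lemma kleene_algebra_K3: "kleene_algebra K3"
  by unfold_locales (auto simp: K3_def)

definition K3_le :: "real \<Rightarrow> real \<Rightarrow> bool" where
  "K3_le x y \<longleftrightarrow> x \<in> {0, 1/2, 1} \<and> y \<in> {0, 1/2, 1} \<and> (x = y \<or> x = 1/2)"

definition dual_points :: "('a, 'm) kleene_scheme \<Rightarrow> ('a \<Rightarrow> real) set" where
  "dual_points B = kleene_hom B K3"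

definition dual_le :: "('a, 'm) kleene_scheme \<Rightarrow> ('a \<Rightarrow> real) \<Rightarrow> ('a \<Rightarrow> real) \<Rightarrow> bool" where
  "dual_le B h h' \<longleftrightarrow> (\<forall>b\<in>carrier B. K3_le (h b) (h' b))"

definition dual_M :: "('a, 'm) kleene_scheme \<Rightarrow> ('a \<Rightarrow> real) set" where
  "dual_M B = {h \<in> dual_points B. h ` carrier B \<subseteq> {0, 1}}"

definition dual_weight :: "('a, 'm) kleene_scheme \<Rightarrow> ('a \<Rightarrow> real) \<Rightarrow> nat" where
  "dual_weight B w = (if w \<in> dual_M B then 1 else 2)"

definition nerve :: "'w set \<Rightarrow> ('w \<Rightarrow> 'w \<Rightarrow> bool) \<Rightarrow> 'w set set" where
  "nerve W le = {S. S \<subseteq> W \<and> (\<forall>x\<in>S. \<forall>y\<in>S. le x y \<or> le y x)}"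

section \<open>The companion polyhedron and its MV-algebra of Z-maps\<close>

text \<open>
  Points of \<open>\<real>\<^sup>d\<close> are the elements of \<open>topspace (Euclidean_space d)\<close>, that is, real
  sequences vanishing from index \<open>d\<close> on; coordinates are numbered from 0.  The function type is
  not an instance of \<open>real_vector\<close>, so the convex hull of a finite set of points
  is spelled out as the set of their convex combinations.
\<close>

definition conv_finite :: "(nat \<Rightarrow> real) set \<Rightarrow> (nat \<Rightarrow> real) set" where
  "conv_finite V = {(\<lambda>j. \<Sum>v\<in>V. u v * v j) | u. (\<forall>v\<in>V. 0 \<le> u v) \<and> sum u V = 1}"

definition std_basis :: "nat \<Rightarrow> nat \<Rightarrow> real" where
  "std_basis i = (\<lambda>j. if j = i then 1 else 0)"

definition companion_polyhedron ::
    "nat \<Rightarrow> (nat \<Rightarrow> 'w) \<Rightarrow> 'w set set \<Rightarrow> ('w \<Rightarrow> nat) \<Rightarrow> (nat \<Rightarrow> real) set" where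
  "companion_polyhedron d w N \<omega> =
     (\<Union>S\<in>N. conv_finite {(\<lambda>j. std_basis i j / real (\<omega> (w i))) | i. i < d \<and> w i \<in> S})"

definition int_affine :: "nat \<Rightarrow> ((nat \<Rightarrow> real) \<Rightarrow> real) set" where
  "int_affine d = {(\<lambda>x. real_of_int c + (\<Sum>i<d. real_of_int (a i) * x i)) | (c :: int) (a :: nat \<Rightarrow> int). True}"

definition int_piecewise_linear :: "nat \<Rightarrow> ((nat \<Rightarrow> real) \<Rightarrow> real) \<Rightarrow> bool" where
  "int_piecewise_linear d f \<longleftrightarrow>
     continuous_map (Euclidean_space d) euclideanreal f \<and>
     (\<exists>L. finite L \<and> L \<subseteq> int_affine d \<and> (\<forall>x\<in>topspace (Euclidean_space d). \<exists>l\<in>L. f x = l x))"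

definition zmap_algebra :: "nat \<Rightarrow> (nat \<Rightarrow> real) set \<Rightarrow> ((nat \<Rightarrow> real) \<Rightarrow> real) mv" where
  "zmap_algebra d X =
     \<lparr>carrier = {restrict f X | f. int_piecewise_linear d f \<and> f ` X \<subseteq> {0..1}},
      mv_add = (\<lambda>f g. \<lambda>x\<in>X. min (f x + g x) 1),
      mv_neg = (\<lambda>f. \<lambda>x\<in>X. 1 - f x),
      mv_zero = (\<lambda>x\<in>X. 0)\<rparr>"

lemma int_piecewise_linear_const: "int_piecewise_linear d (\<lambda>x. real_of_int c)"
  unfolding int_piecewise_linear_def
  by (intro conjI exI[of _ "{\<lambda>x. real_of_int c}"])
     (auto simp: int_affine_def intro!: exI[of _ c] exI[of _ "\<lambda>_. 0"])

lemma int_affine_add: "l \<in> int_affine d \<Longrightarrow> m \<in> int_affine d \<Longrightarrow> (\<lambda>x. l x + m x) \<in> int_affine d"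
proof -
  assume "l \<in> int_affine d" "m \<in> int_affine d"
  then obtain c a c' a' where "l = (\<lambda>x. real_of_int c + (\<Sum>i<d. real_of_int (a i) * x i))"
    "m = (\<lambda>x. real_of_int c' + (\<Sum>i<d. real_of_int (a' i) * x i))"
    by (auto simp: int_affine_def)
  then have "(\<lambda>x. l x + m x) =
      (\<lambda>x. real_of_int (c + c') + (\<Sum>i<d. real_of_int (a i + a' i) * x i))"
    by (simp add: algebra_simps sum.distrib)
  then show ?thesis
    unfolding int_affine_def by (auto intro!: exI[of _ "c + c'"] exI[of _ "\<lambda>i. a i + a' i"])
qed

lemma int_affine_minus: "l \<in> int_affine d \<Longrightarrow> (\<lambda>x. - l x) \<in> int_affine d"
proof -
  assume "l \<in> int_affine d"
  then obtain c a where "l = (\<lambda>x. real_of_int c + (\<Sum>i<d. real_of_int (a i) * x i))"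
    by (auto simp: int_affine_def)
  then have "(\<lambda>x. - l x) = (\<lambda>x. real_of_int (- c) + (\<Sum>i<d. real_of_int (- a i) * x i))"
    by (simp add: sum_negf)
  then show ?thesis
    unfolding int_affine_def by (auto intro!: exI[of _ "- c"] exI[of _ "\<lambda>i. - a i"])
qed

lemma int_piecewise_linear_add:
  assumes "int_piecewise_linear d f" "int_piecewise_linear d g"
  shows "int_piecewise_linear d (\<lambda>x. f x + g x)"
proof -
  obtain L M where L: "finite L" "L \<subseteq> int_affine d" "\<forall>x\<in>topspace (Euclidean_space d). \<exists>l\<in>L. f x = l x"
    and M: "finite M" "M \<subseteq> int_affine d" "\<forall>x\<in>topspace (Euclidean_space d). \<exists>l\<in>M. g x = l x"
    using assms by (auto simp: int_piecewise_linear_def)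
  let ?S = "(\<lambda>(l, m) x. l x + m x) ` (L \<times> M)"
  have "finite ?S" using L M by simp
  moreover have "?S \<subseteq> int_affine d" using L(2) M(2) by (auto intro!: int_affine_add)
  moreover have "\<exists>l\<in>?S. f x + g x = l x" if x: "x \<in> topspace (Euclidean_space d)" for x
  proof -
    obtain l where l: "l \<in> L" "f x = l x"
      using bspec[OF L(3) x] by (rule bexE)
    obtain m where m: "m \<in> M" "g x = m x"
      using bspec[OF M(3) x] by (rule bexE)
    note lm = l m
    have "(\<lambda>x. l x + m x) \<in> ?S"
      using lm by (intro image_eqI[of _ _ "(l, m)"]) simp_all
    then show ?thesis
      by (rule bexI[rotated]) (simp only: lm)
  qed
  moreover have "continuous_map (Euclidean_space d) euclideanreal (\<lambda>x. f x + g x)"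
    using assms by (simp add: int_piecewise_linear_def continuous_map_add)
  ultimately show ?thesis
    unfolding int_piecewise_linear_def by (intro conjI exI[of _ ?S] ballI)
qed

lemma int_piecewise_linear_minus:
  assumes "int_piecewise_linear d f"
  shows "int_piecewise_linear d (\<lambda>x. - f x)"
proof -
  obtain L where L: "finite L" "L \<subseteq> int_affine d" "\<forall>x\<in>topspace (Euclidean_space d). \<exists>l\<in>L. f x = l x"
    using assms by (auto simp: int_piecewise_linear_def)
  let ?S = "(\<lambda>l x. - l x) ` L"
  have "finite ?S" using L by simp
  moreover have "?S \<subseteq> int_affine d" using L int_affine_minus by fastforce
  moreover have "\<forall>x\<in>topspace (Euclidean_space d). \<exists>l\<in>?S. - f x = l x"
    using L by fastforce
  ultimately show ?thesis
    using assms unfolding int_piecewise_linear_def by (blast intro: continuous_map_minus)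
qed

lemma int_piecewise_linear_min:
  assumes "int_piecewise_linear d f" "int_piecewise_linear d g"
  shows "int_piecewise_linear d (\<lambda>x. min (f x) (g x))"
proof -
  obtain L M where L: "finite L" "L \<subseteq> int_affine d" "\<forall>x\<in>topspace (Euclidean_space d). \<exists>l\<in>L. f x = l x"
    and M: "finite M" "M \<subseteq> int_affine d" "\<forall>x\<in>topspace (Euclidean_space d). \<exists>l\<in>M. g x = l x"
    using assms by (auto simp: int_piecewise_linear_def)
  have "\<forall>x\<in>topspace (Euclidean_space d). \<exists>l\<in>L \<union> M. min (f x) (g x) = l x"
    using L M by (fastforce simp: min_def)
  moreover have "finite (L \<union> M)" "L \<union> M \<subseteq> int_affine d" using L M by auto
  ultimately show ?thesis
    using assms unfolding int_piecewise_linear_def by (blast intro: continuous_map_real_min)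
qed

theorem mv_algebra_zmap_algebra: "mv_algebra (zmap_algebra d X)"
proof -
  let ?A = "zmap_algebra d X"
  have ops: "mv_add ?A = (\<lambda>f g. \<lambda>x\<in>X. min (f x + g x) 1)" "mv_neg ?A = (\<lambda>f. \<lambda>x\<in>X. 1 - f x)"
    "mv_zero ?A = (\<lambda>x\<in>X. 0)"
    by (simp_all add: zmap_algebra_def)
  have carr: "f \<in> extensional X \<and> (\<forall>x\<in>X. 0 \<le> f x \<and> f x \<le> 1)" if "f \<in> carrier ?A" for f
    using that by (auto simp: zmap_algebra_def)
  have eqI: "f = g" if "f \<in> extensional X" "g \<in> extensional X" "\<And>x. x \<in> X \<Longrightarrow> f x = g x"
    for f g :: "(nat \<Rightarrow> real) \<Rightarrow> real"
    using that by (rule extensionalityI)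
  show ?thesis
  proof
    fix f g assume "f \<in> carrier ?A" "g \<in> carrier ?A"
    then obtain f' g' where f': "f = restrict f' X" "int_piecewise_linear d f'" "f' ` X \<subseteq> {0..1}"
      and g': "g = restrict g' X" "int_piecewise_linear d g'" "g' ` X \<subseteq> {0..1}"
      by (auto simp: zmap_algebra_def)
    have "int_piecewise_linear d (\<lambda>x. min (f' x + g' x) 1)"
      using int_piecewise_linear_min[OF int_piecewise_linear_add[OF f'(2) g'(2)]
          int_piecewise_linear_const[of d 1]] by simp
    moreover have "(\<lambda>x\<in>X. min (f x + g x) 1) = restrict (\<lambda>x. min (f' x + g' x) 1) X"
      using f' g' by (auto simp: fun_eq_iff)
    moreover have "(\<lambda>x. min (f' x + g' x) 1) ` X \<subseteq> {0..1}"
      using f'(3) g'(3) by (force simp: image_subset_iff)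
    ultimately show "mv_add ?A f g \<in> carrier ?A"
      unfolding zmap_algebra_def by auto
  next
    fix f assume "f \<in> carrier ?A"
    then obtain f' where f': "f = restrict f' X" "int_piecewise_linear d f'" "f' ` X \<subseteq> {0..1}"
      by (auto simp: zmap_algebra_def)
    have "int_piecewise_linear d (\<lambda>x. 1 - f' x)"
      using int_piecewise_linear_add[OF int_piecewise_linear_const[of d 1]
          int_piecewise_linear_minus[OF f'(2)]] by simp
    moreover have "(\<lambda>x\<in>X. 1 - f x) = restrict (\<lambda>x. 1 - f' x) X"
      using f' by (auto simp: fun_eq_iff)
    moreover have "(\<lambda>x. 1 - f' x) ` X \<subseteq> {0..1}"
      using f'(3) by (force simp: image_subset_iff)
    ultimately show "mv_neg ?A f \<in> carrier ?A"
      unfolding zmap_algebra_def by auto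
  next
    show "mv_zero ?A \<in> carrier ?A"
      using int_piecewise_linear_const[of d 0] unfolding zmap_algebra_def by force
  next
    fix f g h assume "f \<in> carrier ?A" "g \<in> carrier ?A" "h \<in> carrier ?A"
    then have *: "0 \<le> f x" "0 \<le> g x" "0 \<le> h x" if "x \<in> X" for x
      using carr that by blast+
    show "mv_add ?A (mv_add ?A f g) h = mv_add ?A f (mv_add ?A g h)"
    proof (unfold ops, rule eqI)
      fix x assume "x \<in> X"
      with *[of x] show "(\<lambda>x\<in>X. min ((\<lambda>x\<in>X. min (f x + g x) 1) x + h x) 1) x =
          (\<lambda>x\<in>X. min (f x + (\<lambda>x\<in>X. min (g x + h x) 1) x) 1) x"
        by (simp add: min_def)
    qed simp_all
  next
    fix f g assume "f \<in> carrier ?A" "g \<in> carrier ?A"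
    then have *: "0 \<le> f x" "0 \<le> g x" "f x \<le> 1" "g x \<le> 1" if "x \<in> X" for x
      using carr that by blast+
    show "mv_add ?A f g = mv_add ?A g f"
      unfolding ops by (rule eqI) (auto simp: add.commute)
    show "mv_add ?A (mv_neg ?A (mv_add ?A (mv_neg ?A f) g)) g =
        mv_add ?A (mv_neg ?A (mv_add ?A (mv_neg ?A g) f)) f"
      unfolding ops by (rule eqI) (use * in \<open>auto simp: min_def\<close>)
  next
    fix f assume "f \<in> carrier ?A"
    then have ext: "f \<in> extensional X" and *: "\<And>x. x \<in> X \<Longrightarrow> 0 \<le> f x \<and> f x \<le> 1"
      using carr by blast+
    show "mv_add ?A f (mv_zero ?A) = f" "mv_neg ?A (mv_neg ?A f) = f"
      unfolding ops by (rule eqI; use ext * in \<open>simp add: min_def\<close>)+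
    show "mv_add ?A f (mv_one ?A) = mv_one ?A"
      unfolding ops mv_one_def by (rule eqI) (auto simp: min_def dest!: *)
  qed
qed

end

theory Submission
  imports Defs "HOL-Library.Multiset"
begin

text \<open>
  Each \<open>b \<in> B\<close> gives the function \<open>lin b x = (\<Sum>i. \<omega> i * w i b * x i)\<close> on \<open>P\<close>.  It is linear with integer
  coefficients, takes the value \<open>w i b\<close> at the \<open>i\<close>-th vertex, and turns the Kleene operations into
  pointwise ones because \<open>w i a\<close> and \<open>w i b\<close> are comparable in the same sense along a chain.  This
  induces a homomorphism from the free algebra to the Z-maps.

  Injectivity: two distinct elements of the free algebra differ in some chain quotient.  Finitely
  many elements of an MV-chain embed into \<open>[0, 1]\<close>: they lie in Chang's ordered group, where they
  satisfy finitely many linear inequalities over the integers, and by Fourier--Motzkin elimination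
  these also have a real solution.  The resulting Kleene homomorphism \<open>B \<rightarrow> [0, 1]\<close> is evaluation at a
  point of \<open>P\<close>, by averaging its thresholds.

  Surjectivity: the coordinate functions are MV-terms in the \<open>lin b\<close>, hence so is every truncated
  integral affine function, and a continuous piecewise linear function is a maximum of minima of its
  affine pieces (McNaughton's theorem).
\<close>

section \<open>MV-algebras and their chain quotients\<close>

text \<open>A chain quotient may contain infinitesimals and then has no embedding into
  \<open>[0, 1]\<close>. Only finitely many sums and comparisons can be carried over to the reals,
  namely those occurring in two given terms and in the relations of \<open>B\<close>; this is why
  the embedding is local and why solving a finite system of inequalities is enough. Chang's group is
  not constructed. What is used of it are sums of carrier elements, kept as an integer part and a
  remainder: summands commute, and adding an element is strictly monotone. The weight 2 is the
  denominator of the value 1/2. A point outside \<open>dual_M B\<close> takes this value, and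
  \<open>2 * 1/2\<close> is an integer coefficient; a Boolean point does not take it and keeps
  weight 1. The two kinds of vertices also need two ways to recover a coordinate: a Boolean point is
  maximal and is isolated by a single element \<open>b\<close> through \<open>b \<odot> b\<close>,
  while at the other points one subtracts the masses of principal down-sets.\<close>

context mv_algebra
begin

abbreviation madd (infixl "\<oplus>" 65) where "x \<oplus> y \<equiv> mv_add A x y"
abbreviation mneg ("\<sim> _" [81] 80) where "\<sim> x \<equiv> mv_neg A x"
abbreviation mone ("\<one>") where "\<one> \<equiv> mv_one A"
abbreviation mzero ("\<zero>") where "\<zero> \<equiv> mv_zero A"
abbreviation mdiff (infixl "\<ominus>" 65) where "x \<ominus> y \<equiv> \<sim> (\<sim> x \<oplus> y)"
abbreviation mmult (infixl "\<odot>" 70) where "x \<odot> y \<equiv> \<sim> (\<sim> x \<oplus> \<sim> y)"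
abbreviation mle (infix "\<sqsubseteq>" 50) where "x \<sqsubseteq> y \<equiv> \<sim> x \<oplus> y = \<one>"
abbreviation mmeet (infixl "\<sqinter>" 70) where "x \<sqinter> y \<equiv> mv_meet A x y"
abbreviation mjoin (infixl "\<squnion>" 65) where "x \<squnion> y \<equiv> mv_join A x y"

lemma one_closed: "\<one> \<in> carrier A"
  by (simp add: mv_one_def neg_closed zero_closed)

lemmas closed [simp] = add_closed neg_closed zero_closed one_closed

lemma join_closed [simp]: "x \<in> carrier A \<Longrightarrow> y \<in> carrier A \<Longrightarrow> x \<squnion> y \<in> carrier A"
  by (simp add: mv_join_def)

lemma meet_closed [simp]: "x \<in> carrier A \<Longrightarrow> y \<in> carrier A \<Longrightarrow> x \<sqinter> y \<in> carrier A"
  by (simp add: mv_meet_def)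

lemma neg_zero [simp]: "\<sim> \<zero> = \<one>" by (simp add: mv_one_def)
lemma neg_one [simp]: "\<sim> \<one> = \<zero>" by (simp add: mv_one_def neg_neg zero_closed del: neg_zero)

lemma zero_add: "x \<in> carrier A \<Longrightarrow> \<zero> \<oplus> x = x"
  by (simp add: add_comm[of "\<zero>"] add_zero)
lemma one_add: "x \<in> carrier A \<Longrightarrow> \<one> \<oplus> x = \<one>"
  by (simp add: add_comm[of "\<one>"] add_one)

lemmas units [simp] = add_zero add_one neg_neg zero_add one_add

lemma add_left_comm:
  "x \<in> carrier A \<Longrightarrow> y \<in> carrier A \<Longrightarrow> z \<in> carrier A \<Longrightarrow> x \<oplus> (y \<oplus> z) = y \<oplus> (x \<oplus> z)"
  by (metis add_assoc add_comm)

section \<open>Order, residuation and lattice operations\<close>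

lemma le_refl [simp]: "x \<in> carrier A \<Longrightarrow> x \<sqsubseteq> x"
  using lukasiewicz[of x "\<one>"] by simp

lemma add_neg [simp]: "x \<in> carrier A \<Longrightarrow> x \<oplus> \<sim> x = \<one>"
  using le_refl[of x] by (simp add: add_comm)

text \<open>The Lukasiewicz axiom is commutativity of the join, and one of its two forms collapses
  to \<open>y\<close> when \<open>x \<sqsubseteq> y\<close>. An inequality thus becomes an equation
  \<open>y = x \<oplus> z\<close>, from which transitivity and monotonicity follow by the monoid
  laws.\<close>

lemma le_add_diff:
  assumes "x \<in> carrier A" "y \<in> carrier A" "x \<sqsubseteq> y" shows "x \<oplus> (y \<ominus> x) = y"
  using lukasiewicz[of x y] assms by (simp add: add_comm)

lemma le_add [simp]: "x \<in> carrier A \<Longrightarrow> y \<in> carrier A \<Longrightarrow> x \<sqsubseteq> x \<oplus> y"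
  by (simp add: add_assoc[symmetric])

lemma le_add2 [simp]: "x \<in> carrier A \<Longrightarrow> y \<in> carrier A \<Longrightarrow> x \<sqsubseteq> y \<oplus> x"
  by (subst (2) add_comm) (simp_all del: closed add: closed)

lemma le_antisym: "x \<in> carrier A \<Longrightarrow> y \<in> carrier A \<Longrightarrow> x \<sqsubseteq> y \<Longrightarrow> y \<sqsubseteq> x \<Longrightarrow> x = y"
  using lukasiewicz[of x y] by simp

lemma le_trans:
  assumes [simp]: "x \<in> carrier A" "y \<in> carrier A" "z \<in> carrier A" and "x \<sqsubseteq> y" "y \<sqsubseteq> z"
  shows "x \<sqsubseteq> z"
proof -
  have "x \<oplus> ((y \<ominus> x) \<oplus> (z \<ominus> y)) = z"
    using le_add_diff[of x y] le_add_diff[of y z] assms by (simp add: add_assoc[symmetric])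
  then show ?thesis using le_add[of x "(y \<ominus> x) \<oplus> (z \<ominus> y)"] by (simp only: closed assms)
qed

lemma le_zero: "x \<in> carrier A \<Longrightarrow> x \<sqsubseteq> \<zero> \<Longrightarrow> x = \<zero>"
  by (rule le_antisym) auto

lemma add_mono:
  assumes [simp]: "x \<in> carrier A" "y \<in> carrier A" "u \<in> carrier A" "v \<in> carrier A"
    and "x \<sqsubseteq> y" "u \<sqsubseteq> v"
  shows "x \<oplus> u \<sqsubseteq> y \<oplus> v"
proof -
  have "y \<oplus> v = (x \<oplus> (y \<ominus> x)) \<oplus> (u \<oplus> (v \<ominus> u))"
    by (simp only: le_add_diff[OF assms(1,2,5)] le_add_diff[OF assms(3,4,6)])
  also have "\<dots> = (x \<oplus> u) \<oplus> ((y \<ominus> x) \<oplus> (v \<ominus> u))"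
    by (metis add_assoc add_left_comm assms(1-4) closed(1,2))
  finally have eq: "(x \<oplus> u) \<oplus> ((y \<ominus> x) \<oplus> (v \<ominus> u)) = y \<oplus> v" ..
  show ?thesis by (subst eq[symmetric], rule le_add) simp_all
qed

lemma neg_le_neg: "x \<in> carrier A \<Longrightarrow> y \<in> carrier A \<Longrightarrow> \<sim> y \<sqsubseteq> \<sim> x \<longleftrightarrow> x \<sqsubseteq> y"
  by (simp add: add_comm)

text \<open>Residuation: both sides unfold to the same sum by associativity. Subtraction is thereby
  left adjoint to addition, the main tool for the inequalities below.\<close>

lemma diff_le_iff:
  "x \<in> carrier A \<Longrightarrow> y \<in> carrier A \<Longrightarrow> z \<in> carrier A \<Longrightarrow> x \<ominus> y \<sqsubseteq> z \<longleftrightarrow> x \<sqsubseteq> y \<oplus> z"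
  by (simp add: add_assoc)

lemma diff_eq_zero_iff: "x \<in> carrier A \<Longrightarrow> y \<in> carrier A \<Longrightarrow> x \<ominus> y = \<zero> \<longleftrightarrow> x \<sqsubseteq> y"
  by (metis closed neg_neg neg_zero neg_one)

lemma le_add_diff_self: "x \<in> carrier A \<Longrightarrow> y \<in> carrier A \<Longrightarrow> x \<sqsubseteq> y \<oplus> (x \<ominus> y)"
  by (subst diff_le_iff[symmetric]) auto

lemma diff_le_self: "x \<in> carrier A \<Longrightarrow> y \<in> carrier A \<Longrightarrow> x \<ominus> y \<sqsubseteq> x"
  by (subst diff_le_iff) auto

lemma join_comm: "x \<in> carrier A \<Longrightarrow> y \<in> carrier A \<Longrightarrow> x \<squnion> y = y \<squnion> x"
  unfolding mv_join_def by (rule lukasiewicz)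

lemma le_join2: "x \<in> carrier A \<Longrightarrow> y \<in> carrier A \<Longrightarrow> y \<sqsubseteq> x \<squnion> y"
  unfolding mv_join_def by simp

lemma le_join1: "x \<in> carrier A \<Longrightarrow> y \<in> carrier A \<Longrightarrow> x \<sqsubseteq> x \<squnion> y"
  using le_join2[of y x] by (simp add: join_comm)

lemma join_least:
  assumes [simp]: "x \<in> carrier A" "y \<in> carrier A" "z \<in> carrier A" and "x \<sqsubseteq> z" "y \<sqsubseteq> z"
  shows "x \<squnion> y \<sqsubseteq> z"
proof -
  have eq: "y \<oplus> (z \<ominus> y) = z" using assms by (simp add: le_add_diff)
  have "x \<ominus> y \<sqsubseteq> z \<ominus> y" by (subst diff_le_iff) (simp_all add: eq assms)
  then have "(x \<ominus> y) \<oplus> y \<sqsubseteq> (z \<ominus> y) \<oplus> y" by (intro add_mono) auto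
  then show ?thesis using eq by (simp add: mv_join_def add_comm)
qed

lemma meet_le1: "x \<in> carrier A \<Longrightarrow> y \<in> carrier A \<Longrightarrow> x \<sqinter> y \<sqsubseteq> x"
  using le_join1[of "\<sim> x" "\<sim> y"] by (simp add: mv_meet_def add_comm)

lemma meet_le2: "x \<in> carrier A \<Longrightarrow> y \<in> carrier A \<Longrightarrow> x \<sqinter> y \<sqsubseteq> y"
  using le_join2[of "\<sim> x" "\<sim> y"] by (simp add: mv_meet_def add_comm)

lemma meet_greatest:
  assumes [simp]: "x \<in> carrier A" "y \<in> carrier A" "z \<in> carrier A" and "z \<sqsubseteq> x" "z \<sqsubseteq> y"
  shows "z \<sqsubseteq> x \<sqinter> y"
  using join_least[of "\<sim> x" "\<sim> y" "\<sim> z"] assms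
  by (simp add: mv_meet_def add_comm)

lemma meet_eq_diff: "x \<in> carrier A \<Longrightarrow> y \<in> carrier A \<Longrightarrow> x \<sqinter> y = (x \<oplus> \<sim> y) \<ominus> \<sim> y"
  by (simp add: mv_meet_def mv_join_def)

text \<open>Subtracting \<open>a\<close> turns the two hypotheses into bounds on
  \<open>z \<ominus> a\<close> by \<open>x\<close> and by \<open>y\<close>, hence by their
  meet.\<close>

lemma le_add_meet:
  assumes [simp]: "a \<in> carrier A" "x \<in> carrier A" "y \<in> carrier A" "z \<in> carrier A"
    and "z \<sqsubseteq> a \<oplus> x" "z \<sqsubseteq> a \<oplus> y"
  shows "z \<sqsubseteq> a \<oplus> x \<sqinter> y"
proof -
  have "z \<ominus> a \<sqsubseteq> x" "z \<ominus> a \<sqsubseteq> y" using assms diff_le_iff by blast+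
  then have "z \<ominus> a \<sqsubseteq> x \<sqinter> y" by (intro meet_greatest) auto
  then show ?thesis by (subst (asm) diff_le_iff) auto
qed

text \<open>This prelinearity law is what makes prime ideals yield chains. Both differences are at
  most the differences from \<open>m\<close>, so their meet \<open>r\<close> satisfies
  \<open>m \<oplus> r \<sqsubseteq> x \<sqinter> y = m\<close>. Since
  \<open>(m \<oplus> r) \<ominus> m = r \<sqinter> \<sim> m\<close> and
  \<open>r \<sqsubseteq> \<sim> m\<close>, only \<open>r = \<zero>\<close> remains.\<close>

lemma diff_meet_diff:
  assumes [simp]: "x \<in> carrier A" "y \<in> carrier A"
  shows "(x \<ominus> y) \<sqinter> (y \<ominus> x) = \<zero>"
proof -
  define m where "m = x \<sqinter> y"
  define r where "r = (x \<ominus> y) \<sqinter> (y \<ominus> x)"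
  have [simp]: "m \<in> carrier A" "r \<in> carrier A" by (simp_all add: m_def r_def)
  have m: "m \<sqsubseteq> x" "m \<sqsubseteq> y" unfolding m_def by (rule meet_le1 meet_le2; simp)+
  have r: "r \<sqsubseteq> x \<ominus> y" "r \<sqsubseteq> y \<ominus> x" unfolding r_def by (rule meet_le1 meet_le2; simp)+
  have *: "u \<ominus> v \<sqsubseteq> u \<ominus> m" if "m \<sqsubseteq> v" and [simp]: "u \<in> carrier A" "v \<in> carrier A" for u v
  proof -
    have 1: "m \<oplus> (u \<ominus> m) \<sqsubseteq> v \<oplus> (u \<ominus> m)" by (rule add_mono) (use that in auto)
    have 2: "u \<sqsubseteq> m \<oplus> (u \<ominus> m)" by (simp add: le_add_diff_self)
    have "u \<sqsubseteq> v \<oplus> (u \<ominus> m)" by (rule le_trans[OF _ _ _ 2 1]) simp_all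
    then show ?thesis by (subst diff_le_iff) auto
  qed
  have rx: "r \<sqsubseteq> x \<ominus> m" by (rule le_trans[OF _ _ _ r(1) *]) (use m in auto)
  have ry: "r \<sqsubseteq> y \<ominus> m" by (rule le_trans[OF _ _ _ r(2) *]) (use m in auto)
  have "m \<oplus> r \<sqsubseteq> m \<oplus> (x \<ominus> m)" "m \<oplus> r \<sqsubseteq> m \<oplus> (y \<ominus> m)"
    by (rule add_mono; use rx ry in simp)+
  then have "m \<oplus> r \<sqsubseteq> x" "m \<oplus> r \<sqsubseteq> y" using m le_add_diff by auto
  then have "m \<oplus> r \<sqsubseteq> x \<sqinter> y" by (intro meet_greatest) auto
  then have "m \<oplus> r \<sqsubseteq> m" by (simp only: m_def)
  then have "(m \<oplus> r) \<ominus> m = \<zero>" by (subst diff_eq_zero_iff) auto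
  then have 0: "r \<sqinter> \<sim> m = \<zero>" by (simp add: meet_eq_diff add_comm)
  have "x \<ominus> m \<sqsubseteq> \<sim> m" by (subst neg_le_neg) auto
  from le_trans[OF _ _ _ rx this] have "r \<sqsubseteq> \<sim> m" by simp
  then have "r \<sqsubseteq> r \<sqinter> \<sim> m" by (intro meet_greatest) auto
  then show ?thesis using le_zero[of r] 0 by (simp add: r_def)
qed

text \<open>For the meet \<open>r\<close> one has
  \<open>r \<sqsubseteq> b \<oplus> c \<sqinter> r\<close>, and
  \<open>c \<sqinter> r \<sqsubseteq> a \<sqinter> c\<close> vanishes, so
  \<open>r \<sqsubseteq> b\<close> and hence \<open>r \<sqsubseteq> a \<sqinter> b\<close>.\<close>

lemma meet_add_zero:
  assumes [simp]: "a \<in> carrier A" "b \<in> carrier A" "c \<in> carrier A"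
    and "a \<sqinter> b = \<zero>" "a \<sqinter> c = \<zero>"
  shows "a \<sqinter> (b \<oplus> c) = \<zero>"
proof -
  define r where "r = a \<sqinter> (b \<oplus> c)"
  have [simp]: "r \<in> carrier A" by (simp add: r_def)
  have r: "r \<sqsubseteq> a" "r \<sqsubseteq> b \<oplus> c" unfolding r_def by (rule meet_le1 meet_le2; simp)+
  have "r \<sqsubseteq> b \<oplus> c \<sqinter> r" by (rule le_add_meet) (use r in auto)
  moreover have "c \<sqinter> r \<sqsubseteq> a \<sqinter> c"
    by (rule meet_greatest; (rule le_trans[OF _ _ _ meet_le2 r(1)] meet_le1)?; simp)
  ultimately have "r \<sqsubseteq> b" using assms le_zero[of "c \<sqinter> r"] by simp
  then have "r \<sqsubseteq> a \<sqinter> b" using r by (intro meet_greatest) auto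
  then show ?thesis using le_zero[of r] assms by (simp add: r_def)
qed

lemma meet_commute: "x \<in> carrier A \<Longrightarrow> y \<in> carrier A \<Longrightarrow> x \<sqinter> y = y \<sqinter> x"
  by (simp add: mv_meet_def join_comm)

section \<open>Ideals and prime ideals\<close>

definition multiple :: "nat \<Rightarrow> 'a \<Rightarrow> 'a" where "multiple n x = ((\<oplus>) x ^^ n) \<zero>"

lemma multiple_0 [simp]: "multiple 0 x = \<zero>"
  and multiple_Suc: "multiple (Suc n) x = x \<oplus> multiple n x"
  by (simp_all add: multiple_def)

lemma multiple_closed [simp]: "x \<in> carrier A \<Longrightarrow> multiple n x \<in> carrier A"
  by (induction n) (simp_all add: multiple_Suc)

lemma multiple_add: "x \<in> carrier A \<Longrightarrow> multiple (m + n) x = multiple m x \<oplus> multiple n x"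
  by (induction m) (simp_all add: multiple_Suc add_assoc)

lemma meet_multiple_zero:
  "a \<in> carrier A \<Longrightarrow> x \<in> carrier A \<Longrightarrow> a \<sqinter> x = \<zero> \<Longrightarrow> a \<sqinter> multiple n x = \<zero>"
proof (induction n)
  case 0
  then show ?case using meet_le2[of a "\<zero>"] le_zero[of "a \<sqinter> \<zero>"] by simp
qed (simp add: multiple_Suc meet_add_zero)

lemma multiple_meet_multiple_zero:
  assumes "x \<in> carrier A" "y \<in> carrier A" "x \<sqinter> y = \<zero>"
  shows "multiple m x \<sqinter> multiple n y = \<zero>"
  using meet_multiple_zero[of "multiple n y" x m] meet_multiple_zero[of x y n] assms
  by (simp add: meet_commute)

definition mv_ideal :: "'a set \<Rightarrow> bool" where
  "mv_ideal I \<longleftrightarrow> I \<subseteq> carrier A \<and> \<zero> \<in> I \<and>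
     (\<forall>x\<in>I. \<forall>y\<in>carrier A. y \<sqsubseteq> x \<longrightarrow> y \<in> I) \<and> (\<forall>x\<in>I. \<forall>y\<in>I. x \<oplus> y \<in> I)"

lemma mv_idealD:
  assumes "mv_ideal I"
  shows "I \<subseteq> carrier A" "\<zero> \<in> I" "x \<in> I \<Longrightarrow> y \<in> carrier A \<Longrightarrow> y \<sqsubseteq> x \<Longrightarrow> y \<in> I"
    "x \<in> I \<Longrightarrow> y \<in> I \<Longrightarrow> x \<oplus> y \<in> I"
  using assms unfolding mv_ideal_def by blast+

lemma mv_ideal_insert:
  assumes I: "mv_ideal I" and p [simp]: "p \<in> carrier A"
  defines "J \<equiv> {x \<in> carrier A. \<exists>i\<in>I. \<exists>n. x \<sqsubseteq> i \<oplus> multiple n p}"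
  shows "mv_ideal J" "I \<subseteq> J" "p \<in> J"
proof -
  have Ic [simp]: "i \<in> carrier A" if "i \<in> I" for i using I that by (auto simp: mv_ideal_def)
  have down: "y \<in> J" if "x \<in> J" and [simp]: "y \<in> carrier A" and "y \<sqsubseteq> x" for x y
  proof -
    obtain i n where "i \<in> I" "x \<sqsubseteq> i \<oplus> multiple n p" "x \<in> carrier A"
      using \<open>x \<in> J\<close> by (auto simp: J_def)
    then have "y \<sqsubseteq> i \<oplus> multiple n p" by (intro le_trans[OF _ _ _ \<open>y \<sqsubseteq> x\<close>]) simp_all
    then show ?thesis using \<open>i \<in> I\<close> by (auto simp: J_def)
  qed
  have plus: "x \<oplus> y \<in> J" if xy: "x \<in> J" "y \<in> J" for x y
  proof -
    obtain i m j n where *: "i \<in> I" "x \<sqsubseteq> i \<oplus> multiple m p" "j \<in> I" "y \<sqsubseteq> j \<oplus> multiple n p"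
      and [simp]: "x \<in> carrier A" "y \<in> carrier A" using xy by (auto simp: J_def)
    have "x \<oplus> y \<sqsubseteq> (i \<oplus> multiple m p) \<oplus> (j \<oplus> multiple n p)"
      by (rule add_mono) (use * in simp_all)
    also have "(i \<oplus> multiple m p) \<oplus> (j \<oplus> multiple n p) = (i \<oplus> j) \<oplus> multiple (m + n) p"
      using * by (simp add: multiple_add add_assoc add_left_comm[of "multiple m p" j])
    finally have "x \<oplus> y \<sqsubseteq> (i \<oplus> j) \<oplus> multiple (m + n) p" .
    moreover have "i \<oplus> j \<in> I" using mv_idealD(4)[OF I] * by blast
    ultimately show ?thesis unfolding J_def by (simp only: mem_Collect_eq) (meson \<open>x \<in> carrier A\<close> \<open>y \<in> carrier A\<close> closed(1))
  qed
  have 0: "\<zero> \<in> I" using I by (simp add: mv_ideal_def)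
  show "I \<subseteq> J"
  proof
    fix x assume "x \<in> I"
    then have "x \<sqsubseteq> x \<oplus> multiple 0 p" by simp
    with \<open>x \<in> I\<close> Ic show "x \<in> J" unfolding J_def by blast
  qed
  have "p \<sqsubseteq> \<zero> \<oplus> multiple 1 p" by (simp add: multiple_Suc)
  with 0 p show "p \<in> J" unfolding J_def by blast
  show "mv_ideal J"
    unfolding mv_ideal_def using down plus 0 \<open>I \<subseteq> J\<close> by (metis (no_types, lifting) J_def mem_Collect_eq subsetD subsetI)
qed

text \<open>Zorn's lemma gives an ideal maximal among those avoiding \<open>d\<close>. If it
  contained neither difference, adjoining either one would capture \<open>d\<close>; since multiples
  of \<open>x \<ominus> y\<close> and of \<open>y \<ominus> x\<close> meet in
  \<open>\<zero>\<close>, \<open>d\<close> would already lie below an element of the ideal.\<close>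

lemma prime_ideal_exists:
  assumes d [simp]: "d \<in> carrier A" and "d \<noteq> \<zero>"
  obtains I where "mv_ideal I" "d \<notin> I"
    "\<And>x y. x \<in> carrier A \<Longrightarrow> y \<in> carrier A \<Longrightarrow> x \<ominus> y \<in> I \<or> y \<ominus> x \<in> I"
proof -
  define F where "F = {I. mv_ideal I \<and> d \<notin> I}"
  have "{\<zero>} \<in> F" using \<open>d \<noteq> \<zero>\<close> by (auto simp: F_def mv_ideal_def dest: le_zero)
  then have "F \<noteq> {}" by blast
  moreover have "\<Union>C \<in> F" if C: "C \<noteq> {}" "subset.chain F C" for C
  proof -
    have CF: "\<And>I. I \<in> C \<Longrightarrow> mv_ideal I \<and> d \<notin> I" and tot: "\<And>I J. I \<in> C \<Longrightarrow> J \<in> C \<Longrightarrow> I \<subseteq> J \<or> J \<subseteq> I"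
      using C by (auto simp: subset_chain_def F_def)
    have "x \<oplus> y \<in> \<Union>C" if xy: "x \<in> \<Union>C" "y \<in> \<Union>C" for x y
    proof -
      obtain I J where "I \<in> C" "x \<in> I" "J \<in> C" "y \<in> J" using xy by blast
      then obtain K where "K \<in> C" "x \<in> K" "y \<in> K" using tot[of I J] by blast
      then show ?thesis using CF[of K] mv_idealD(4) by blast
    qed
    moreover have "\<zero> \<in> \<Union>C" using C(1) CF mv_idealD(2) by blast
    moreover have "y \<in> \<Union>C" if "x \<in> \<Union>C" "y \<in> carrier A" "y \<sqsubseteq> x" for x y
      using that CF mv_idealD(3) by blast
    moreover have "\<Union>C \<subseteq> carrier A" using CF mv_idealD(1) by blast
    ultimately have "mv_ideal (\<Union>C)" unfolding mv_ideal_def by blast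
    then show ?thesis using CF by (auto simp: F_def)
  qed
  ultimately obtain I where "I \<in> F" and max: "\<And>J. J \<in> F \<Longrightarrow> I \<subseteq> J \<Longrightarrow> J = I"
    using subset_Zorn_nonempty[of F] by blast
  then have I: "mv_ideal I" "d \<notin> I" by (auto simp: F_def)
  then have Ic [simp]: "i \<in> carrier A" if "i \<in> I" for i using that mv_idealD(1) by blast
  have witness: "\<exists>i\<in>I. \<exists>n. d \<sqsubseteq> i \<oplus> multiple n p" if "p \<notin> I" and [simp]: "p \<in> carrier A" for p
  proof -
    let ?J = "{x \<in> carrier A. \<exists>i\<in>I. \<exists>n. x \<sqsubseteq> i \<oplus> multiple n p}"
    have "?J \<notin> F" using max[of ?J] mv_ideal_insert(2,3)[OF I(1), of p] that by blast
    then have "d \<in> ?J" using mv_ideal_insert(1)[OF I(1), of p] that unfolding F_def by blast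
    then show ?thesis by blast
  qed
  have "x \<ominus> y \<in> I \<or> y \<ominus> x \<in> I" if [simp]: "x \<in> carrier A" "y \<in> carrier A" for x y
  proof (rule ccontr)
    let ?p = "x \<ominus> y" and ?q = "y \<ominus> x"
    assume "\<not> ?thesis"
    then obtain i j m n where i: "i \<in> I" "d \<sqsubseteq> i \<oplus> multiple m ?p" and j: "j \<in> I" "d \<sqsubseteq> j \<oplus> multiple n ?q"
      using witness[of ?p] witness[of ?q] by auto
    have le: "d \<sqsubseteq> (i \<oplus> j) \<oplus> r" if "d \<sqsubseteq> k \<oplus> r" "k = i \<or> k = j" and [simp]: "r \<in> carrier A" for k r
    proof (rule le_trans[OF _ _ _ that(1)])
      show "k \<oplus> r \<sqsubseteq> (i \<oplus> j) \<oplus> r"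
        by (rule add_mono) (use that i j in auto)
    qed (use that i j in auto)
    have "d \<sqsubseteq> (i \<oplus> j) \<oplus> multiple m ?p \<sqinter> multiple n ?q"
      by (rule le_add_meet) (use i j le in auto)
    also have "multiple m ?p \<sqinter> multiple n ?q = \<zero>"
      by (rule multiple_meet_multiple_zero) (auto intro: diff_meet_diff)
    finally have "d \<sqsubseteq> i \<oplus> j" using i j by simp
    then show False using mv_idealD(3)[OF I(1) mv_idealD(4)[OF I(1)]] i j I(2) d by blast
  qed
  with I show ?thesis using that by blast
qed

end

locale mv_chain = mv_algebra +
  assumes total: "x \<in> carrier A \<Longrightarrow> y \<in> carrier A \<Longrightarrow>
    mv_add A (mv_neg A x) y = mv_one A \<or> mv_add A (mv_neg A y) x = mv_one A"

context mv_algebra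
begin

text \<open>The quotient by a prime ideal is realised on a set of representatives, so that it lives on the
  same type.\<close>

lemma chain_quotient_separates:
  assumes ab [simp]: "a \<in> carrier A" "b \<in> carrier A" and "a \<noteq> b"
  obtains C :: "'a mv" and h where "mv_chain C" "h \<in> mv_hom A C" "h a \<noteq> h b"
proof -
  \<comment> \<open>Chang's distance of \<open>a\<close> and \<open>b\<close>, which vanishes only
    if \<open>a = b\<close>; an ideal avoiding it keeps their classes apart.\<close>
  define d where "d = (a \<ominus> b) \<oplus> (b \<ominus> a)"
  have "d \<noteq> \<zero>"
  proof
    assume "d = \<zero>"
    then have "a \<ominus> b \<sqsubseteq> \<zero>" "b \<ominus> a \<sqsubseteq> \<zero>"
      using le_add[of "a \<ominus> b" "b \<ominus> a"] le_add2[of "b \<ominus> a" "a \<ominus> b"] unfolding d_def by auto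
    then have "a \<sqsubseteq> b" "b \<sqsubseteq> a" by (simp_all add: diff_le_iff)
    then show False using \<open>a \<noteq> b\<close> le_antisym ab by blast
  qed
  moreover have "d \<in> carrier A" by (simp add: d_def)
  ultimately obtain I where I: "mv_ideal I" "d \<notin> I"
    and prime: "\<And>x y. x \<in> carrier A \<Longrightarrow> y \<in> carrier A \<Longrightarrow> x \<ominus> y \<in> I \<or> y \<ominus> x \<in> I"
    using prime_ideal_exists by blast
  have Idown: "y \<in> I" if "y \<sqsubseteq> x" "x \<in> I" "y \<in> carrier A" for x y
    using mv_idealD(3)[OF I(1)] that by blast
  have Iadd: "x \<oplus> y \<in> I" if "x \<in> I" "y \<in> I" for x y using mv_idealD(4)[OF I(1)] that by blast
  define R where "R x y \<longleftrightarrow> x \<ominus> y \<in> I \<and> y \<ominus> x \<in> I" for x y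
  have diff_trans: "x \<ominus> z \<in> I" if "x \<ominus> y \<in> I" "y \<ominus> z \<in> I"
    and [simp]: "x \<in> carrier A" "y \<in> carrier A" "z \<in> carrier A" for x y z
  proof (rule Idown[OF _ Iadd[OF that(1,2)]])
    have 1: "x \<sqsubseteq> y \<oplus> (x \<ominus> y)" "y \<sqsubseteq> z \<oplus> (y \<ominus> z)" by (rule le_add_diff_self; simp)+
    have "y \<oplus> (x \<ominus> y) \<sqsubseteq> (z \<oplus> (y \<ominus> z)) \<oplus> (x \<ominus> y)" by (rule add_mono) (use 1 in simp_all)
    from le_trans[OF _ _ _ 1(1) this] have "x \<sqsubseteq> (z \<oplus> (y \<ominus> z)) \<oplus> (x \<ominus> y)" by simp
    also have "(z \<oplus> (y \<ominus> z)) \<oplus> (x \<ominus> y) = z \<oplus> ((x \<ominus> y) \<oplus> (y \<ominus> z))"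
      by (subst add_assoc, simp_all, subst add_comm[of "y \<ominus> z"], simp_all)
    finally show "x \<ominus> z \<sqsubseteq> (x \<ominus> y) \<oplus> (y \<ominus> z)" by (subst diff_le_iff) simp_all
  qed simp
  have diff_add: "(x \<oplus> z) \<ominus> (y \<oplus> z) \<in> I" if "x \<ominus> y \<in> I"
    and [simp]: "x \<in> carrier A" "y \<in> carrier A" "z \<in> carrier A" for x y z
  proof (rule Idown[OF _ that(1)])
    have "x \<oplus> z \<sqsubseteq> (y \<oplus> (x \<ominus> y)) \<oplus> z"
      by (rule add_mono) (simp_all add: le_add_diff_self)
    also have "(y \<oplus> (x \<ominus> y)) \<oplus> z = (y \<oplus> z) \<oplus> (x \<ominus> y)"
      by (simp only: add_assoc closed that add_comm[of "x \<ominus> y" z])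
    finally show "(x \<oplus> z) \<ominus> (y \<oplus> z) \<sqsubseteq> x \<ominus> y" by (subst diff_le_iff) simp_all
  qed simp
  have R_refl: "R x x" if "x \<in> carrier A" for x using that mv_idealD(2)[OF I(1)] by (simp add: R_def)
  have R_sym: "R x y \<Longrightarrow> R y x" for x y by (simp add: R_def)
  have R_trans: "R x z" if "R x y" "R y z" "x \<in> carrier A" "y \<in> carrier A" "z \<in> carrier A" for x y z
    using that diff_trans unfolding R_def by blast
  have R_neg: "R (\<sim> x) (\<sim> y)" if "R x y" "x \<in> carrier A" "y \<in> carrier A" for x y
    using that by (simp add: R_def add_comm)
  have R_add1: "R (x \<oplus> z) (y \<oplus> z)" if "R x y" "x \<in> carrier A" "y \<in> carrier A" "z \<in> carrier A" for x y z
    using that diff_add by (simp add: R_def)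
  have R_add2: "R (z \<oplus> x) (z \<oplus> y)" if "R x y" "x \<in> carrier A" "y \<in> carrier A" "z \<in> carrier A" for x y z
    using R_add1[of x y z] that by (simp add: add_comm)
  \<comment> \<open>The choice predicate depends only on the class of \<open>x\<close>, so congruent
    elements get the same representative and equality in the quotient is equality of
    representatives.\<close>
  define rep where "rep x = (SOME y. y \<in> carrier A \<and> R x y)" for x
  have rep: "rep x \<in> carrier A \<and> R x (rep x)" if "x \<in> carrier A" for x
    unfolding rep_def by (rule someI[of _ x]) (simp add: that R_refl)
  have rep_closed [simp]: "rep x \<in> carrier A" if "x \<in> carrier A" for x using rep that by blast
  have rep_cong: "rep x = rep y" if "R x y" and [simp]: "x \<in> carrier A" "y \<in> carrier A" for x y
  proof -
    have "z \<in> carrier A \<and> R x z \<longleftrightarrow> z \<in> carrier A \<and> R y z" for z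
      using R_trans R_sym that by blast
    then show ?thesis unfolding rep_def by presburger
  qed
  have rep_simps [simp]: "rep (rep x) = rep x" "rep (\<sim> rep x) = rep (\<sim> x)"
    "rep (rep x \<oplus> y) = rep (x \<oplus> y)" "rep (y \<oplus> rep x) = rep (y \<oplus> x)"
    "rep (\<sim> rep x \<oplus> y) = rep (\<sim> x \<oplus> y)"
    if [simp]: "x \<in> carrier A" "y \<in> carrier A" for x y
    by (rule rep_cong; use rep[of x] R_sym R_neg R_add1 R_add2 in simp)+
  define C where "C = \<lparr>carrier = rep ` carrier A, mv_add = \<lambda>x y. rep (x \<oplus> y), mv_neg = \<lambda>x. rep (\<sim> x),
    mv_zero = rep \<zero>\<rparr>"
  have C [simp]: "carrier C = rep ` carrier A" "mv_add C x y = rep (x \<oplus> y)" "mv_neg C x = rep (\<sim> x)"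
    "mv_zero C = rep \<zero>" for x y
    by (simp_all add: C_def)
  have C1 [simp]: "mv_one C = rep \<one>" using rep_simps(2)[of "\<zero>" "\<zero>"] by (simp add: mv_one_def[of C])
  have "mv_chain C"
  proof
    fix x y z assume "x \<in> carrier C" "y \<in> carrier C" "z \<in> carrier C"
    then show "mv_add C (mv_add C x y) z = mv_add C x (mv_add C y z)"
      by (auto simp: add_assoc)
  next
    fix x y assume "x \<in> carrier C" "y \<in> carrier C"
    then obtain x' y' where [simp]: "x = rep x'" "y = rep y'" "x' \<in> carrier A" "y' \<in> carrier A" by auto
    show "mv_add C x y \<in> carrier C" by auto
    show "mv_add C x y = mv_add C y x" by (simp add: add_comm)
    show "mv_add C (mv_neg C (mv_add C (mv_neg C x) y)) y = mv_add C (mv_neg C (mv_add C (mv_neg C y) x)) x"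
      using lukasiewicz[of x' y'] by simp
    have *: "rep (\<sim> u \<oplus> v) = rep \<one>" if "u \<ominus> v \<in> I" and [simp]: "u \<in> carrier A" "v \<in> carrier A" for u v
    proof (rule rep_cong)
      show "R (\<sim> u \<oplus> v) \<one>" using that mv_idealD(2)[OF I(1)] by (simp add: R_def)
    qed simp_all
    show "mv_add C (mv_neg C x) y = mv_one C \<or> mv_add C (mv_neg C y) x = mv_one C"
      using prime[of x' y'] *[of x' y'] *[of y' x'] by auto
  next
    fix x assume "x \<in> carrier C"
    then show "mv_neg C x \<in> carrier C" "mv_add C x (mv_zero C) = x" "mv_neg C (mv_neg C x) = x"
      "mv_add C x (mv_one C) = mv_one C" by auto
  qed simp
  moreover have "restrict rep (carrier A) \<in> mv_hom A C" by (auto simp: mv_hom_def)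
  moreover have "rep a \<noteq> rep b"
  proof
    assume "rep a = rep b"
    then have "R a b" using rep[of a] rep[of b] R_trans R_sym ab by metis
    then show False using I Iadd by (auto simp: R_def d_def)
  qed
  ultimately show ?thesis using that[of C "restrict rep (carrier A)"] by simp
qed

end

section \<open>Sums in MV-chains\<close>

context mv_chain
begin

text \<open>Read \<open>\<sim> a \<oplus> \<sim> b = \<one>\<close> as
  \<open>a \<odot> b = \<zero>\<close>: in a chain, a sum that stays below \<open>\<one>\<close> is
  exact. The side conditions of the carry rules come from here.\<close>

lemma mult_eq_zero: "a \<in> carrier A \<Longrightarrow> b \<in> carrier A \<Longrightarrow> a \<oplus> b \<noteq> \<one> \<Longrightarrow> \<sim> a \<oplus> \<sim> b = \<one>"
  using total[of a "\<sim> b"] by (auto simp: add_comm)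

lemma add_diff_cancel:
  assumes [simp]: "a \<in> carrier A" "b \<in> carrier A" and "\<sim> a \<oplus> \<sim> b = \<one>"
  shows "(a \<oplus> b) \<ominus> b = a"
proof -
  have "a \<sqsubseteq> a \<sqinter> \<sim> b" by (rule meet_greatest) (use assms in auto)
  then have "a \<sqinter> \<sim> b = a" using le_antisym[of "a \<sqinter> \<sim> b" a] meet_le1[of a "\<sim> b"] by simp
  then show ?thesis by (simp add: meet_eq_diff)
qed

text \<open>As both sums are exact, \<open>b\<close> and \<open>c\<close> are the complements of
  \<open>a \<oplus> \<beta>\<close> and \<open>a \<oplus> \<gamma>\<close>, and both sides become
  the complement of the symmetric sum \<open>a \<oplus> \<beta> \<oplus> \<gamma>\<close>. In the
  ordered group with unit \<open>u\<close> both are \<open>a + b + c - u\<close>, cut off at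
  zero.\<close>

lemma carry_comm_low:
  assumes [simp]: "a \<in> carrier A" "b \<in> carrier A" "c \<in> carrier A"
    and "\<sim> a \<oplus> \<sim> b = \<one>" "\<sim> a \<oplus> \<sim> c = \<one>"
  shows "(a \<oplus> b) \<odot> c = (a \<oplus> c) \<odot> b"
proof -
  define \<beta> where "\<beta> = \<sim> (a \<oplus> b)"
  define \<gamma> where "\<gamma> = \<sim> (a \<oplus> c)"
  have [simp]: "\<beta> \<in> carrier A" "\<gamma> \<in> carrier A" by (simp_all add: \<beta>_def \<gamma>_def)
  have "\<sim> b = a \<oplus> \<beta>" "\<sim> c = a \<oplus> \<gamma>"
    using le_add_diff[of a "\<sim> b"] le_add_diff[of a "\<sim> c"] assms
    by (simp_all add: \<beta>_def \<gamma>_def add_comm[of b a] add_comm[of c a])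
  then show ?thesis
    by (simp add: \<beta>_def[symmetric] \<gamma>_def[symmetric])
       (metis \<open>\<beta> \<in> carrier A\<close> \<open>\<gamma> \<in> carrier A\<close> add_comm add_left_comm assms(1))
qed

lemma carry_comm_high:
  assumes [simp]: "a \<in> carrier A" "b \<in> carrier A" "c \<in> carrier A"
    and "a \<oplus> b = \<one>" "a \<oplus> c = \<one>"
  shows "a \<odot> b \<oplus> c = a \<odot> c \<oplus> b"
  using arg_cong[OF carry_comm_low[of "\<sim> a" "\<sim> b" "\<sim> c"], of "mv_neg A"] assms by simp

text \<open>With \<open>\<beta>\<close> standing for \<open>u - a - b\<close> and
  \<open>\<delta>\<close> for \<open>a + c - u\<close>, both sides are the complement of
  \<open>e = \<sim> c \<oplus> \<beta>\<close>. For nonzero \<open>b\<close> the sum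
  \<open>e \<oplus> \<delta> = \<sim> b\<close> stays below \<open>\<one>\<close>, so nothing is cut
  off in it.\<close>

lemma carry_comm_mixed:
  assumes [simp]: "a \<in> carrier A" "b \<in> carrier A" "c \<in> carrier A"
    and "\<sim> a \<oplus> \<sim> b = \<one>" "a \<oplus> c = \<one>"
  shows "(a \<oplus> b) \<odot> c = a \<odot> c \<oplus> b"
proof (cases "b = \<zero>")
  case False
  define \<beta> where "\<beta> = \<sim> (a \<oplus> b)"
  define \<delta> where "\<delta> = a \<odot> c"
  define e where "e = \<sim> c \<oplus> \<beta>"
  have [simp]: "\<beta> \<in> carrier A" "\<delta> \<in> carrier A" "e \<in> carrier A" by (simp_all add: \<beta>_def \<delta>_def e_def)
  have b: "\<sim> b = a \<oplus> \<beta>"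
    using le_add_diff[of a "\<sim> b"] assms by (simp add: \<beta>_def add_comm[of b a])
  have a: "a = \<sim> c \<oplus> \<delta>"
    using le_add_diff[of "\<sim> c" a] assms by (simp add: \<delta>_def add_comm[of c a])
  have "\<sim> b = e \<oplus> \<delta>"
    unfolding b by (subst a) (simp add: e_def add_assoc add_comm[of \<delta> \<beta>])
  then have b': "b = \<sim> (e \<oplus> \<delta>)" by (metis assms(2) neg_neg)
  have "e \<oplus> \<delta> \<noteq> \<one>" using False b' by auto
  then have "\<sim> \<delta> \<oplus> \<sim> e = \<one>" using mult_eq_zero[of e \<delta>] by (simp add: add_comm)
  then have "\<delta> \<oplus> (\<sim> e \<ominus> \<delta>) = \<sim> e" by (intro le_add_diff) auto
  then have "\<delta> \<oplus> b = \<sim> e" unfolding b' by simp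
  then show ?thesis by (simp add: \<beta>_def[symmetric] \<delta>_def[symmetric] e_def add_comm[of \<beta>])
qed simp

text \<open>A pair \<open>(m, a)\<close> with \<open>a \<noteq> \<one>\<close> stands for the element \<open>m u + a\<close> of Chang's ordered group with
  strong unit \<open>u\<close>.  Adding elements outside the carrier has no effect, which makes the operation
  commute unconditionally.\<close>

definition carry_add :: "'a \<Rightarrow> nat \<times> 'a \<Rightarrow> nat \<times> 'a" where
  "carry_add b s = (if b \<in> carrier A \<and> snd s \<in> carrier A \<and> snd s \<noteq> \<one>
     then if snd s \<oplus> b = \<one> then (Suc (fst s), snd s \<odot> b) else (fst s, snd s \<oplus> b)
     else s)"

definition valid :: "nat \<times> 'a \<Rightarrow> bool" where
  "valid s \<longleftrightarrow> snd s \<in> carrier A \<and> snd s \<noteq> \<one>"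

lemma carry_add_id: "b \<notin> carrier A \<or> \<not> valid s \<Longrightarrow> carry_add b s = s"
  by (auto simp: carry_add_def valid_def)

lemma mult_neq_one: 
  assumes [simp]: "a \<in> carrier A" "b \<in> carrier A" and "a \<noteq> \<one>" shows "a \<odot> b \<noteq> \<one>"
proof
  assume "a \<odot> b = \<one>"
  then have "\<sim> a \<oplus> \<sim> b = \<zero>" by (metis assms(1,2) closed(1,2) neg_neg neg_one)
  then have "\<sim> a \<sqsubseteq> \<zero>" using le_add[of "\<sim> a" "\<sim> b"] by simp
  then have "\<sim> a = \<zero>" by (intro le_zero) auto
  then show False using assms by (metis neg_neg neg_zero)
qed

lemma valid_carry_add: "valid s \<Longrightarrow> valid (carry_add b s)"
  by (auto simp: valid_def carry_add_def mult_neq_one)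

lemma carry_add_commute_aux:
  assumes "a \<in> carrier A" "b \<in> carrier A" "c \<in> carrier A" "a \<noteq> \<one>" "a \<oplus> b \<noteq> \<one>"
  shows "carry_add c (carry_add b (m, a)) = carry_add b (carry_add c (m, a))"
proof (cases "a \<oplus> c = \<one>")
  case True
  have ab: "\<sim> a \<oplus> \<sim> b = \<one>" using assms by (simp add: mult_eq_zero)
  have "a \<oplus> b \<oplus> c = \<one>"
    using assms True by (simp add: add_assoc add_comm[of b c]) (simp add: add_assoc[symmetric] True)
  moreover have "a \<odot> c \<oplus> b = (a \<oplus> b) \<odot> c" using carry_comm_mixed[of a b c] assms True ab by simp
  moreover have "(a \<oplus> b) \<odot> c \<noteq> \<one>" using assms by (intro mult_neq_one) auto
  ultimately show ?thesis using assms True mult_neq_one[of a c]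
    by (simp add: carry_add_def)
next
  case False
  have ab: "\<sim> a \<oplus> \<sim> b = \<one>" "\<sim> a \<oplus> \<sim> c = \<one>" using assms False by (simp_all add: mult_eq_zero)
  have "a \<oplus> b \<oplus> c = a \<oplus> c \<oplus> b" using assms by (simp add: add_assoc add_comm[of b c])
  then show ?thesis
    using assms False carry_comm_low[of a b c] ab by (simp add: carry_add_def)
qed

text \<open>Order independence of carrying is what allows a multiset to be summed. The cases say
  which summand overflows on its own; if one does not, the auxiliary lemma applies in one order or
  the other.\<close>

lemma carry_add_commute: "carry_add c (carry_add b s) = carry_add b (carry_add c s)"
proof (cases "valid s \<and> b \<in> carrier A \<and> c \<in> carrier A")
  case True
  obtain m a where s: "s = (m, a)" by (cases s)
  have [simp]: "a \<in> carrier A" "a \<noteq> \<one>" "b \<in> carrier A" "c \<in> carrier A" using True s by (auto simp: valid_def)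
  consider "a \<oplus> b \<noteq> \<one>" | "a \<oplus> c \<noteq> \<one>" | "a \<oplus> b = \<one>" "a \<oplus> c = \<one>" by blast
  then show ?thesis
  proof cases
    case 3
    have "a \<odot> b \<oplus> c = a \<odot> c \<oplus> b" using carry_comm_high 3 by simp
    moreover have "(a \<odot> b) \<odot> c = (a \<odot> c) \<odot> b"
      by (simp add: add_assoc add_comm[of "\<sim> b" "\<sim> c"])
    ultimately show ?thesis using 3 mult_neq_one[of a b] mult_neq_one[of a c]
      by (simp add: s carry_add_def)
  qed (unfold s, (rule carry_add_commute_aux carry_add_commute_aux[symmetric]; simp)+)
next
  case False
  then show ?thesis using carry_add_id by metis
qed

section \<open>Order on sums with carries\<close>

definition state_less :: "nat \<times> 'a \<Rightarrow> nat \<times> 'a \<Rightarrow> bool" where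
  "state_less s t \<longleftrightarrow> fst s < fst t \<or> fst s = fst t \<and> snd s \<noteq> snd t \<and> snd s \<sqsubseteq> snd t"

lemma state_less_total: "valid s \<Longrightarrow> valid t \<Longrightarrow> state_less s t \<or> s = t \<or> state_less t s"
  using total[of "snd s" "snd t"] by (cases s; cases t) (auto simp: state_less_def valid_def)

lemma state_less_asym: "valid s \<Longrightarrow> valid t \<Longrightarrow> state_less s t \<Longrightarrow> \<not> state_less t s"
  using le_antisym[of "snd s" "snd t"] by (auto simp: state_less_def valid_def)

lemma state_less_trans:
  "valid s \<Longrightarrow> valid t \<Longrightarrow> valid u \<Longrightarrow> state_less s t \<Longrightarrow> state_less t u \<Longrightarrow> state_less s u"
  using le_antisym[of "snd s" "snd t"] le_trans[of "snd s" "snd t" "snd u"]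
  by (auto simp: state_less_def valid_def)

lemma add_right_cancel:
  assumes "a \<in> carrier A" "a' \<in> carrier A" "b \<in> carrier A" "\<sim> a \<oplus> \<sim> b = \<one>" "\<sim> a' \<oplus> \<sim> b = \<one>"
    and "a \<oplus> b = a' \<oplus> b"
  shows "a = a'"
  using add_diff_cancel[OF assms(1,3,4)] add_diff_cancel[OF assms(2,3,5)] assms(6) by metis

text \<open>The delicate comparison is a carry out of the smaller state that makes the integer parts
  meet: then \<open>a \<odot> b \<sqsubseteq> b \<sqsubseteq> a' \<oplus> b\<close>, and equality
  would force \<open>a = \<one>\<close>. For equal integer parts strictness is cancellation, applied
  to the sums or, after a carry, to the sums of the complements.\<close>

lemma carry_add_mono:
  assumes "valid s" "valid t" and less: "state_less s t"
  shows "state_less (carry_add b s) (carry_add b t)"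
proof (cases "b \<in> carrier A")
  case [simp]: True
  obtain m a n a' where st: "s = (m, a)" "t = (n, a')" by (cases s, cases t)
  have [simp]: "a \<in> carrier A" "a' \<in> carrier A" "a \<noteq> \<one>" "a' \<noteq> \<one>"
    using assms by (auto simp: st valid_def)
  show ?thesis
  proof (cases "m < n")
    case True
    have "a \<odot> b \<sqsubseteq> b" using diff_le_self[of b "\<sim> a"] by (simp add: add_comm)
    then have le: "a \<odot> b \<sqsubseteq> a' \<oplus> b" by (rule le_trans[OF _ _ _ _ le_add2, rotated 3]) simp_all
    have "a \<odot> b \<noteq> a' \<oplus> b" if "a \<oplus> b = \<one>"
    proof
      assume eq: "a \<odot> b = a' \<oplus> b"
      have "a \<odot> b = b" by (rule le_antisym) (use \<open>a \<odot> b \<sqsubseteq> b\<close> eq in simp_all)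
      then have "\<sim> a \<oplus> \<sim> b = \<zero> \<oplus> \<sim> b" by (metis True closed \<open>a \<in> carrier A\<close> \<open>b \<in> carrier A\<close> neg_neg units(4))
      then have "\<sim> a = \<zero>" by (rule add_right_cancel[rotated 5]) (use that in simp_all)
      then have "a = \<one>" by (metis \<open>a \<in> carrier A\<close> neg_neg neg_zero)
      then show False by simp
    qed
    then show ?thesis using True le
      by (auto simp: st carry_add_def state_less_def)
  next
    case False
    then have [simp]: "n = m" and aa: "a \<noteq> a'" "a \<sqsubseteq> a'" using less by (auto simp: st state_less_def)
    have le: "a \<oplus> b \<sqsubseteq> a' \<oplus> b" by (rule add_mono) (use aa in auto)
    have le': "a \<odot> b \<sqsubseteq> a' \<odot> b"
    proof (subst neg_le_neg)
      show "\<sim> a' \<oplus> \<sim> b \<sqsubseteq> \<sim> a \<oplus> \<sim> b" by (rule add_mono) (use aa in \<open>auto simp: add_comm\<close>)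
    qed simp_all
    show ?thesis
    proof (cases "a \<oplus> b = \<one>")
      case True
      then have *: "a' \<oplus> b = \<one>" using le by (metis \<open>a' \<in> carrier A\<close> True \<open>b \<in> carrier A\<close> closed(1) neg_one units(4))
      have "a \<odot> b \<noteq> a' \<odot> b"
      proof
        assume "a \<odot> b = a' \<odot> b"
        then have "\<sim> a \<oplus> \<sim> b = \<sim> a' \<oplus> \<sim> b" by (metis \<open>a \<in> carrier A\<close> \<open>a' \<in> carrier A\<close> \<open>b \<in> carrier A\<close> closed(1,2) neg_neg)
        then have "\<sim> a = \<sim> a'" by (rule add_right_cancel[rotated 5]) (use * True in simp_all)
        then show False using aa by (metis \<open>a \<in> carrier A\<close> \<open>a' \<in> carrier A\<close> neg_neg)
      qed
      then show ?thesis using True * le' by (simp add: st carry_add_def state_less_def)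
    next
      case False
      have "a \<oplus> b \<noteq> a' \<oplus> b" if "a' \<oplus> b \<noteq> \<one>"
        using add_right_cancel[of a a' b] mult_eq_zero[of a b] mult_eq_zero[of a' b] False that aa by auto
      then show ?thesis using False le by (simp add: st carry_add_def state_less_def)
    qed
  qed
qed (use less in \<open>simp add: carry_add_def\<close>)

sublocale carry: comp_fun_commute carry_add
  by unfold_locales (auto simp: fun_eq_iff carry_add_commute)

definition msum :: "'a multiset \<Rightarrow> nat \<times> 'a" where "msum M = fold_mset carry_add (0, \<zero>) M"

lemma msum_add: "msum (add_mset x M) = carry_add x (msum M)"
  by (simp add: msum_def)

end

text \<open>In a trivial algebra the initial state \<open>(0, \<zero>)\<close> would be invalid and
  \<open>carry_add\<close> would never move it; nontriviality makes every sum a valid state.\<close>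

locale mv_nontrivial_chain = mv_chain +
  assumes nontrivial: "mv_zero A \<noteq> mv_one A"
begin

lemma valid_msum: "valid (msum M)"
proof (induction M)
  case empty
  then show ?case using nontrivial by (simp add: msum_def valid_def)
qed (simp add: msum_add valid_carry_add)

text \<open>Adding \<open>K\<close> preserves strict order and equality, so by totality it also
  reflects the order; this is cancellation in the ordered group.\<close>

lemma msum_less_add: "state_less (msum (M + K)) (msum (N + K)) \<longleftrightarrow> state_less (msum M) (msum N)"
proof -
  have mono: "state_less (msum (M + K)) (msum (N + K))" if "state_less (msum M) (msum N)" for M N
    by (induction K) (simp_all add: msum_add carry_add_mono valid_msum that)
  have eq: "msum (M + K) = msum (N + K)" if "msum M = msum N"
    by (induction K) (simp_all add: msum_add that)
  show ?thesis
    using mono[of M N] mono[of N M] eq state_less_total[OF valid_msum valid_msum, of M N]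
      state_less_asym[OF valid_msum valid_msum, of "M + K" "N + K"] by metis
qed

lemma msum_le_add_mono:
  assumes "\<not> state_less (msum M) (msum N)" "\<not> state_less (msum M') (msum N')"
  shows "\<not> state_less (msum (M + M')) (msum (N + N'))"
proof
  have le: "\<not> state_less (msum (M + M')) (msum (N + M'))" "\<not> state_less (msum (N + M')) (msum (N + N'))"
    using assms msum_less_add[of M M' N] msum_less_add[of M' N N'] by (simp_all add: add.commute)
  assume "state_less (msum (M + M')) (msum (N + N'))"
  then show False
    using le state_less_trans[OF valid_msum valid_msum valid_msum] state_less_total[OF valid_msum valid_msum]
    by metis
qed

end

section \<open>Local embedding of MV-chains into the unit interval\<close>

text \<open>Fourier--Motzkin elimination, for an abstract set \<open>K\<close> of integer linear forms that are
  regarded as nonnegative; the solution in \<open>\<real>\<close> replaces one in an arbitrary ordered group.\<close>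

lemma fourier_motzkin:
  fixes K :: "('v \<Rightarrow> int) set"
  assumes add: "\<And>p q. p \<in> K \<Longrightarrow> q \<in> K \<Longrightarrow> (\<lambda>v. p v + q v) \<in> K"
    and total: "\<And>p. p \<in> K \<or> (\<lambda>v. - p v) \<in> K"
    and "finite V" "finite P" "P \<subseteq> K" "\<And>p v. p \<in> P \<Longrightarrow> v \<notin> V \<Longrightarrow> p v = 0"
  shows "\<exists>r::'v \<Rightarrow> real. \<forall>p\<in>P. 0 \<le> (\<Sum>v\<in>V. p v * r v) \<and>
           ((\<lambda>v. - p v) \<notin> K \<longrightarrow> 0 < (\<Sum>v\<in>V. p v * r v))"
  using assms(3-)
proof (induction V arbitrary: P rule: finite_induct)
  case empty
  have "(\<lambda>v. - p v) = p" if "p \<in> P" for p using empty.prems(3)[OF that] by auto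
  then have "(\<lambda>v. - p v) \<in> K" if "p \<in> P" for p using that empty.prems(2) by force
  then show ?case by simp
next
  case (insert x V)
  have zero: "(\<lambda>_. 0) \<in> K" using total[of "\<lambda>_. 0"] by simp
  have mult: "(\<lambda>v. int n * p v) \<in> K" if "p \<in> K" for n p
  proof (induction n)
    case (Suc n)
    show ?case using add[OF Suc that] by (simp add: algebra_simps)
  qed (simp add: zero)
  \<comment> \<open>Strict positivity of \<open>p\<close> is encoded as \<open>- p\<close> not lying
    in \<open>K\<close>. It survives adding a member \<open>q\<close>, because \<open>- p\<close> is
    the sum of \<open>- (p + q)\<close> and \<open>q\<close>.\<close>
  have strict: "(\<lambda>v. - (p v + q v)) \<notin> K" if "(\<lambda>v. - p v) \<notin> K" "q \<in> K" for p q
    using add[of "\<lambda>v. - (p v + q v)" q] that by auto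
  have strict_mult: "(\<lambda>v. - (int n * p v)) \<notin> K" if "(\<lambda>v. - p v) \<notin> K" "n > 0" for n p
  proof -
    define k where "k = n - 1"
    have n: "n = Suc k" using that(2) by (simp add: k_def)
    have "p \<in> K" using total that by blast
    from strict[OF that(1) mult[OF this, of k]] show ?thesis by (simp add: n algebra_simps)
  qed
  define U where "U = {p \<in> P. p x > 0}"
  define D where "D = {q \<in> P. q x < 0}"
  \<comment> \<open>The combination in which \<open>x\<close> cancels. The factors are natural
    numbers because \<open>K\<close> is only known to be closed under sums.\<close>
  define c where "c p q = (\<lambda>v. int (nat (- q x)) * p v + int (nat (p x)) * q v)" for p q :: "'v \<Rightarrow> int"
  have c_eq: "c p q v = - q x * p v + p x * q v" if "p \<in> U" "q \<in> D" for p q v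
    using that by (simp add: c_def U_def D_def)
  have cK: "c p q \<in> K" if "p \<in> U" "q \<in> D" for p q
    unfolding c_def by (intro add mult) (use that insert.prems in \<open>auto simp: U_def D_def\<close>)
  have cstrict: "(\<lambda>v. - c p q v) \<notin> K" if "p \<in> U" "q \<in> D" "(\<lambda>v. - p v) \<notin> K \<or> (\<lambda>v. - q v) \<notin> K" for p q
  proof -
    have pq: "p \<in> K" "q \<in> K" "0 < nat (p x)" "0 < nat (- q x)" using that insert.prems by (auto simp: U_def D_def)
    show ?thesis using that(3)
    proof
      assume "(\<lambda>v. - p v) \<notin> K"
      from strict[OF strict_mult[OF this pq(4)] mult[OF pq(2), of "nat (p x)"]] show ?thesis
        by (simp add: c_def)
    next
      assume "(\<lambda>v. - q v) \<notin> K"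
      from strict[OF strict_mult[OF this pq(3)] mult[OF pq(1), of "nat (- q x)"]] show ?thesis
        by (simp add: c_def add.commute)
    qed
  qed
  define P' where "P' = {p \<in> P. p x = 0} \<union> (\<lambda>(p, q). c p q) ` (U \<times> D)"
  have fin: "finite U" "finite D" using insert.prems by (simp_all add: U_def D_def)
  have "finite P'" using fin insert.prems by (simp add: P'_def)
  moreover have "P' \<subseteq> K" using cK insert.prems by (auto simp: P'_def)
  moreover have "p v = 0" if "p \<in> P'" "v \<notin> V" for p v
  proof (cases "v = x")
    case True
    then show ?thesis using that by (auto simp: P'_def c_eq)
  next
    case False
    then have *: "p v = 0" if "p \<in> P" for p using \<open>v \<notin> V\<close> that insert.prems(3) by auto
    have "c p q v = 0" if "p \<in> U" "q \<in> D" for p q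
      using *[of p] *[of q] that by (simp add: c_eq) (simp add: U_def D_def)
    then show ?thesis using that(1) * by (auto simp: P'_def)
  qed
  ultimately have "\<exists>r::'v \<Rightarrow> real. \<forall>p\<in>P'. 0 \<le> (\<Sum>v\<in>V. p v * r v) \<and>
      ((\<lambda>v. - p v) \<notin> K \<longrightarrow> 0 < (\<Sum>v\<in>V. p v * r v))"
    by (rule insert.IH)
  then obtain r :: "'v \<Rightarrow> real" where r: "\<And>p. p \<in> P' \<Longrightarrow> 0 \<le> (\<Sum>v\<in>V. p v * r v)"
    "\<And>p. p \<in> P' \<Longrightarrow> (\<lambda>v. - p v) \<notin> K \<Longrightarrow> 0 < (\<Sum>v\<in>V. p v * r v)"
    by blast
  define s where "s p = (\<Sum>v\<in>V. real_of_int (p v) * r v)" for p :: "'v \<Rightarrow> int"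
  \<comment> \<open>The value of \<open>x\<close> at which the form vanishes once the other
    variables are fixed: a lower bound for \<open>x\<close> if the form is in \<open>U\<close>, an
    upper bound if it is in \<open>D\<close>.\<close>
  define b where "b p = - s p / p x" for p
  have sc: "s (c p q) = - q x * s p + p x * s q" if "p \<in> U" "q \<in> D" for p q
    by (simp add: s_def c_eq[OF that] sum_distrib_left sum.distrib[symmetric] algebra_simps sum_subtractf)
  have le: "b p \<le> b q" if "p \<in> U" "q \<in> D" for p q
  proof -
    have "c p q \<in> P'" using that by (force simp: P'_def)
    from r(1)[OF this] have "0 \<le> - q x * s p + p x * s q" using sc[OF that] by (simp add: s_def)
    then show ?thesis using that by (simp add: b_def U_def D_def field_simps)
  qed
  have less: "b p < b q" if "p \<in> U" "q \<in> D" "(\<lambda>v. - p v) \<notin> K \<or> (\<lambda>v. - q v) \<notin> K" for p q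
  proof -
    have "c p q \<in> P'" using that by (force simp: P'_def)
    from r(2)[OF this cstrict[OF that]] have "0 < - q x * s p + p x * s q" using sc[OF that(1,2)] by (simp add: s_def)
    then show ?thesis using that by (simp add: b_def U_def D_def field_simps)
  qed
  \<comment> \<open>With bounds on both sides, the midpoint of the tightest pair is strict wherever
    this is required. Otherwise one goes a unit beyond the extreme bound, where 0 is inserted so
    that the extreme exists.\<close>
  obtain y :: real where y: "\<And>p. p \<in> U \<Longrightarrow> b p \<le> y \<and> ((\<lambda>v. - p v) \<notin> K \<longrightarrow> b p < y)"
    "\<And>q. q \<in> D \<Longrightarrow> y \<le> b q \<and> ((\<lambda>v. - q v) \<notin> K \<longrightarrow> y < b q)"
  proof (cases "U = {} \<or> D = {}")
    case True
    then show ?thesis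
    proof
      assume "U = {}"
      have "Min (insert 0 (b ` D)) - 1 < b q" if "q \<in> D" for q
      proof -
        have "Min (insert 0 (b ` D)) \<le> b q" by (rule Min_le) (use fin that in auto)
        then show ?thesis by simp
      qed
      then show ?thesis using \<open>U = {}\<close> by (intro that[of "Min (insert 0 (b ` D)) - 1"]) (auto intro: less_imp_le)
    next
      assume "D = {}"
      have "b p < Max (insert 0 (b ` U)) + 1" if "p \<in> U" for p
      proof -
        have "b p \<le> Max (insert 0 (b ` U))" by (rule Max_ge) (use fin that in auto)
        then show ?thesis by simp
      qed
      then show ?thesis using \<open>D = {}\<close> by (intro that[of "Max (insert 0 (b ` U)) + 1"]) (auto intro: less_imp_le)
    qed
  next
    case False
    have "Max (b ` U) \<in> b ` U" "Min (b ` D) \<in> b ` D" using False fin by auto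
    then obtain p0 q0 where p0: "p0 \<in> U" "Max (b ` U) = b p0" and q0: "q0 \<in> D" "Min (b ` D) = b q0"
      by (metis imageE)
    have 1: "b p \<le> b p0" if "p \<in> U" for p using Max_ge[of "b ` U" "b p"] that fin p0 by simp
    have 2: "b q0 \<le> b q" if "q \<in> D" for q using Min_le[of "b ` D" "b q"] that fin q0 by simp
    have "b p \<le> (b p0 + b q0) / 2 \<and> ((\<lambda>v. - p v) \<notin> K \<longrightarrow> b p < (b p0 + b q0) / 2)" if "p \<in> U" for p
      using 1[OF that] le[OF that q0(1)] less[OF that q0(1)] by auto
    moreover have "(b p0 + b q0) / 2 \<le> b q \<and> ((\<lambda>v. - q v) \<notin> K \<longrightarrow> (b p0 + b q0) / 2 < b q)" if "q \<in> D" for q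
      using 2[OF that] le[OF p0(1) that] less[OF p0(1) that] by auto
    ultimately show ?thesis by (intro that[of "(b p0 + b q0) / 2"])
  qed
  have sum: "(\<Sum>v\<in>insert x V. p v * (r(x := y)) v) = p x * y + s p" for p :: "'v \<Rightarrow> int"
  proof -
    have "(\<Sum>v\<in>V. p v * (r(x := y)) v) = s p"
      unfolding s_def using insert.hyps by (intro sum.cong) auto
    then show ?thesis using insert.hyps by simp
  qed
  show ?case
  proof (intro exI[of _ "r(x := y)"] ballI, unfold sum)
    fix p assume "p \<in> P"
    consider "p x = 0" | "p \<in> U" | "p \<in> D" using \<open>p \<in> P\<close> linorder_less_linear[of "p x" 0]
      by (auto simp: U_def D_def)
    then show "0 \<le> p x * y + s p \<and> ((\<lambda>v. - p v) \<notin> K \<longrightarrow> 0 < p x * y + s p)"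
    proof cases
      case 1
      then show ?thesis using r[of p] \<open>p \<in> P\<close> by (simp add: P'_def s_def)
    next
      case 2
      then show ?thesis using y(1)[OF 2] by (simp add: b_def U_def field_simps) linarith
    next
      case 3
      then show ?thesis using y(2)[OF 3] by (simp add: b_def D_def field_simps) linarith
    qed
  qed
qed

section \<open>From sums in a chain to real numbers\<close>

context mv_nontrivial_chain
begin

text \<open>An integer form counts as nonnegative when the sum of its positive part is not below
  that of its negative part. By cancellation this depends only on the difference of two multisets,
  so comparing lists becomes a sign condition, and the length bound leaves finitely many of
  them.\<close>

lemma msum_real_sums:
  assumes fin: "finite V"
  obtains r :: "'a \<Rightarrow> real" where
    "\<And>xs ys. set xs \<subseteq> V \<Longrightarrow> set ys \<subseteq> V \<Longrightarrow> length xs \<le> n \<Longrightarrow> length ys \<le> n \<Longrightarrow>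
      state_less (msum (mset xs)) (msum (mset ys)) \<longleftrightarrow> sum_list (map r xs) < sum_list (map r ys)"
proof -
  define ms where "ms f = (\<Sum>v\<in>V. replicate_mset (f v) v)" for f :: "'a \<Rightarrow> nat"
  define K where "K = {c :: 'a \<Rightarrow> int. \<not> state_less (msum (ms (\<lambda>v. nat (c v)))) (msum (ms (\<lambda>v. nat (- c v))))}"
  have ms_add: "ms f + ms g = ms (\<lambda>v. f v + g v)" for f g
    by (rule multiset_eqI) (use fin in \<open>simp add: ms_def count_sum sum.delta\<close>)
  have ms_count: "ms (count M) = M" if "set_mset M \<subseteq> V" for M
    by (rule multiset_eqI) (use fin that in \<open>auto simp: ms_def count_sum sum.delta not_in_iff[symmetric] subset_iff\<close>)
  define form where "form M N = (\<lambda>v. int (count M v) - int (count N v))" for M N :: "'a multiset"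
  have form_K: "form M N \<in> K \<longleftrightarrow> \<not> state_less (msum M) (msum N)" if "set_mset M \<subseteq> V" "set_mset N \<subseteq> V" for M N
  proof -
    let ?c = "form M N"
    \<comment> \<open>The common part of the two multisets, which is lost in their
      difference.\<close>
    define Z where "Z = ms (\<lambda>v. min (count M v) (count N v))"
    have "ms (\<lambda>v. nat (?c v)) + Z = ms (count M)" "ms (\<lambda>v. nat (- ?c v)) + Z = ms (count N)"
      unfolding Z_def ms_add by (rule arg_cong[of _ _ ms]; force simp: form_def)+
    then show ?thesis
      using msum_less_add[of "ms (\<lambda>v. nat (?c v))" Z "ms (\<lambda>v. nat (- ?c v))"] that
      by (simp add: ms_count K_def)
  qed
  have form_neg: "(\<lambda>v. - form M N v) = form N M" for M N by (simp add: form_def)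
  define Ls where "Ls = {xs. set xs \<subseteq> V \<and> length xs \<le> n}"
  define P where "P = (\<lambda>(xs, ys). form (mset xs) (mset ys)) ` (Ls \<times> Ls) \<inter> K"
  have "\<exists>r::'a \<Rightarrow> real. \<forall>p\<in>P. 0 \<le> (\<Sum>v\<in>V. p v * r v) \<and> ((\<lambda>v. - p v) \<notin> K \<longrightarrow> 0 < (\<Sum>v\<in>V. p v * r v))"
  proof (rule fourier_motzkin)
    fix p q assume pq: "p \<in> K" "q \<in> K"
    \<comment> \<open>What cancels between \<open>p\<close> and \<open>q\<close>. The same multiset
      completes the positive and the negative parts, since both parts have equal
      differences.\<close>
    define Z where "Z = ms (\<lambda>v. nat (p v) + nat (q v) - nat (p v + q v))"
    have "ms (\<lambda>v. nat (p v + q v)) + Z = ms (\<lambda>v. nat (p v)) + ms (\<lambda>v. nat (q v))"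
      "ms (\<lambda>v. nat (- (p v + q v))) + Z = ms (\<lambda>v. nat (- p v)) + ms (\<lambda>v. nat (- q v))"
      unfolding Z_def ms_add by (rule arg_cong[of _ _ ms]; force)+
    then show "(\<lambda>v. p v + q v) \<in> K"
      using msum_le_add_mono[of "ms (\<lambda>v. nat (p v))" "ms (\<lambda>v. nat (- p v))" "ms (\<lambda>v. nat (q v))" "ms (\<lambda>v. nat (- q v))"]
        msum_less_add[of "ms (\<lambda>v. nat (p v + q v))" Z "ms (\<lambda>v. nat (- (p v + q v)))"] pq
      by (simp add: K_def)
  next
    show "p \<in> K \<or> (\<lambda>v. - p v) \<in> K" for p
      using state_less_asym[OF valid_msum valid_msum] by (auto simp: K_def)
  next
    show "finite P" using finite_lists_length_le[OF fin, of n] by (simp add: P_def Ls_def)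
    show "p v = 0" if "p \<in> P" "v \<notin> V" for p v
    proof -
      obtain xs ys where *: "xs \<in> Ls" "ys \<in> Ls" "p = form (mset xs) (mset ys)" using \<open>p \<in> P\<close> by (auto simp: P_def)
      then have "v \<notin># mset xs" "v \<notin># mset ys" using \<open>v \<notin> V\<close> by (auto simp: Ls_def)
      then show ?thesis by (simp only: * form_def not_in_iff)
    qed
  qed (auto simp: P_def fin)
  then obtain r :: "'a \<Rightarrow> real" where r: "\<And>p. p \<in> P \<Longrightarrow> 0 \<le> (\<Sum>v\<in>V. p v * r v)"
    "\<And>p. p \<in> P \<Longrightarrow> (\<lambda>v. - p v) \<notin> K \<Longrightarrow> 0 < (\<Sum>v\<in>V. p v * r v)" by blast
  have sum_count: "(\<Sum>v\<in>V. real (count (mset xs) v) * r v) = sum_list (map r xs)" if "set xs \<subseteq> V" for xs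
    using that
  proof (induction xs)
    case (Cons x xs)
    have "(\<Sum>v\<in>V. real (count (mset (x # xs)) v) * r v) =
        (\<Sum>v\<in>V. real (count (mset xs) v) * r v + (if x = v then r v else 0))"
      by (rule sum.cong) (auto simp: algebra_simps)
    then show ?case using Cons fin by (simp add: sum.distrib sum.delta)
  qed simp
  have sum_form: "(\<Sum>v\<in>V. form (mset xs) (mset ys) v * r v) = sum_list (map r xs) - sum_list (map r ys)"
    if "xs \<in> Ls" "ys \<in> Ls" for xs ys
    using that sum_count[of xs] sum_count[of ys] by (simp add: form_def Ls_def left_diff_distrib sum_subtractf)
  show ?thesis
  proof (rule that)
    fix xs ys assume "set xs \<subseteq> V" "set ys \<subseteq> V" "length xs \<le> n" "length ys \<le> n"
    then have L: "xs \<in> Ls" "ys \<in> Ls" by (auto simp: Ls_def)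
    have K: "form (mset us) (mset vs) \<in> K \<longleftrightarrow> \<not> state_less (msum (mset us)) (msum (mset vs))"
      if "us \<in> Ls" "vs \<in> Ls" for us vs using form_K that by (simp add: Ls_def)
    have inP: "form (mset us) (mset vs) \<in> P" if "us \<in> Ls" "vs \<in> Ls" "form (mset us) (mset vs) \<in> K" for us vs
      using that by (force simp: P_def)
    show "state_less (msum (mset xs)) (msum (mset ys)) \<longleftrightarrow> sum_list (map r xs) < sum_list (map r ys)"
    proof
      assume l: "state_less (msum (mset xs)) (msum (mset ys))"
      then have "\<not> state_less (msum (mset ys)) (msum (mset xs))" using state_less_asym[OF valid_msum valid_msum] by blast
      then have "form (mset ys) (mset xs) \<in> P" using inP K L by blast
      from r(2)[OF this] show "sum_list (map r xs) < sum_list (map r ys)"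
        using K[of xs ys] l L sum_form[of ys xs] by (simp add: form_neg)
    next
      assume "sum_list (map r xs) < sum_list (map r ys)"
      then have "form (mset xs) (mset ys) \<notin> P" using r(1)[of "form (mset xs) (mset ys)"] L sum_form[of xs ys] by auto
      then show "state_less (msum (mset xs)) (msum (mset ys))" using inP K L by blast
    qed
  qed
qed

lemma msum_empty: "msum {#} = (0, \<zero>)"
  by (simp add: msum_def)

lemma msum_single: "x \<in> carrier A \<Longrightarrow> msum {#x#} = (if x = \<one> then (1, \<zero>) else (0, x))"
proof -
  assume x: "x \<in> carrier A"
  have "msum {#x#} = carry_add x (0, \<zero>)" by (simp only: msum_add msum_empty)
  then show ?thesis using x nontrivial by (simp add: carry_add_def)
qed

text \<open>Sums of at most two elements suffice: \<open>x\<close> and \<open>\<sim> x\<close> add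
  up to the unit, and two elements either add up to a third or have a sum that is at least the unit.
  Dividing by the positive value of \<open>\<one>\<close> normalises the unit.\<close>

lemma local_embedding:
  assumes "finite X" "X \<subseteq> carrier A"
  obtains \<rho> :: "'a \<Rightarrow> real" where "\<rho> \<zero> = 0" "\<rho> \<one> = 1"
    "\<And>x. x \<in> X \<Longrightarrow> 0 \<le> \<rho> x \<and> \<rho> x \<le> 1"
    "\<And>x y. x \<in> X \<Longrightarrow> y \<in> X \<Longrightarrow> x \<sqsubseteq> y \<Longrightarrow> x \<noteq> y \<Longrightarrow> \<rho> x < \<rho> y"
    "\<And>x. x \<in> X \<Longrightarrow> \<sim> x \<in> X \<Longrightarrow> \<rho> (\<sim> x) = 1 - \<rho> x"
    "\<And>x y. x \<in> X \<Longrightarrow> y \<in> X \<Longrightarrow> x \<oplus> y \<in> X \<Longrightarrow> \<rho> (x \<oplus> y) = min (\<rho> x + \<rho> y) 1"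
proof -
  define V where "V = X \<union> {\<zero>, \<one>}"
  have V: "finite V" "\<zero> \<in> V" "\<one> \<in> V" "X \<subseteq> V" and Vc: "\<And>x. x \<in> V \<Longrightarrow> x \<in> carrier A"
    using assms by (auto simp: V_def)
  obtain r :: "'a \<Rightarrow> real" where r:
    "\<And>xs ys. set xs \<subseteq> V \<Longrightarrow> set ys \<subseteq> V \<Longrightarrow> length xs \<le> 2 \<Longrightarrow> length ys \<le> 2 \<Longrightarrow>
      state_less (msum (mset xs)) (msum (mset ys)) \<longleftrightarrow> sum_list (map r xs) < sum_list (map r ys)"
    using msum_real_sums[OF V(1), of 2] by blast
  have req: "sum_list (map r xs) = sum_list (map r ys)"
    if "msum (mset xs) = msum (mset ys)" "set xs \<subseteq> V" "set ys \<subseteq> V" "length xs \<le> 2" "length ys \<le> 2" for xs ys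
    using r[of xs ys] r[of ys xs] that state_less_asym[OF valid_msum valid_msum, of "mset xs" "mset ys"] by force
  have r0: "r \<zero> = 0" using req[of "[\<zero>]" "[]"] V nontrivial msum_single[of "\<zero>"] by (simp add: msum_empty)
  have mono: "r x < r y" if "x \<in> V" "y \<in> V" "x \<sqsubseteq> y" "x \<noteq> y" for x y
  proof -
    have "x \<noteq> \<one>" using that Vc[of y] by auto
    then show ?thesis using r[of "[x]" "[y]"] that by (auto simp: msum_single Vc state_less_def split: if_splits)
  qed
  have mono_le: "r x \<le> r y" if "x \<in> V" "y \<in> V" "x \<sqsubseteq> y" for x y
    using mono[of x y] that by (cases "x = y") auto
  have r1: "0 < r \<one>" using mono[of "\<zero>" "\<one>"] r0 nontrivial V by simp
  have rneg: "r x + r (\<sim> x) = r \<one>" if "x \<in> V" "\<sim> x \<in> V" for x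
  proof -
    have "msum {#x, \<sim> x#} = (1, \<zero>)"
    proof (cases "\<sim> x = \<one>")
      case True
      then have "x = \<zero>" using Vc that by (metis neg_neg neg_one)
      then show ?thesis using nontrivial by (simp add: msum_add msum_empty msum_single carry_add_def)
    next
      case False
      then show ?thesis using Vc that nontrivial
        by (simp add: msum_add msum_empty msum_single carry_add_def add_comm)
    qed
    then show ?thesis using req[of "[x, \<sim> x]" "[\<one>]"] that V by (simp add: msum_single)
  qed
  have radd: "r (x \<oplus> y) = min (r x + r y) (r \<one>)" if xy: "x \<in> V" "y \<in> V" "x \<oplus> y \<in> V" for x y
  proof (cases "x \<oplus> y = \<one>")
    case True
    have [simp]: "x \<in> carrier A" "y \<in> carrier A" using xy Vc by auto
    \<comment> \<open>An overflow shows as a positive integer part, which puts the sum at or above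
      the state \<open>(1, \<zero>)\<close> of the unit.\<close>
    have "fst (msum {#x, y#}) \<ge> 1"
      using True nontrivial by (auto simp: msum_add msum_empty msum_single carry_add_def add_comm)
    then have "\<not> state_less (msum {#x, y#}) (msum {#\<one>#})"
      using le_zero valid_msum[of "{#x, y#}"] by (auto simp: msum_single state_less_def valid_def)
    then show ?thesis using r[of "[x, y]" "[\<one>]"] xy V True by simp
  next
    case False
    have [simp]: "x \<in> carrier A" "y \<in> carrier A" using xy Vc by auto
    have "y \<noteq> \<one>" using False by auto
    then have "msum {#x, y#} = msum {#x \<oplus> y#}"
      using False by (simp add: msum_add[of x "{#y#}"] msum_single carry_add_def add_comm)
    then have "r (x \<oplus> y) = r x + r y" using req[of "[x, y]" "[x \<oplus> y]"] xy by simp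
    moreover have "r (x \<oplus> y) \<le> r \<one>" using mono_le xy V by simp
    ultimately show ?thesis by simp
  qed
  show ?thesis
  proof (rule that[of "\<lambda>x. r x / r \<one>"])
    fix x assume "x \<in> X"
    then have "x \<in> V" using V by auto
    then show "0 \<le> r x / r \<one> \<and> r x / r \<one> \<le> 1"
      using mono_le[of "\<zero>" x] mono_le[of x "\<one>"] r0 r1 V Vc by simp
    assume "\<sim> x \<in> X"
    then show "r (\<sim> x) / r \<one> = 1 - r x / r \<one>" using rneg[of x] \<open>x \<in> V\<close> V r1 by (auto simp: field_simps)
  next
    fix x y assume xy: "x \<in> X" "y \<in> X"
    show "r x / r \<one> < r y / r \<one>" if "x \<sqsubseteq> y" "x \<noteq> y"
      using mono[of x y] that xy V r1 by (auto intro: divide_strict_right_mono)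
    show "r (x \<oplus> y) / r \<one> = min (r x / r \<one> + r y / r \<one>) 1" if "x \<oplus> y \<in> X"
    proof -
      have "r (x \<oplus> y) = min (r x + r y) (r \<one>)" using radd[of x y] xy V that by blast
      then show ?thesis using r1 by (simp add: min_def field_simps)
    qed
  qed (use r0 r1 in auto)
qed

end

section \<open>Truncated max-min representation of Z-maps\<close>

text \<open>The closed sets on which single pieces agree with \<open>f\<close> cover
  \<open>S\<close>, and closure commutes with finite unions. Agreement of one piece both at the
  limit point and at a point of \<open>S\<close> later determines the sign of its slope.\<close>

lemma closure_meets_piece:
  fixes f :: "real \<Rightarrow> real"
  assumes f: "continuous_on {0..1} f" and L: "finite L" "\<And>l. l \<in> L \<Longrightarrow> continuous_on {0..1} l"
    and pieces: "\<And>t. t \<in> {0..1} \<Longrightarrow> \<exists>l\<in>L. f t = l t"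
    and S: "S \<subseteq> {0..1}" "t0 \<in> closure S"
  obtains l t where "l \<in> L" "f t0 = l t0" "t \<in> S" "f t = l t"
proof -
  define C where "C l = {t \<in> {0..1}. f t = l t}" for l
  have closed: "closed (C l)" if "l \<in> L" for l
    using continuous_closed_preimage_constant[of "{0..1}" "\<lambda>t. f t - l t" 0] f L(2)[OF that]
    by (simp add: C_def continuous_on_diff)
  have "S \<subseteq> (\<Union>l\<in>L. S \<inter> C l)" using S(1) pieces by (fastforce simp: C_def)
  also have "\<dots> \<subseteq> (\<Union>l\<in>L. closure (S \<inter> C l))" by (intro UN_mono closure_subset order_refl)
  finally have "closure S \<subseteq> (\<Union>l\<in>L. closure (S \<inter> C l))"
    using L(1) by (intro closure_minimal closed_UN) auto
  then obtain l where l: "l \<in> L" "t0 \<in> closure (S \<inter> C l)" using S(2) by blast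
  then have "t0 \<in> C l" using closure_minimal[of "S \<inter> C l" "C l"] closed by auto
  moreover have "S \<inter> C l \<noteq> {}" using l by auto
  ultimately show ?thesis using that[of l] l by (auto simp: C_def)
qed

text \<open>If \<open>f\<close> is positive at \<open>t1\<close>, a piece shared by the last
  nonpositive point before \<open>t1\<close> and a point after it with positive value must increase.
  If \<open>f\<close> is nonpositive throughout, a piece shared by 1 and an earlier point cannot
  decrease. The sign of the slope carries the inequalities to both ends of the segment.\<close>

lemma segment_piece_zero:
  fixes f :: "real \<Rightarrow> real"
  assumes f: "continuous_on {0..1} f" "f 0 = 0" "f 1 = 0"
    and L: "finite L" "\<And>l. l \<in> L \<Longrightarrow> \<exists>a b. l = (\<lambda>t. a + b * t)"
    and pieces: "\<And>t. t \<in> {0..1} \<Longrightarrow> \<exists>l\<in>L. f t = l t"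
  shows "\<exists>l\<in>L. l 0 \<le> 0 \<and> 0 \<le> l 1"
proof -
  have cont: "continuous_on {0..1} l" if "l \<in> L" for l
    using L(2)[OF that] by (auto intro!: continuous_intros)
  note piece = closure_meets_piece[OF f(1) L(1) cont pieces]
  show ?thesis
  proof (cases "\<exists>t\<in>{0..1}. f t > 0")
    case True
    then obtain t1 where t1: "t1 \<in> {0..1}" "f t1 > 0" by blast
    define T where "T = {t \<in> {0..t1}. f t \<le> 0}"
    have "continuous_on {0..t1} f" using f(1) continuous_on_subset t1 by fastforce
    then have "closed T" unfolding T_def
      by (intro continuous_closed_preimage[of "{0..t1}" f "{..0}", unfolded vimage_def Int_def, simplified]
          continuous_on_closed_Collect_le) auto
    moreover have "0 \<in> T" using t1 f by (simp add: T_def)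
    moreover have bdd: "bdd_above T" by (auto simp: T_def)
    ultimately have "Sup T \<in> T" using closed_contains_Sup by blast
    define t0 where "t0 = Sup T"
    have t0: "0 \<le> t0" "t0 \<le> t1" "f t0 \<le> 0" using \<open>Sup T \<in> T\<close> unfolding t0_def[symmetric] by (simp_all add: T_def)
    have "t0 < t1" using t0 t1 by (cases "t0 = t1") auto
    have pos: "f t > 0" if "t \<in> {t0<..t1}" for t
    proof (rule ccontr)
      assume "\<not> 0 < f t"
      then have "t \<in> T" using that t0 by (simp add: T_def)
      then show False using cSup_upper[OF _ bdd, of t] that by (simp add: t0_def)
    qed
    have S: "{t0<..t1} \<subseteq> {0..1}" "t0 \<in> closure {t0<..t1}"
      using t0 t1 \<open>t0 < t1\<close> by auto
    obtain l t where l: "l \<in> L" "f t0 = l t0" "t \<in> {t0<..t1}" "f t = l t" using piece[OF _ _ S] by blast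
    obtain a b where ab: "l = (\<lambda>t. a + b * t)" using L(2) l by blast
    have *: "a + b * t0 \<le> 0" "a + b * t > 0" "0 \<le> t0" "t0 < t" "t \<le> 1"
      using l ab t0 pos[of t] t1 by auto
    then have "b * (t - t0) > 0" by (simp add: algebra_simps)
    then have "b > 0" using * by (simp add: zero_less_mult_iff)
    then have "0 \<le> b * t0" "b * t \<le> b * 1" using * by (auto intro!: mult_left_mono)
    then have "l 0 \<le> 0" "0 \<le> l 1" using * ab by auto
    then show ?thesis using l by blast
  next
    case False
    then have neg: "f t \<le> 0" if "t \<in> {0..1}" for t using that by force
    have S: "{0..<1} \<subseteq> {0..1::real}" "1 \<in> closure {0..<1::real}" by auto
    obtain l t where l: "l \<in> L" "f 1 = l 1" "t \<in> {0..<1}" "f t = l t" using piece[OF _ _ S] by blast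
    obtain a b where ab: "l = (\<lambda>t. a + b * t)" using L(2) l by blast
    have *: "a + b = 0" "a + b * t \<le> 0" "0 \<le> t" "t < 1" using l ab f neg[of t] by auto
    then have "b * (1 - t) \<ge> 0" by (simp add: algebra_simps)
    then have "b \<ge> 0" using * by (simp add: zero_le_mult_iff)
    then have "l 0 \<le> 0" "0 \<le> l 1" using * ab by auto
    then show ?thesis using l by blast
  qed
qed

text \<open>Subtracting the chord of \<open>f\<close> keeps the pieces affine and makes both end
  values zero.\<close>

lemma segment_piece:
  fixes f :: "real \<Rightarrow> real"
  assumes f: "continuous_on {0..1} f"
    and L: "finite L" "\<And>l. l \<in> L \<Longrightarrow> \<exists>a b. l = (\<lambda>t. a + b * t)"
    and pieces: "\<And>t. t \<in> {0..1} \<Longrightarrow> \<exists>l\<in>L. f t = l t"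
  shows "\<exists>l\<in>L. l 0 \<le> f 0 \<and> f 1 \<le> l 1"
proof -
  define c where "c t = f 0 + (f 1 - f 0) * t" for t
  have "\<exists>l\<in>(\<lambda>l t. l t - c t) ` L. l 0 \<le> 0 \<and> 0 \<le> l 1"
  proof (rule segment_piece_zero[of "\<lambda>t. f t - c t"])
    show "continuous_on {0..1} (\<lambda>t. f t - c t)" unfolding c_def by (intro continuous_intros f)
    fix l assume "l \<in> (\<lambda>l t. l t - c t) ` L"
    then obtain a b where "l = (\<lambda>t. a + b * t - c t)" using L(2) by blast
    then have "l = (\<lambda>t. (a - f 0) + (b - (f 1 - f 0)) * t)" by (auto simp: c_def algebra_simps)
    then show "\<exists>a b. l = (\<lambda>t. a + b * t)" by blast
  next
    show "\<exists>l\<in>(\<lambda>l t. l t - c t) ` L. f t - c t = l t" if "t \<in> {0..1}" for t using pieces[OF that] by force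
  qed (use L in \<open>auto simp: c_def\<close>)
  then show ?thesis by (auto simp: c_def)
qed

text \<open>On the segment from \<open>x\<close> to \<open>y\<close> the pieces are affine in one
  parameter. This separation is what makes the max-min formula exact.\<close>

lemma int_piecewise_linear_separate:
  assumes f: "continuous_map (Euclidean_space d) euclideanreal f"
    and L: "finite L" "L \<subseteq> int_affine d"
    and pieces: "\<And>x. x \<in> topspace (Euclidean_space d) \<Longrightarrow> \<exists>l\<in>L. f x = l x"
    and x: "x \<in> topspace (Euclidean_space d)" and y: "y \<in> topspace (Euclidean_space d)"
  shows "\<exists>l\<in>L. l x \<le> f x \<and> f y \<le> l y"
proof -
  define p where "p t = (\<lambda>i. x i + t * (y i - x i))" for t :: real
  have p01: "p 0 = x" "p 1 = y" by (auto simp: p_def)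
  have p_top: "p t \<in> topspace (Euclidean_space d)" for t
    using x y by (auto simp: p_def topspace_Euclidean_space)
  have "continuous_map euclideanreal (powertop_real UNIV) p"
    unfolding p_def continuous_map_componentwise_UNIV by (auto intro!: continuous_intros)
  then have "continuous_map euclideanreal (Euclidean_space d) p"
    using p_top by (auto simp: Euclidean_space_def continuous_map_in_subtopology)
  then have "continuous_map euclideanreal euclideanreal (f \<circ> p)" using f continuous_map_compose by blast
  then have cont: "continuous_on {0..1} (\<lambda>t. f (p t))"
    by (auto simp: comp_def intro: continuous_on_subset)
  have "\<exists>l\<in>(\<lambda>l t. l (p t)) ` L. l 0 \<le> f (p 0) \<and> f (p 1) \<le> l 1"
  proof (rule segment_piece[OF cont])
    fix l assume "l \<in> (\<lambda>l t. l (p t)) ` L"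
    then obtain c a where "l = (\<lambda>t. real_of_int c + (\<Sum>i<d. real_of_int (a i) * p t i))"
      using L(2) by (auto simp: int_affine_def)
    then have "l = (\<lambda>t. (c + (\<Sum>i<d. a i * x i)) + (\<Sum>i<d. a i * (y i - x i)) * t)"
      by (auto simp: p_def algebra_simps sum.distrib sum_distrib_left sum_subtractf)
    then show "\<exists>a b. l = (\<lambda>t. a + b * t)" by blast
  qed (use L pieces[OF p_top] in auto)
  then show ?thesis by (auto simp: p01)
qed

text \<open>Attach to each \<open>y\<close> the pieces lying above \<open>f\<close> at
  \<open>y\<close>; all these sets are subsets of \<open>L\<close>, so there are finitely many. The
  set of \<open>x\<close> itself has minimum at least \<open>f x\<close> at \<open>x\<close>, and
  separation puts into the set of every \<open>y\<close> a piece that does not exceed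
  \<open>f x\<close> at \<open>x\<close>.\<close>

lemma int_piecewise_linear_max_min:
  assumes "int_piecewise_linear d f"
  obtains F where "finite F" "F \<noteq> {}" "\<And>G. G \<in> F \<Longrightarrow> finite G \<and> G \<noteq> {} \<and> G \<subseteq> int_affine d"
    "\<And>x. x \<in> topspace (Euclidean_space d) \<Longrightarrow> f x = (MAX G\<in>F. MIN l\<in>G. l x)"
proof -
  let ?E = "topspace (Euclidean_space d)"
  obtain L where f: "continuous_map (Euclidean_space d) euclideanreal f"
    and L: "finite L" "L \<subseteq> int_affine d" "\<And>x. x \<in> ?E \<Longrightarrow> \<exists>l\<in>L. f x = l x"
    using assms by (auto simp: int_piecewise_linear_def)
  define G where "G y = {l \<in> L. f y \<le> l y}" for y
  define F where "F = G ` ?E"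
  have "F \<subseteq> Pow L" by (auto simp: F_def G_def)
  then have finF: "finite F" using L(1) by (simp add: finite_subset)
  have Gne: "G y \<noteq> {}" if "y \<in> ?E" for y using L(3)[OF that] by (force simp: G_def)
  have finG: "finite (G y)" for y using L(1) by (simp add: G_def)
  have "(\<lambda>_. 0) \<in> ?E" by (simp add: topspace_Euclidean_space)
  then have "F \<noteq> {}" by (auto simp: F_def)
  moreover have "f x = (MAX G\<in>F. MIN l\<in>G. l x)" if x: "x \<in> ?E" for x
  proof (rule antisym)
    have "f x \<le> (MIN l\<in>G x. l x)" using Gne[OF x] finG by (subst Min_ge_iff) (auto simp: G_def)
    also have "\<dots> \<le> (MAX G\<in>F. MIN l\<in>G. l x)" using finF x by (intro Max_ge) (auto simp: F_def)
    finally show "f x \<le> (MAX G\<in>F. MIN l\<in>G. l x)" .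
    show "(MAX G\<in>F. MIN l\<in>G. l x) \<le> f x"
    proof (subst Max_le_iff)
      show "\<forall>a\<in>(\<lambda>G. MIN l\<in>G. l x) ` F. a \<le> f x"
      proof (clarsimp simp: F_def)
        fix y assume y: "y \<in> ?E"
        obtain l where l: "l \<in> L" "l x \<le> f x" "f y \<le> l y"
          using int_piecewise_linear_separate[OF f L x y] by blast
        have "(MIN l\<in>G y. l x) \<le> l x" using finG l by (intro Min_le) (auto simp: G_def)
        then show "(MIN l\<in>G y. l x) \<le> f x" using l by simp
      qed
    qed (use finF \<open>F \<noteq> {}\<close> in auto)
  qed
  moreover have "finite G' \<and> G' \<noteq> {} \<and> G' \<subseteq> int_affine d" if "G' \<in> F" for G'
    using that Gne finG L(2) by (auto simp: F_def) (auto simp: G_def)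
  ultimately show ?thesis using that finF by blast
qed

section \<open>Truncated affine functions in an algebra of functions\<close>

definition trunc :: "real \<Rightarrow> real" where "trunc r = max 0 (min 1 r)"

text \<open>The left side is \<open>(trunc r \<oplus> s) \<odot> trunc (r + 1)\<close> in the unit
  interval. The second factor corrects the case \<open>r < 0\<close>, where truncating before the
  addition loses information.\<close>

lemma trunc_add:
  assumes "0 \<le> s" "s \<le> 1"
  shows "max 0 (min (trunc r + s) 1 - (1 - trunc (r + 1))) = trunc (r + s)"
proof -
  consider "r \<le> -1" | "-1 \<le> r" "r \<le> 0" | "0 \<le> r" "r \<le> 1" | "1 \<le> r" by linarith
  then show ?thesis using assms by cases (auto simp: trunc_def min_def max_def)
qed

locale unit_interval_subalgebra =
  fixes X :: "(nat \<Rightarrow> real) set" and H :: "((nat \<Rightarrow> real) \<Rightarrow> real) set"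
  assumes range: "f \<in> H \<Longrightarrow> x \<in> X \<Longrightarrow> 0 \<le> f x \<and> f x \<le> 1"
    and zero: "(\<lambda>x\<in>X. 0) \<in> H"
    and neg: "f \<in> H \<Longrightarrow> (\<lambda>x\<in>X. 1 - f x) \<in> H"
    and add: "f \<in> H \<Longrightarrow> g \<in> H \<Longrightarrow> (\<lambda>x\<in>X. min (f x + g x) 1) \<in> H"
begin

definition represented :: "((nat \<Rightarrow> real) \<Rightarrow> real) \<Rightarrow> bool" where
  "represented f \<longleftrightarrow> restrict f X \<in> H"

lemma represented_cong: "(\<And>x. x \<in> X \<Longrightarrow> f x = g x) \<Longrightarrow> represented f \<longleftrightarrow> represented g"
  by (simp add: represented_def cong: restrict_cong)

lemma represented_range: "represented f \<Longrightarrow> x \<in> X \<Longrightarrow> 0 \<le> f x \<and> f x \<le> 1"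
  using range[of "restrict f X" x] by (simp add: represented_def)

lemma represented_zero: "represented (\<lambda>_. 0)"
  using zero by (simp add: represented_def)

lemma represented_neg: "represented f \<Longrightarrow> represented (\<lambda>x. 1 - f x)"
  using neg[of "restrict f X"] by (simp add: represented_def cong: restrict_cong)

lemma represented_add: "represented f \<Longrightarrow> represented g \<Longrightarrow> represented (\<lambda>x. min (f x + g x) 1)"
  using add[of "restrict f X" "restrict g X"] by (simp add: represented_def cong: restrict_cong)

lemma represented_one: "represented (\<lambda>_. 1)"
  using represented_neg[OF represented_zero] by simp

lemma represented_diff:
  assumes "represented f" "represented g"
  shows "represented (\<lambda>x. max 0 (f x - g x))"
  using represented_neg[OF represented_add[OF represented_neg[OF assms(1)] assms(2)]]
  by (rule represented_cong[THEN iffD1, rotated]) (auto simp: min_def max_def)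

lemma represented_max:
  assumes "represented f" "represented g"
  shows "represented (\<lambda>x. max (f x) (g x))"
  using represented_add[OF represented_diff[OF assms] assms(2)]
  by (rule represented_cong[THEN iffD1, rotated])
     (use assms[THEN represented_range] in \<open>force simp: min_def max_def\<close>)

lemma represented_min:
  assumes "represented f" "represented g"
  shows "represented (\<lambda>x. min (f x) (g x))"
  using represented_neg[OF represented_max[OF assms[THEN represented_neg]]]
  by (rule represented_cong[THEN iffD1, rotated]) (auto simp: min_def max_def)

lemma represented_Max:
  assumes "finite I" "I \<noteq> {}" "\<And>i. i \<in> I \<Longrightarrow> represented (f i)"
  shows "represented (\<lambda>x. MAX i\<in>I. f i x)"
  using assms by (induction I rule: finite_ne_induct) (simp_all add: represented_max)

lemma represented_Min:
  assumes "finite I" "I \<noteq> {}" "\<And>i. i \<in> I \<Longrightarrow> represented (f i)"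
  shows "represented (\<lambda>x. MIN i\<in>I. f i x)"
  using assms by (induction I rule: finite_ne_induct) (simp_all add: represented_min)

text \<open>All integer shifts at once, because the addition formula for truncations uses both
  \<open>r\<close> and \<open>r + 1\<close>.\<close>

definition truncs_represented :: "((nat \<Rightarrow> real) \<Rightarrow> real) \<Rightarrow> bool" where
  "truncs_represented f \<longleftrightarrow> (\<forall>c::int. represented (\<lambda>x. trunc (f x + c)))"

lemma truncs_represented_zero: "truncs_represented (\<lambda>_. 0)"
proof -
  have "trunc (real_of_int c) = (if c \<ge> 1 then 1 else 0)" for c by (auto simp: trunc_def)
  then show ?thesis by (simp add: truncs_represented_def represented_zero represented_one)
qed

lemma truncs_represented_add:
  assumes f: "truncs_represented f" and g: "represented g"
  shows "truncs_represented (\<lambda>x. f x + g x)"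
  unfolding truncs_represented_def
proof
  fix c :: int
  have "represented (\<lambda>x. trunc (f x + c))" "represented (\<lambda>x. trunc (f x + c + 1))"
    using f[unfolded truncs_represented_def, THEN spec, of c]
      f[unfolded truncs_represented_def, THEN spec, of "c + 1"] by (simp_all add: add.assoc)
  then have "represented (\<lambda>x. max 0 (min (trunc (f x + c) + g x) 1 - (1 - trunc (f x + c + 1))))"
    by (intro represented_diff represented_add represented_neg g)
  then have "represented (\<lambda>x. trunc (f x + c + g x))"
    by (rule represented_cong[THEN iffD1, rotated]) (use represented_range[OF g] in \<open>simp add: trunc_add\<close>)
  then show "represented (\<lambda>x. trunc (f x + g x + c))" by (simp add: add_ac)
qed

lemma truncs_represented_shift:
  assumes "truncs_represented f" shows "truncs_represented (\<lambda>x. f x + real_of_int k)"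
  unfolding truncs_represented_def
proof
  show "represented (\<lambda>x. trunc (f x + real_of_int k + real_of_int c))" for c
    using assms[unfolded truncs_represented_def, THEN spec, of "k + c"] by (simp add: add.assoc)
qed

text \<open>\<open>f - g = (f - 1) + (1 - g)\<close>: an integer shift, followed by adding a
  represented function.\<close>

lemma truncs_represented_diff:
  assumes "truncs_represented f" and "represented g"
  shows "truncs_represented (\<lambda>x. f x - g x)"
  using truncs_represented_add[OF truncs_represented_shift[OF assms(1), of "-1"] represented_neg[OF assms(2)]]
  by simp

lemma truncs_represented_add_mult:
  assumes "truncs_represented f" and "represented g"
  shows "truncs_represented (\<lambda>x. f x + real_of_int k * g x)"
proof (induction k rule: int_induct[of _ 0])
  case base
  then show ?case using assms by simp
next
  case (step1 i)
  show ?case using truncs_represented_add[OF step1(2) assms(2)] by (simp add: algebra_simps)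
next
  case (step2 i)
  show ?case using truncs_represented_diff[OF step2(2) assms(2)] by (simp add: algebra_simps)
qed

lemma truncs_represented_sum:
  fixes n :: nat
  assumes "\<And>i. i < n \<Longrightarrow> represented (g i)"
  shows "truncs_represented (\<lambda>x. \<Sum>i<n. real_of_int (a i) * g i x)"
  using assms
proof (induction n)
  case (Suc n)
  then show ?case using truncs_represented_add_mult[OF Suc.IH, of "g n" "a n"] by simp
qed (simp add: truncs_represented_zero)

text \<open>Truncation is monotone, so it commutes with the maxima and minima of the max-min
  formula, and it fixes \<open>f\<close> on \<open>X\<close>. What remains are truncated affine
  pieces, which are built up coordinate by coordinate.\<close>

lemma represented_int_piecewise_linear:
  assumes coord: "\<And>i. i < d \<Longrightarrow> represented (\<lambda>x. x i)"
    and X: "X \<subseteq> topspace (Euclidean_space d)"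
    and f: "int_piecewise_linear d f" and f01: "f ` X \<subseteq> {0..1}"
  shows "represented f"
proof -
  obtain F where F: "finite F" "F \<noteq> {}" "\<And>G. G \<in> F \<Longrightarrow> finite G \<and> G \<noteq> {} \<and> G \<subseteq> int_affine d"
    "\<And>x. x \<in> topspace (Euclidean_space d) \<Longrightarrow> f x = (MAX G\<in>F. MIN l\<in>G. l x)"
    using int_piecewise_linear_max_min[OF f] by blast
  have l: "represented (\<lambda>x. trunc (l x))" if l: "l \<in> int_affine d" for l
  proof -
    obtain c a where l: "l = (\<lambda>x. real_of_int c + (\<Sum>i<d. real_of_int (a i) * x i))"
      using l by (auto simp: int_affine_def)
    show ?thesis
      using truncs_represented_sum[of d "\<lambda>i x. x i" a] coord
      by (simp add: l truncs_represented_def add.commute)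
  qed
  have mono: "mono trunc" by (auto simp: mono_def trunc_def)
  have "represented (\<lambda>x. MAX G\<in>F. MIN l\<in>G. trunc (l x))"
    by (intro represented_Max represented_Min l) (use F in auto)
  moreover have "(MAX G\<in>F. MIN l\<in>G. trunc (l x)) = f x" if "x \<in> X" for x
  proof -
    have "(MIN l\<in>G. trunc (l x)) = trunc (MIN l\<in>G. l x)" if "G \<in> F" for G
      using F(3)[OF that] mono_Min_commute[OF mono, of "(\<lambda>l. l x) ` G"] by (simp add: image_image)
    then have "(MAX G\<in>F. MIN l\<in>G. trunc (l x)) = (MAX G\<in>F. trunc (MIN l\<in>G. l x))"
      by (simp cong: image_cong)
    also have "\<dots> = trunc (MAX G\<in>F. MIN l\<in>G. l x)"
      using F mono_Max_commute[OF mono, of "(\<lambda>G. MIN l\<in>G. l x) ` F"] by (simp add: image_image)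
    also have "\<dots> = trunc (f x)" using F(4) X that by auto
    also have "\<dots> = f x" using f01 that by (auto simp: trunc_def image_subset_iff)
    finally show ?thesis .
  qed
  ultimately show ?thesis by (rule represented_cong[THEN iffD1, rotated])
qed

end

section \<open>Points of the companion polyhedron\<close>

text \<open>\<open>m t\<close> is the gap from \<open>t\<close> to the next element of
  \<open>T\<close>, or to \<open>u\<close> after the last one; starting from 0, the gaps below
  \<open>y\<close> telescope to \<open>y\<close>.\<close>

lemma telescoping_weights:
  fixes u :: real
  assumes "finite T" "0 \<in> T" "\<And>t. t \<in> T \<Longrightarrow> 0 \<le> t \<and> t < u"
  obtains m :: "real \<Rightarrow> real" where "\<And>t. t \<in> T \<Longrightarrow> 0 \<le> m t"
    "\<And>y. y \<in> insert u T \<Longrightarrow> (\<Sum>t | t \<in> T \<and> t < y. m t) = y"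
proof -
  have "\<exists>m::real \<Rightarrow> real. (\<forall>t\<in>T. 0 \<le> m t) \<and> (\<forall>y\<in>insert u T. (\<Sum>t | t \<in> T \<and> t < y. m t) = y)"
    using assms
  proof (induction T arbitrary: u rule: finite_linorder_max_induct)
    case (insert b A)
    show ?case
    proof (cases "A = {}")
      case True
      then have [simp]: "b = 0" using insert.prems by simp
      have "{t. t = 0 \<and> t < u} = {0}" using insert.prems by auto
      then show ?thesis using insert.prems True by (intro exI[of _ "\<lambda>_. u"]) auto
    next
      case False
      then have "0 \<in> A" using insert by force
      \<comment> \<open>Here \<open>b\<close> serves as the upper end, so that the gap of the former
        maximum ends at \<open>b\<close>; the gap from \<open>b\<close> to \<open>u\<close> is added
        afterwards.\<close>
      have "\<exists>m::real \<Rightarrow> real. (\<forall>t\<in>A. 0 \<le> m t) \<and> (\<forall>y\<in>insert b A. (\<Sum>t | t \<in> A \<and> t < y. m t) = y)"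
        by (rule insert.IH[OF \<open>0 \<in> A\<close>]) (use insert.prems insert.hyps in auto)
      then obtain m :: "real \<Rightarrow> real" where m: "\<And>t. t \<in> A \<Longrightarrow> 0 \<le> m t"
        "\<And>y. y \<in> insert b A \<Longrightarrow> (\<Sum>t | t \<in> A \<and> t < y. m t) = y"
        by blast
      have "b \<notin> A" using insert.hyps by auto
      define m' where "m' = m(b := u - b)"
      have m'A: "m' t = m t" if "t \<in> A" for t using that \<open>b \<notin> A\<close> by (auto simp: m'_def)
      have "(\<Sum>t | t \<in> insert b A \<and> t < y. m' t) = y" if y: "y \<in> insert u (insert b A)" for y
      proof (cases "y = u")
        case True
        have "{t. t \<in> insert b A \<and> t < u} = insert b A" using insert.prems by auto
        moreover have "{t. t \<in> A \<and> t < b} = A" using insert.hyps by auto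
        moreover have "sum m' A = sum m A" using m'A by (auto intro: sum.cong)
        moreover have "m' b = u - b" by (simp add: m'_def)
        ultimately show ?thesis using True m(2)[of b] \<open>b \<notin> A\<close> insert.hyps by simp
      next
        case False
        then have "y \<in> insert b A" using y by auto
        then have "{t. t \<in> insert b A \<and> t < y} = {t. t \<in> A \<and> t < y}" using insert.hyps by force
        moreover have "sum m' {t. t \<in> A \<and> t < y} = sum m {t. t \<in> A \<and> t < y}" using m'A by (auto intro: sum.cong)
        ultimately show ?thesis using m(2)[OF \<open>y \<in> insert b A\<close>] by simp
      qed
      moreover have "0 \<le> m' t" if "t \<in> insert b A" for t
        using that m(1)[of t] insert.prems(2)[of b] by (auto simp: m'_def)
      ultimately show ?thesis by blast
    qed
  qed simp
  then show ?thesis using that by blast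
qed

lemma finite_total_greatest:
  assumes "finite T" "T \<noteq> {}" "\<And>x y. x \<in> T \<Longrightarrow> y \<in> T \<Longrightarrow> le x y \<or> le y x"
    and "\<And>x y z. x \<in> T \<Longrightarrow> y \<in> T \<Longrightarrow> z \<in> T \<Longrightarrow> le x y \<Longrightarrow> le y z \<Longrightarrow> le x z"
  shows "\<exists>k\<in>T. \<forall>j\<in>T. le j k"
  using assms
proof (induction T rule: finite_ne_induct)
  case (singleton x)
  show ?case using singleton(1)[of x x] by simp
next
  case (insert x F)
  have "\<exists>k\<in>F. \<forall>j\<in>F. le j k" by (rule insert.IH) (use insert.prems in blast)+
  then obtain k where k: "k \<in> F" "\<forall>j\<in>F. le j k" by blast
  show ?case
  proof (cases "le x k")
    case False
    then have "le k x" using insert.prems(1)[of x k] k by auto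
    then have "\<forall>j\<in>F. le j x" using insert.prems(2) k by blast
    then show ?thesis using insert.prems(1)[of x x] by auto
  qed (use k in blast)
qed

lemma K3_le_antisym: "K3_le x y \<Longrightarrow> K3_le y x \<Longrightarrow> x = y"
  by (auto simp: K3_le_def)

lemma K3_le_trans: "K3_le x y \<Longrightarrow> K3_le y z \<Longrightarrow> K3_le x z"
  by (auto simp: K3_le_def)

locale dual_kleene_space = kleene_algebra B for B :: "('a, 'm) kleene_scheme" +
  fixes w :: "nat \<Rightarrow> 'a \<Rightarrow> real" and d :: nat
  assumes finite_carrier: "finite (carrier B)"
    and enum: "bij_betw w {..<d} (dual_points B)"
begin

lemmas k_closed [simp] = join_closed meet_closed neg_closed zero_closed one_closed

abbreviation le where "le i j \<equiv> dual_le B (w i) (w j)"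
abbreviation weight ("\<omega>") where "\<omega> i \<equiv> real (dual_weight B (w i))"
abbreviation "P \<equiv> companion_polyhedron d w (nerve (dual_points B) (dual_le B)) (dual_weight B)"

lemma w_dual: "i < d \<Longrightarrow> w i \<in> dual_points B"
  using enum by (auto simp: bij_betw_def)

lemma w_hom:
  assumes "i < d"
  shows "b \<in> carrier B \<Longrightarrow> w i b \<in> {0, 1/2, 1}"
    "a \<in> carrier B \<Longrightarrow> b \<in> carrier B \<Longrightarrow> w i (k_join B a b) = max (w i a) (w i b)"
    "a \<in> carrier B \<Longrightarrow> b \<in> carrier B \<Longrightarrow> w i (k_meet B a b) = min (w i a) (w i b)"
    "b \<in> carrier B \<Longrightarrow> w i (k_neg B b) = 1 - w i b"
    "w i (k_zero B) = 0" "w i (k_one B) = 1"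
  using w_dual[OF assms] by (auto simp: dual_points_def kleene_hom_def K3_def)

lemmas w_ops = w_hom(2-)

lemma w_inj: "i < d \<Longrightarrow> j < d \<Longrightarrow> (\<And>b. b \<in> carrier B \<Longrightarrow> w i b = w j b) \<Longrightarrow> i = j"
proof -
  assume ij: "i < d" "j < d" and eq: "\<And>b. b \<in> carrier B \<Longrightarrow> w i b = w j b"
  have "w i = w j"
    using w_dual[OF ij(1)] w_dual[OF ij(2)] eq unfolding dual_points_def kleene_hom_def
    by (intro extensionalityI[of _ "carrier B"]) (auto simp: PiE_def)
  then show ?thesis using enum ij by (auto simp: bij_betw_def inj_on_def)
qed

lemma le_refl: "i < d \<Longrightarrow> le i i"
  using w_hom(1) by (auto simp: dual_le_def K3_le_def)

lemma le_trans: "le i j \<Longrightarrow> le j k \<Longrightarrow> le i k"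
  using K3_le_trans unfolding dual_le_def by blast

lemma le_antisym: "i < d \<Longrightarrow> j < d \<Longrightarrow> le i j \<Longrightarrow> le j i \<Longrightarrow> i = j"
  using K3_le_antisym unfolding dual_le_def by (intro w_inj) auto

lemma weight_pos: "0 < \<omega> i"
  by (simp add: dual_weight_def)

lemma weight_nonzero [simp]: "dual_weight B v \<noteq> 0"
  by (simp add: dual_weight_def)

text \<open>The vertices are multiples of different basis vectors, so the numbers
  \<open>\<omega> i * x i\<close> are the barycentric coordinates of \<open>x\<close>, and the
  support of \<open>x\<close> spans the smallest simplex containing it. Membership thus becomes a
  chain condition on the support.\<close>

lemma mem_P_iff:
  "x \<in> P \<longleftrightarrow> (\<forall>j\<ge>d. x j = 0) \<and> (\<forall>i<d. 0 \<le> x i) \<and> (\<Sum>i<d. \<omega> i * x i) = 1 \<and>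
     (\<forall>i<d. \<forall>j<d. x i \<noteq> 0 \<longrightarrow> x j \<noteq> 0 \<longrightarrow> le i j \<or> le j i)" (is "_ \<longleftrightarrow> ?R")
proof -
  define e where "e i = (\<lambda>j. std_basis i j / \<omega> i)" for i
  have e_inj: "inj e"
  proof (rule injI)
    fix i j assume "e i = e j"
    then have "e i i = e j i" by simp
    then show "i = j" using weight_pos[of i] by (auto simp: e_def std_basis_def split: if_splits)
  qed
  define I where "I S = {i. i < d \<and> w i \<in> S}" for S
  have I: "finite (I S)" "I S \<subseteq> {..<d}" for S by (auto simp: I_def)
  have P_eq: "P = (\<Union>S\<in>nerve (dual_points B) (dual_le B). conv_finite (e ` I S))"
  proof -
    have "{(\<lambda>j. std_basis i j / \<omega> i) | i. i < d \<and> w i \<in> S} = e ` I S" for S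
      unfolding e_def I_def by blast
    then show ?thesis by (simp only: companion_polyhedron_def)
  qed
  have sum_e: "(\<Sum>v\<in>e ` I S. u v * v j) = (if j \<in> I S then u (e j) / \<omega> j else 0)" for S u j
  proof -
    have "(\<Sum>v\<in>e ` I S. u v * v j) = (\<Sum>i\<in>I S. u (e i) * e i j)"
      using e_inj by (subst sum.reindex) (auto intro: inj_on_subset)
    also have "\<dots> = (\<Sum>i\<in>I S. if i = j then u (e j) / \<omega> j else 0)"
      by (rule sum.cong) (auto simp: e_def std_basis_def)
    finally show ?thesis using I(1) by simp
  qed
  have sum_u: "sum u (e ` I S) = (\<Sum>i\<in>I S. u (e i))" for u :: "(nat \<Rightarrow> real) \<Rightarrow> real" and S
    using e_inj by (subst sum.reindex) (auto intro: inj_on_subset)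
  show ?thesis
  proof
    assume "x \<in> P"
    then obtain S u where S: "S \<in> nerve (dual_points B) (dual_le B)"
      and u: "\<forall>v\<in>e ` I S. 0 \<le> u v" "sum u (e ` I S) = 1" "x = (\<lambda>j. \<Sum>v\<in>e ` I S. u v * v j)"
      unfolding P_eq conv_finite_def by blast
    have x: "x j = (if j \<in> I S then u (e j) / \<omega> j else 0)" for j by (simp add: u(3) sum_e)
    have "(\<Sum>i<d. \<omega> i * x i) = (\<Sum>i\<in>I S. u (e i))"
      by (rule sum.mono_neutral_cong_right) (auto simp: x I_def)
    then have "(\<Sum>i<d. \<omega> i * x i) = 1" using u(2) sum_u by simp
    moreover have "\<forall>i<d. 0 \<le> x i" using u(1) by (auto simp: x)
    moreover have "\<forall>j\<ge>d. x j = 0" by (auto simp: x I_def)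
    moreover have "le i j \<or> le j i" if "x i \<noteq> 0" "x j \<noteq> 0" for i j
      using that S by (auto simp: x nerve_def I_def split: if_splits)
    ultimately show ?R by blast
  next
    assume R: ?R
    define S where "S = w ` {i. i < d \<and> x i \<noteq> 0}"
    have "S \<in> nerve (dual_points B) (dual_le B)" using R w_dual by (auto simp: nerve_def S_def)
    moreover have "x \<in> conv_finite (e ` I S)"
    proof -
      have IS: "i \<in> I S \<longleftrightarrow> i < d \<and> x i \<noteq> 0" for i
        using enum by (auto simp: I_def S_def bij_betw_def inj_on_def)
      define u where "u v = \<omega> (inv e v) * x (inv e v)" for v
      have ue: "u (e i) = \<omega> i * x i" for i by (simp add: u_def inv_f_f[OF e_inj])
      have "x = (\<lambda>j. \<Sum>v\<in>e ` I S. u v * v j)"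
        unfolding sum_e ue using R by (auto simp: IS fun_eq_iff not_less)
      moreover have "\<forall>v\<in>e ` I S. 0 \<le> u v" using R by (auto simp: ue I_def)
      moreover have "sum u (e ` I S) = 1"
      proof -
        have "(\<Sum>i\<in>I S. \<omega> i * x i) = (\<Sum>i<d. \<omega> i * x i)"
          by (intro sum.mono_neutral_left) (auto simp: IS)
        then show ?thesis using R by (simp add: sum_u ue)
      qed
      ultimately show ?thesis unfolding conv_finite_def by blast
    qed
    ultimately show "x \<in> P" unfolding P_eq by blast
  qed
qed

definition lin :: "'a \<Rightarrow> (nat \<Rightarrow> real) \<Rightarrow> real" where
  "lin b x = (\<Sum>i<d. \<omega> i * w i b * x i)"

text \<open>If two elements take distinct values at the lower of two comparable points, then the
  smaller value is 0 or the larger one is 1. Such a value persists at the upper point, so the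
  inequality cannot be reversed there.\<close>

lemma comparable_on_support:
  assumes x: "x \<in> P" and ab: "a \<in> carrier B" "b \<in> carrier B"
  shows "(\<forall>i<d. x i \<noteq> 0 \<longrightarrow> w i a \<le> w i b) \<or> (\<forall>i<d. x i \<noteq> 0 \<longrightarrow> w i b \<le> w i a)"
proof (rule ccontr)
  assume "\<not> ?thesis"
  then obtain i j where ij: "i < d" "j < d" "x i \<noteq> 0" "x j \<noteq> 0" "w i b < w i a" "w j a < w j b"
    by (auto simp: not_le)
  then have "le i j \<or> le j i" using x by (simp add: mem_P_iff)
  then have "K3_le (w i a) (w j a) \<and> K3_le (w i b) (w j b) \<or> K3_le (w j a) (w i a) \<and> K3_le (w j b) (w i b)"
    using ab by (auto simp: dual_le_def)
  then show False using ij by (auto simp: K3_le_def)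
qed

lemma lin_mono:
  assumes "x \<in> P" "\<And>i. i < d \<Longrightarrow> x i \<noteq> 0 \<Longrightarrow> w i a \<le> w i b"
  shows "lin a x \<le> lin b x"
  unfolding lin_def
proof (rule sum_mono)
  fix i assume "i \<in> {..<d}"
  then show "\<omega> i * w i a * x i \<le> \<omega> i * w i b * x i"
    using assms by (cases "x i = 0") (auto simp: mem_P_iff intro!: mult_right_mono mult_left_mono)
qed

lemma lin_cong:
  assumes "\<And>i. i < d \<Longrightarrow> x i \<noteq> 0 \<Longrightarrow> w i a = w i b"
  shows "lin a x = lin b x"
  unfolding lin_def by (rule sum.cong) (use assms in auto)

lemma lin_join:
  assumes x: "x \<in> P" and ab: "a \<in> carrier B" "b \<in> carrier B"
  shows "lin (k_join B a b) x = max (lin a x) (lin b x)"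
  using comparable_on_support[OF assms]
proof
  assume *: "\<forall>i<d. x i \<noteq> 0 \<longrightarrow> w i a \<le> w i b"
  then have "lin (k_join B a b) x = lin b x" using ab by (intro lin_cong) (auto simp: w_ops max_def)
  then show ?thesis using lin_mono[OF x, of a b] * by simp
next
  assume *: "\<forall>i<d. x i \<noteq> 0 \<longrightarrow> w i b \<le> w i a"
  then have "lin (k_join B a b) x = lin a x" using ab by (intro lin_cong) (auto simp: w_ops max_def)
  then show ?thesis using lin_mono[OF x, of b a] * by simp
qed

lemma lin_neg:
  assumes "x \<in> P" "b \<in> carrier B"
  shows "lin (k_neg B b) x = 1 - lin b x"
proof -
  have "lin (k_neg B b) x = (\<Sum>i<d. \<omega> i * x i - \<omega> i * w i b * x i)"
    unfolding lin_def using assms by (intro sum.cong) (auto simp: w_ops algebra_simps)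
  then show ?thesis using assms by (simp add: sum_subtractf mem_P_iff lin_def)
qed

lemma meet_eq: "a \<in> carrier B \<Longrightarrow> b \<in> carrier B \<Longrightarrow> k_meet B a b = k_neg B (k_join B (k_neg B a) (k_neg B b))"
  using de_morgan[of a b] neg_neg[of "k_meet B a b"] by simp

lemma one_eq: "k_one B = k_neg B (k_zero B)" by (simp add: neg_zero)

lemma lin_zero: "lin (k_zero B) x = 0"
  by (simp add: lin_def w_ops)

lemma lin_range: "x \<in> P \<Longrightarrow> b \<in> carrier B \<Longrightarrow> 0 \<le> lin b x \<and> lin b x \<le> 1"
proof -
  have nonneg: "0 \<le> lin c x" if "x \<in> P" "c \<in> carrier B" for c
    unfolding lin_def
  proof (rule sum_nonneg)
    fix i assume "i \<in> {..<d}"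
    then have "0 \<le> w i c" "0 \<le> x i" using that w_hom(1)[of i c] by (auto simp: mem_P_iff)
    then show "0 \<le> \<omega> i * w i c * x i" by simp
  qed
  assume "x \<in> P" "b \<in> carrier B"
  then show ?thesis using nonneg[of b] nonneg[of "k_neg B b"] lin_neg[of x b] by simp
qed

lemma lin_int_piecewise_linear:
  assumes b: "b \<in> carrier B"
  shows "int_piecewise_linear d (lin b)"
proof -
  define a where "a i = \<lfloor>\<omega> i * w i b\<rfloor>" for i
  have a: "real_of_int (a i) = \<omega> i * w i b" if "i < d" for i
  proof -
    \<comment> \<open>A point of weight 1 never takes the value 1/2, so the coefficients are
      integers and the floor changes nothing.\<close>
    have "\<omega> i * w i b \<in> {0, 1, 2}"
      using w_hom(1)[OF that b] b w_dual[OF that] by (auto simp: dual_weight_def dual_M_def image_subset_iff)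
    then show ?thesis by (auto simp: a_def)
  qed
  have eq: "lin b = (\<lambda>x. real_of_int 0 + (\<Sum>i<d. real_of_int (a i) * x i))"
    by (auto simp: lin_def a intro!: ext sum.cong)
  then have "lin b \<in> int_affine d" unfolding int_affine_def by blast
  moreover have "continuous_map (Euclidean_space d) euclideanreal (lin b)"
    unfolding lin_def
    by (intro continuous_map_sum continuous_map_real_mult continuous_map_const[THEN iffD2])
       (auto simp: Euclidean_space_def intro!: continuous_map_from_subtopology continuous_map_product_projection)
  ultimately show ?thesis unfolding int_piecewise_linear_def by (intro conjI exI[of _ "{lin b}"]) auto
qed

text \<open>Every Kleene homomorphism \<open>\<phi>\<close> into \<open>[0, 1]\<close> is the mean \<open>\<phi> = 2 \<integral>\<^sub>0\<^sup>1\<^sup>/\<^sup>2 \<kappa> t dt\<close> of its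
  thresholds \<open>\<kappa> t\<close>, which form a chain.\<close>

lemma kleene_hom_is_point:
  assumes range: "\<And>b. b \<in> carrier B \<Longrightarrow> 0 \<le> \<phi> b \<and> \<phi> b \<le> 1"
    and join: "\<And>a b. a \<in> carrier B \<Longrightarrow> b \<in> carrier B \<Longrightarrow> \<phi> (k_join B a b) = max (\<phi> a) (\<phi> b)"
    and neg: "\<And>b. b \<in> carrier B \<Longrightarrow> \<phi> (k_neg B b) = 1 - \<phi> b"
    and zero: "\<phi> (k_zero B) = 0"
  shows "\<exists>x\<in>P. \<forall>b\<in>carrier B. lin b x = \<phi> b"
proof -
  have meet: "\<phi> (k_meet B a b) = min (\<phi> a) (\<phi> b)" if "a \<in> carrier B" "b \<in> carrier B" for a b
    using that by (simp add: meet_eq neg join)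
  \<comment> \<open>Values within \<open>t\<close> of an end go to that end, all others to 1/2.
    Monotonicity yields the lattice operations, symmetry under \<open>y \<mapsto> 1 - y\<close>
    yields negation.\<close>
  define \<theta> where "\<theta> t y = (if y \<le> t then 0 else if 1 - t \<le> y then 1 else 1/2 :: real)" for t y :: real
  define \<kappa> where "\<kappa> t = (\<lambda>b\<in>carrier B. \<theta> t (\<phi> b))" for t
  \<comment> \<open>The threshold \<open>\<kappa> t\<close> changes only at these \<open>t\<close>,
    so the integral becomes a finite sum weighted by the gaps.\<close>
  define T where "T = insert 0 {y \<in> \<phi> ` carrier B. y < 1/2}"
  have T: "finite T" "0 \<in> T" "\<And>t. t \<in> T \<Longrightarrow> 0 \<le> t \<and> t < 1/2" using finite_carrier range by (auto simp: T_def)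
  obtain m where m: "\<And>t. t \<in> T \<Longrightarrow> 0 \<le> m t" "\<And>y. y \<in> insert (1/2) T \<Longrightarrow> (\<Sum>t | t \<in> T \<and> t < y. m t) = y"
    using telescoping_weights[OF T] by blast
  have \<kappa>_dual: "\<kappa> t \<in> dual_points B" if "t \<in> T" for t
  proof -
    have t: "0 \<le> t" "t < 1/2" using T(3)[OF that] by auto
    have "mono (\<theta> t)" using t by (auto simp: mono_def \<theta>_def)
    then have "\<theta> t (max y z) = max (\<theta> t y) (\<theta> t z)" "\<theta> t (min y z) = min (\<theta> t y) (\<theta> t z)" for y z
      by (simp_all add: max_of_mono min_of_mono)
    moreover have "\<theta> t (1 - y) = 1 - \<theta> t y" "\<theta> t y \<in> {0, 1/2, 1}" for y using t by (auto simp: \<theta>_def)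
    moreover have "\<theta> t 0 = 0" "\<theta> t 1 = 1" using t by (auto simp: \<theta>_def)
    moreover have "\<phi> (k_one B) = 1" using zero by (simp add: one_eq neg)
    ultimately show ?thesis
      unfolding dual_points_def kleene_hom_def K3_def \<kappa>_def using zero by (simp add: join meet neg)
  qed
  \<comment> \<open>A larger \<open>t\<close> moves more values from 1/2 to an end, hence upwards in
    the order.\<close>
  have \<kappa>_le: "dual_le B (\<kappa> s) (\<kappa> t)" if "s \<le> t" "t \<in> T" for s t
    using that(1) T(3)[OF that(2)] by (auto simp: dual_le_def K3_le_def \<kappa>_def \<theta>_def)
  define ix where "ix t = inv_into {..<d} w (\<kappa> t)" for t
  have ix: "ix t < d" "w (ix t) = \<kappa> t" if "t \<in> T" for t
    using \<kappa>_dual[OF that] enum inv_into_into[of "\<kappa> t" w "{..<d}"] f_inv_into_f[of "\<kappa> t" w "{..<d}"]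
    by (auto simp: ix_def bij_betw_def)
  \<comment> \<open>The factor 2 normalises the total gap length 1/2. Summing over fibres of
    \<open>ix\<close> avoids asking whether different thresholds are different points.\<close>
  define \<mu> where "\<mu> i = (\<Sum>t | t \<in> T \<and> ix t = i. 2 * m t)" for i
  define x where "x i = (if i < d then \<mu> i / \<omega> i else 0)" for i
  have \<omega>x: "\<omega> i * x i = \<mu> i" if "i < d" for i using that weight_pos[of i] by (simp add: x_def)
  have group: "(\<Sum>i<d. \<mu> i * f i) = (\<Sum>t\<in>T. 2 * m t * f (ix t))" for f
  proof -
    have "(\<Sum>i<d. \<mu> i * f i) = (\<Sum>i<d. \<Sum>t | t \<in> T \<and> ix t = i. 2 * m t * f (ix t))"
      by (intro sum.cong) (auto simp: \<mu>_def sum_distrib_right)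
    then show ?thesis using sum.group[of T "{..<d}" ix "\<lambda>t. 2 * m t * f (ix t)"] T(1) ix by auto
  qed
  have total: "(\<Sum>t\<in>T. 2 * m t) = 1"
  proof -
    have "{t. t \<in> T \<and> t < 1/2} = T" using T(3) by auto
    then show ?thesis using m(2)[of "1/2"] by (simp add: sum_distrib_left[symmetric])
  qed
  \<comment> \<open>In this range \<open>\<kappa> t b\<close> is 1/2 exactly for
    \<open>t < \<phi> b\<close>, so the factor 2 cancels and the gaps telescope. Larger values are
    handled by negation.\<close>
  have low: "(\<Sum>t\<in>T. 2 * m t * \<kappa> t b) = \<phi> b" if b: "b \<in> carrier B" "\<phi> b \<le> 1/2" for b
  proof -
    have "(\<Sum>t\<in>T. 2 * m t * \<kappa> t b) = (\<Sum>t\<in>T. if t < \<phi> b then m t else 0)"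
      using T(3) b by (intro sum.cong) (force simp: \<kappa>_def \<theta>_def)+
    also have "\<dots> = (\<Sum>t | t \<in> T \<and> t < \<phi> b. m t)" using T(1) by (simp add: sum.inter_filter)
    also have "\<dots> = \<phi> b" using b by (intro m(2)) (auto simp: T_def)
    finally show ?thesis .
  qed
  have mean: "(\<Sum>t\<in>T. 2 * m t * \<kappa> t b) = \<phi> b" if b: "b \<in> carrier B" for b
  proof (cases "\<phi> b \<le> 1/2")
    case False
    have "\<kappa> t (k_neg B b) = 1 - \<kappa> t b" if "t \<in> T" for t
      using T(3)[OF that] b by (auto simp: \<kappa>_def \<theta>_def neg)
    then have "(\<Sum>t\<in>T. 2 * m t * \<kappa> t (k_neg B b)) = (\<Sum>t\<in>T. 2 * m t - 2 * m t * \<kappa> t b)"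
      by (intro sum.cong) (simp_all add: right_diff_distrib)
    then show ?thesis using low[of "k_neg B b"] False b total by (simp add: neg sum_subtractf)
  qed (use low b in auto)
  have supp: "\<exists>t\<in>T. ix t = i" if "\<mu> i \<noteq> 0" for i
  proof (rule ccontr)
    assume "\<not> ?thesis"
    then have "{t. t \<in> T \<and> ix t = i} = {}" by blast
    with that show False by (simp only: \<mu>_def sum.empty)
  qed
  have "x \<in> P"
    unfolding mem_P_iff
  proof (intro conjI allI impI)
    show "0 \<le> x i" for i using m(1) weight_pos[of i] by (auto simp: x_def \<mu>_def intro!: divide_nonneg_pos sum_nonneg)
    have "(\<Sum>i<d. \<omega> i * x i) = (\<Sum>i<d. \<mu> i)" by (intro sum.cong) (auto simp: \<omega>x)
    then show "(\<Sum>i<d. \<omega> i * x i) = 1" using group[of "\<lambda>_. 1"] total by simp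
    fix i j assume "x i \<noteq> 0" "x j \<noteq> 0"
    then have "\<mu> i \<noteq> 0" "\<mu> j \<noteq> 0" by (auto simp: x_def split: if_splits)
    then obtain s t where "s \<in> T" "ix s = i" "t \<in> T" "ix t = j" using supp by blast
    then show "le i j \<or> le j i" using ix \<kappa>_le[of s t] \<kappa>_le[of t s] linear[of s t] by auto
  qed (simp add: x_def)
  moreover have "lin b x = \<phi> b" if "b \<in> carrier B" for b
  proof -
    have "lin b x = (\<Sum>i<d. \<mu> i * w i b)"
      unfolding lin_def by (intro sum.cong) (auto simp: \<omega>x[symmetric])
    also have "\<dots> = (\<Sum>t\<in>T. 2 * m t * \<kappa> t b)" unfolding group by (intro sum.cong) (auto simp: ix)
    finally show ?thesis using mean that by simp
  qed
  ultimately show ?thesis by blast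
qed

end

section \<open>Elements of the Kleene algebra that isolate a coordinate\<close>

context dual_kleene_space
begin

lemma exists_least_one:
  assumes i: "i < d"
  obtains b where "b \<in> carrier B" "w i b = 1"
    "\<And>j c. j < d \<Longrightarrow> c \<in> carrier B \<Longrightarrow> w i c = 1 \<Longrightarrow> w j b \<le> w j c"
proof -
  have "\<exists>b\<in>carrier B. w i b = 1 \<and> (\<forall>j<d. \<forall>c\<in>F. w j b \<le> w j c)"
    if "finite F" "F \<subseteq> {c \<in> carrier B. w i c = 1}" for F
    using that
  proof (induction F rule: finite_induct)
    case empty
    then show ?case using i by (auto intro!: bexI[of _ "k_one B"] simp: w_ops)
  next
    case (insert c F)
    then obtain b where b: "b \<in> carrier B" "w i b = 1" "\<forall>j<d. \<forall>c\<in>F. w j b \<le> w j c" by auto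
    then show ?case using insert.prems i
      by (intro bexI[of _ "k_meet B b c"]) (auto simp: w_ops min.coboundedI1)
  qed
  from this[of "{c \<in> carrier B. w i c = 1}"] show ?thesis using finite_carrier that by auto
qed

text \<open>The meet of \<open>a\<close> with its negation has values in {0, 1/2}, and 1/2 exactly
  where \<open>a\<close> has. Meeting over all \<open>a\<close> that are 1/2 at \<open>w i\<close>
  gives an element that is 1/2 only where all of them are; a point outside \<open>dual_M B\<close>
  supplies at least one such \<open>a\<close>.\<close>

lemma exists_least_half:
  assumes i: "i < d" "w i \<notin> dual_M B"
  obtains c where "c \<in> carrier B" "w i c = 1/2" "\<And>j. j < d \<Longrightarrow> w j c \<in> {0, 1/2}"
    "\<And>j c'. j < d \<Longrightarrow> w j c = 1/2 \<Longrightarrow> c' \<in> carrier B \<Longrightarrow> w i c' = 1/2 \<Longrightarrow> w j c' = 1/2"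
proof -
  obtain c0 where c0: "c0 \<in> carrier B" "w i c0 = 1/2"
    using i w_dual[of i] w_hom(1)[of i] by (fastforce simp: dual_M_def)
  have "\<exists>c\<in>carrier B. w i c = 1/2 \<and> (\<forall>j<d. w j c \<in> {0, 1/2} \<and> (w j c = 1/2 \<longrightarrow> (\<forall>c'\<in>F. w j c' = 1/2)))"
    if "finite F" "F \<subseteq> {c \<in> carrier B. w i c = 1/2}" for F
    using that
  proof (induction F rule: finite_induct)
    case empty
    have "w j (k_meet B c0 (k_neg B c0)) \<in> {0, 1/2}" if "j < d" for j
      using w_hom(1)[OF that c0(1)] c0 that by (auto simp: w_ops)
    then show ?case using c0 i by (intro bexI[of _ "k_meet B c0 (k_neg B c0)"]) (auto simp: w_ops)
  next
    case (insert a F)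
    then obtain c where c: "c \<in> carrier B" "w i c = 1/2"
      and cj: "\<And>j. j < d \<Longrightarrow> w j c \<in> {0, 1/2} \<and> (w j c = 1/2 \<longrightarrow> (\<forall>c'\<in>F. w j c' = 1/2))" by auto
    have a: "a \<in> carrier B" "w i a = 1/2" using insert.prems by auto
    let ?m = "k_meet B c (k_meet B a (k_neg B a))"
    have "w j ?m \<in> {0, 1/2} \<and> (w j ?m = 1/2 \<longrightarrow> w j c = 1/2 \<and> w j a = 1/2)" if "j < d" for j
    proof -
      have "w j ?m = min (w j c) (min (w j a) (1 - w j a))" using a c that by (simp add: w_ops)
      moreover have "w j c \<in> {0, 1/2}" "w j a \<in> {0, 1/2, 1}" using w_hom(1)[OF that a(1)] cj[OF that] by blast+
      ultimately show ?thesis by auto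
    qed
    moreover have "w i ?m = 1/2" using a c i by (simp add: w_ops)
    moreover have "?m \<in> carrier B" using a c by simp
    ultimately show ?case using cj by (intro bexI[of _ ?m]) blast+
  qed
  note ex = this
  have "\<exists>c\<in>carrier B. w i c = 1/2 \<and> (\<forall>j<d. w j c \<in> {0, 1/2} \<and>
      (w j c = 1/2 \<longrightarrow> (\<forall>c'\<in>{c \<in> carrier B. w i c = 1/2}. w j c' = 1/2)))"
    by (rule ex[OF finite_subset[OF _ finite_carrier]]) auto
  then show ?thesis using that by blast
qed

text \<open>A point lies below \<open>i\<close> when it is 1/2 wherever \<open>i\<close> is and
  never has the opposite of a value 0 or 1 of \<open>i\<close>. The least half-valued element tests
  the first condition and the least element with value 1 the second; value 0 reduces to value 1 by
  negation.\<close>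

lemma exists_principal_downset:
  assumes i: "i < d" "w i \<notin> dual_M B"
  obtains c where "c \<in> carrier B" "\<And>j. j < d \<Longrightarrow> w j c = (if le j i then 1/2 else 0)"
proof -
  obtain b where b: "b \<in> carrier B" "w i b = 1"
    "\<And>j c. j < d \<Longrightarrow> c \<in> carrier B \<Longrightarrow> w i c = 1 \<Longrightarrow> w j b \<le> w j c"
    using exists_least_one[OF i(1)] by blast
  obtain c where c: "c \<in> carrier B" "w i c = 1/2" "\<And>j. j < d \<Longrightarrow> w j c \<in> {0, 1/2}"
    "\<And>j c'. j < d \<Longrightarrow> w j c = 1/2 \<Longrightarrow> c' \<in> carrier B \<Longrightarrow> w i c' = 1/2 \<Longrightarrow> w j c' = 1/2"
    using exists_least_half[OF i] by blast
  have "w j (k_meet B c b) = (if le j i then 1/2 else 0)" if j: "j < d" for j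
  proof (cases "le j i")
    case True
    then have "K3_le (w j c) (1/2)" "K3_le (w j b) 1" using b(1,2) c(1,2) by (metis dual_le_def)+
    then have "w j c = 1/2" "w j b \<in> {1/2, 1}" by (auto simp: K3_le_def)
    moreover have "w j (k_meet B c b) = min (w j c) (w j b)" using b(1) c(1) j by (simp add: w_ops)
    ultimately show ?thesis using True by auto
  next
    case False
    have "w j (k_meet B c b) = 0"
    proof (rule ccontr)
      assume "w j (k_meet B c b) \<noteq> 0"
      then have jc: "w j c = 1/2" and jb: "w j b \<ge> 1/2"
        using c(3)[OF j] w_hom(1)[OF j b(1)] w_ops(2)[OF j c(1) b(1)] by auto
      have ge: "w j a \<ge> 1/2" if "a \<in> carrier B" "w i a = 1" for a
        using b(3)[OF j that] jb by simp
      have "K3_le (w j a) (w i a)" if a: "a \<in> carrier B" for a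
      proof -
        consider "w i a = 1/2" | "w i a = 1" | "w i a = 0" using w_hom(1)[OF i(1) a] by auto
        then show ?thesis
        proof cases
          case 1
          then show ?thesis using c(4)[OF j jc a] by (simp add: K3_le_def)
        next
          case 2
          then show ?thesis using ge[OF a] w_hom(1)[OF j a] by (auto simp: K3_le_def)
        next
          case 3
          then show ?thesis using ge[of "k_neg B a"] w_hom(1)[OF j a] w_ops(3)[OF j a] w_ops(3)[OF i(1) a] a
            by (auto simp: K3_le_def)
        qed
      qed
      then show False using False by (simp add: dual_le_def)
    qed
    then show ?thesis using False by simp
  qed
  then show ?thesis using that[of "k_meet B c b"] b(1) c(1) by simp
qed

text \<open>Going up in the order only replaces 1/2 by 0 or 1, so nothing lies strictly above a
  point without the value 1/2.\<close>

lemma maximal_M: "i < d \<Longrightarrow> j < d \<Longrightarrow> w i \<in> dual_M B \<Longrightarrow> le i j \<Longrightarrow> i = j"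
  by (rule w_inj) (fastforce simp: dual_M_def dual_le_def K3_le_def)+

lemma not_M_below: "i < d \<Longrightarrow> j < d \<Longrightarrow> w i \<notin> dual_M B \<Longrightarrow> le j i \<Longrightarrow> w j \<notin> dual_M B"
  using maximal_M[of j i] by auto

text \<open>The left side is \<open>lin b \<odot> lin b\<close>, the positive part of the sum of
  \<open>\<omega> j * x j * (2 * w j b - 1)\<close>. By minimality \<open>b\<close> is 1 only at
  \<open>i\<close>. If \<open>i\<close> is in the support, the rest of the support lies below it by
  maximality, where \<open>b\<close> is 1/2 and contributes nothing; otherwise no term is
  positive.\<close>

lemma coordinate_M:
  assumes x: "x \<in> P" and i: "i < d" "w i \<in> dual_M B"
    and b: "b \<in> carrier B" "w i b = 1"
    "\<And>j c. j < d \<Longrightarrow> c \<in> carrier B \<Longrightarrow> w i c = 1 \<Longrightarrow> w j b \<le> w j c"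
  shows "max 0 (lin b x - (1 - lin b x)) = x i"
proof -
  have b1: "j = i" if "j < d" "w j b = 1" for j
  proof (rule maximal_M[OF i(1) that(1) i(2), symmetric])
    have one: "w j c = 1" if "c \<in> carrier B" "w i c = 1" for c
      using b(3)[OF \<open>j < d\<close> that] w_hom(1)[OF \<open>j < d\<close> that(1)] \<open>w j b = 1\<close> by auto
    have "w i c = w j c" if c: "c \<in> carrier B" for c
    proof -
      have "w i c \<in> {0, 1}" using i(2) c by (auto simp: dual_M_def)
      then show ?thesis using one[of c] one[of "k_neg B c"] c i(1) \<open>j < d\<close> by (auto simp: w_ops)
    qed
    then show "le i j" using w_hom(1)[OF i(1)] by (auto simp: dual_le_def K3_le_def)
  qed
  have \<omega>i: "\<omega> i = 1" using i by (simp add: dual_weight_def)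
  have eq: "lin b x - (1 - lin b x) = (\<Sum>j<d. \<omega> j * x j * (2 * w j b - 1))"
  proof -
    have "(\<Sum>j<d. \<omega> j * x j * (2 * w j b - 1)) = (\<Sum>j<d. 2 * (\<omega> j * w j b * x j) - \<omega> j * x j)"
      by (intro sum.cong) (auto simp: algebra_simps)
    then show ?thesis using x by (simp add: sum_subtractf lin_def mem_P_iff sum_distrib_left[symmetric])
  qed
  show ?thesis
  proof (cases "x i = 0")
    case True
    have "(\<Sum>j<d. \<omega> j * x j * (2 * w j b - 1)) \<le> 0"
    proof (rule sum_nonpos)
      fix j assume "j \<in> {..<d}"
      then have j: "j < d" by simp
      show "\<omega> j * x j * (2 * w j b - 1) \<le> 0"
      proof (cases "j = i")
        case False
        then have "2 * w j b - 1 \<le> 0" using b1[OF j] w_hom(1)[OF j b(1)] by auto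
        moreover have "0 \<le> \<omega> j * x j" using x j by (simp add: mem_P_iff)
        ultimately show ?thesis by (rule mult_nonneg_nonpos[rotated])
      qed (simp add: True)
    qed
    then show ?thesis using True eq by simp
  next
    case False
    have "\<omega> j * x j * (2 * w j b - 1) = (if j = i then x i else 0)" if j: "j < d" for j
    proof (cases "j = i \<or> x j = 0")
      case True
      then show ?thesis using b(2) \<omega>i by auto
    next
      case ji: False
      then have "le i j \<or> le j i" using x False i j by (auto simp: mem_P_iff)
      then have "le j i" using maximal_M[OF i(1) j i(2)] ji by auto
      then have "K3_le (w j b) 1" using b(1,2) by (metis dual_le_def)
      then have "w j b = 1/2" using b1[OF j] ji by (auto simp: K3_le_def)
      then show ?thesis using ji by simp
    qed
    then have "(\<Sum>j<d. \<omega> j * x j * (2 * w j b - 1)) = (\<Sum>j<d. if j = i then x i else 0)"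
      by (intro sum.cong) auto
    then show ?thesis using eq i x by (simp add: mem_P_iff)
  qed
qed

text \<open>For \<open>i\<close> outside \<open>dual_M B\<close> this is \<open>lin c\<close> for
  the element \<open>c\<close> that is 1/2 on the down-set of \<open>i\<close> and 0 elsewhere: all
  weights there are 2 and cancel the 1/2.\<close>

definition below :: "nat \<Rightarrow> (nat \<Rightarrow> real) \<Rightarrow> real" where
  "below i x = (\<Sum>j | j < d \<and> le j i. x j)"

lemma lin_downset:
  assumes i: "i < d" "w i \<notin> dual_M B" and c: "\<And>j. j < d \<Longrightarrow> w j c = (if le j i then 1/2 else 0)"
  shows "lin c x = below i x"
proof -
  have "lin c x = (\<Sum>j<d. if le j i then x j else 0)"
    unfolding lin_def using not_M_below[OF i(1) _ i(2)]
    by (intro sum.cong) (auto simp: c dual_weight_def)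
  then show ?thesis by (simp add: below_def sum.inter_filter[symmetric])
qed

text \<open>The support is a chain, so its points strictly below \<open>i\<close> have a greatest
  one \<open>k\<close>, and \<open>below k x\<close> already collects all mass strictly below
  \<open>i\<close>; no other choice exceeds it. The zero function covers the case that the support
  has no point there.\<close>

lemma coordinate_not_M:
  assumes x: "x \<in> P" and i: "i < d"
  shows "max 0 (below i x - (MAX q\<in>insert (\<lambda>_. 0) (below ` {k. k < d \<and> le k i \<and> k \<noteq> i}). q x)) = x i"
proof -
  define K where "K = {k. k < d \<and> le k i \<and> k \<noteq> i}"
  have finK: "finite K" by (simp add: K_def)
  have x0: "0 \<le> x j" if "j < d" for j using x that by (simp add: mem_P_iff)
  have downK: "{j. j < d \<and> le j k} \<subseteq> K" if "k \<in> K" for k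
    using that le_trans le_antisym[OF _ i] by (auto simp: K_def)
  have "(MAX q\<in>insert (\<lambda>_. 0) (below ` K). q x) = (\<Sum>j\<in>K. x j)"
  proof (rule Max_eqI)
    show "finite ((\<lambda>q. q x) ` insert (\<lambda>_. 0) (below ` K))" using finK by simp
    show "y \<le> (\<Sum>j\<in>K. x j)" if y: "y \<in> (\<lambda>q. q x) ` insert (\<lambda>_. 0) (below ` K)" for y
    proof -
      consider "y = 0" | k where "k \<in> K" "y = below k x" using y by auto
      then show ?thesis
      proof cases
        case 2
        then show ?thesis unfolding below_def using downK finK x0
          by (auto intro!: sum_mono2 simp: K_def)
      qed (auto intro!: sum_nonneg x0 simp: K_def)
    qed
    define T where "T = {j \<in> K. x j \<noteq> 0}"
    have sumT: "(\<Sum>j\<in>K. x j) = (\<Sum>j\<in>T. x j)" using finK by (intro sum.mono_neutral_right) (auto simp: T_def)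
    show "(\<Sum>j\<in>K. x j) \<in> (\<lambda>q. q x) ` insert (\<lambda>_. 0) (below ` K)"
    proof (cases "T = {}")
      case True
      then show ?thesis using sumT by auto
    next
      case False
      have "\<exists>k\<in>T. \<forall>j\<in>T. le j k"
      proof (rule finite_total_greatest[OF _ False])
        show "finite T" using finK by (simp add: T_def)
        show "le j k \<or> le k j" if "j \<in> T" "k \<in> T" for j k using that x by (auto simp: T_def K_def mem_P_iff)
      qed (use le_trans in blast)
      then obtain k where k: "k \<in> T" "\<And>j. j \<in> T \<Longrightarrow> le j k" by blast
      then have "k \<in> K" by (simp add: T_def)
      have "below k x = (\<Sum>j\<in>T. x j)" unfolding below_def
        by (rule sum.mono_neutral_right) (use k downK[OF \<open>k \<in> K\<close>] in \<open>auto simp: T_def K_def\<close>)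
      then show ?thesis using sumT \<open>k \<in> K\<close> by (intro image_eqI[of _ _ "below k"]) simp_all
    qed
  qed
  moreover have "below i x = x i + (\<Sum>j\<in>K. x j)"
  proof -
    have "{j. j < d \<and> le j i} = insert i K" using le_refl i by (auto simp: K_def)
    moreover have "i \<notin> K" by (simp add: K_def)
    ultimately show ?thesis using finK by (simp add: below_def)
  qed
  ultimately show ?thesis using x0[OF i] by (simp add: K_def)
qed

lemma represented_coordinate:
  assumes H: "unit_interval_subalgebra P H"
    and lin: "\<And>b. b \<in> carrier B \<Longrightarrow> unit_interval_subalgebra.represented P H (lin b)"
    and i: "i < d"
  shows "unit_interval_subalgebra.represented P H (\<lambda>x. x i)"
proof -
  interpret unit_interval_subalgebra P H by (rule H)
  show ?thesis
  proof (cases "w i \<in> dual_M B")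
    case True
    obtain b where b: "b \<in> carrier B" "w i b = 1"
      "\<And>j c. j < d \<Longrightarrow> c \<in> carrier B \<Longrightarrow> w i c = 1 \<Longrightarrow> w j b \<le> w j c"
      using exists_least_one[OF i] by blast
    have "represented (\<lambda>x. max 0 (lin b x - (1 - lin b x)))"
      by (intro represented_diff represented_neg lin b)
    then show ?thesis
      by (rule represented_cong[THEN iffD1, rotated]) (rule coordinate_M[OF _ i True b])
  next
    case False
    have below: "represented (below k)" if k: "k < d" "w k \<notin> dual_M B" for k
    proof -
      obtain c where c: "c \<in> carrier B" "\<And>j. j < d \<Longrightarrow> w j c = (if le j k then 1/2 else 0)"
        using exists_principal_downset[OF k] by blast
      then have "lin c = below k" using lin_downset[OF k] by blast
      then show ?thesis using lin[OF c(1)] by simp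
    qed
    have "represented (\<lambda>x. max 0 (below i x -
        (MAX q\<in>insert (\<lambda>_. 0) (below ` {k. k < d \<and> le k i \<and> k \<noteq> i}). q x)))"
      using not_M_below[OF i _ False]
      by (intro represented_diff represented_Max below i False) (auto intro: represented_zero below)
    then show ?thesis
      by (rule represented_cong[THEN iffD1, rotated]) (rule coordinate_not_M[OF _ i])
  qed
qed

end

section \<open>The isomorphism\<close>

lemma mv_homD:
  assumes "h \<in> mv_hom A C"
  shows "x \<in> carrier A \<Longrightarrow> h x \<in> carrier C"
    "x \<in> carrier A \<Longrightarrow> y \<in> carrier A \<Longrightarrow> h (mv_add A x y) = mv_add C (h x) (h y)"
    "x \<in> carrier A \<Longrightarrow> h (mv_neg A x) = mv_neg C (h x)"
    "h (mv_zero A) = mv_zero C"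
  using assms by (auto simp: mv_hom_def)

lemma mv_hom_free_mv_class:
  assumes B: "kleene_algebra B" and h: "h \<in> mv_hom (free_mv B) A"
    and s: "s \<in> carrier (kleene_terms B)"
  shows "h (free_mv_cong B `` {s}) = mv_eval A (\<lambda>b. h (free_mv_unit B b)) s"
  using s
proof (induction s)
  case (MV_Gen b)
  then show ?case by (simp add: free_mv_unit_def mv_term_algebra_def)
next
  case MV_Zero
  then show ?case using mv_homD(4)[OF h] by (simp add: free_mv_zero_class[OF B])
next
  case (MV_Neg s)
  then have s: "s \<in> carrier (kleene_terms B)" by (simp add: mv_term_algebra_def)
  show ?case
    using MV_Neg.IH[OF s] mv_homD(3)[OF h free_mv_class_closed[OF B s]] by (simp add: free_mv_neg_class[OF B s])
next
  case (MV_Add s t)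
  then have s: "s \<in> carrier (kleene_terms B)" "t \<in> carrier (kleene_terms B)"
    by (simp_all add: mv_term_algebra_def)
  show ?case
    using MV_Add.IH(1)[OF s(1)] MV_Add.IH(2)[OF s(2)]
      mv_homD(2)[OF h free_mv_class_closed[OF B s(1)] free_mv_class_closed[OF B s(2)]]
    by (simp add: free_mv_add_class[OF B s])
qed

text \<open>The local embedding respects an operation only if its arguments and result lie in a
  given finite set; closing under subterms keeps evaluation inside such a set.\<close>

primrec subterms :: "'a mv_term \<Rightarrow> 'a mv_term set" where
  "subterms (MV_Gen a) = {MV_Gen a}"
| "subterms MV_Zero = {MV_Zero}"
| "subterms (MV_Neg t) = insert (MV_Neg t) (subterms t)"
| "subterms (MV_Add s t) = insert (MV_Add s t) (subterms s \<union> subterms t)"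

lemma finite_subterms: "finite (subterms t)"
  by (induction t) auto

lemma self_subterm: "t \<in> subterms t"
  by (cases t) auto

lemma subterms_closed: "s \<in> carrier (kleene_terms B) \<Longrightarrow> subterms s \<subseteq> carrier (kleene_terms B)"
  by (induction s) (auto simp: mv_term_algebra_def)

definition unit_interval :: "real mv" where
  "unit_interval = \<lparr>carrier = {0..1}, mv_add = \<lambda>x y. min (x + y) 1, mv_neg = \<lambda>x. 1 - x, mv_zero = 0\<rparr>"

text \<open>Chang's completeness theorem, relative to the relations of \<open>B\<close>: these involve finitely many
  elements only, so they survive the local embedding of a chain quotient into \<open>[0, 1]\<close>.\<close>

lemma free_mv_separated:
  assumes B: "kleene_algebra B" and fin: "finite (carrier B)"
    and st: "s \<in> carrier (kleene_terms B)" "t \<in> carrier (kleene_terms B)"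
    and neq: "free_mv_cong B `` {s} \<noteq> free_mv_cong B `` {t}"
  obtains \<phi> :: "'a \<Rightarrow> real" where
    "\<And>b. b \<in> carrier B \<Longrightarrow> 0 \<le> \<phi> b \<and> \<phi> b \<le> 1"
    "\<And>a b. a \<in> carrier B \<Longrightarrow> b \<in> carrier B \<Longrightarrow> \<phi> (k_join B a b) = max (\<phi> a) (\<phi> b)"
    "\<And>b. b \<in> carrier B \<Longrightarrow> \<phi> (k_neg B b) = 1 - \<phi> b"
    "\<phi> (k_zero B) = 0"
    "mv_eval unit_interval \<phi> s \<noteq> mv_eval unit_interval \<phi> t"
proof -
  interpret B: kleene_algebra B by (rule B)
  interpret F: mv_algebra "free_mv B" by (rule mv_algebra_free_mv[OF B])
  define cl where "cl u = free_mv_cong B `` {u}" for u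
  have cl_closed: "cl u \<in> carrier (free_mv B)" if "u \<in> carrier (kleene_terms B)" for u
    unfolding cl_def by (rule free_mv_class_closed[OF B that])
  obtain C :: "'a mv_term set mv" and h where C: "mv_chain C" and h: "h \<in> mv_hom (free_mv B) C"
    and hne: "h (cl s) \<noteq> h (cl t)"
    using F.chain_quotient_separates[OF cl_closed[OF st(1)] cl_closed[OF st(2)]] neq unfolding cl_def by metis
  interpret C: mv_chain C by (rule C)
  have h_closed: "h (cl u) \<in> carrier C" if "u \<in> carrier (kleene_terms B)" for u
    using mv_homD(1)[OF h cl_closed[OF that]] .
  have "mv_zero C \<noteq> mv_one C"
  proof
    assume 01: "mv_zero C = mv_one C"
    have "x = mv_one C" if "x \<in> carrier C" for x
      using C.add_zero[OF that] C.add_one[OF that] 01 by simp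
    then show False using hne h_closed st by metis
  qed
  then interpret C: mv_nontrivial_chain C by unfold_locales
  define T where "T = subterms s \<union> subterms t \<union> MV_Gen ` carrier B"
  have Tc: "T \<subseteq> carrier (kleene_terms B)"
    using subterms_closed[OF st(1)] subterms_closed[OF st(2)] by (auto simp: T_def mv_term_algebra_def)
  define X where "X = (\<lambda>u. h (cl u)) ` T"
  have X: "finite X" "X \<subseteq> carrier C" using Tc h_closed fin by (auto simp: X_def T_def finite_subterms)
  obtain \<rho> :: "'a mv_term set \<Rightarrow> real" where \<rho>: "\<rho> (mv_zero C) = 0" "\<rho> (mv_one C) = 1"
    "\<And>x. x \<in> X \<Longrightarrow> 0 \<le> \<rho> x \<and> \<rho> x \<le> 1"
    "\<And>x y. x \<in> X \<Longrightarrow> y \<in> X \<Longrightarrow> mv_add C (mv_neg C x) y = mv_one C \<Longrightarrow> x \<noteq> y \<Longrightarrow> \<rho> x < \<rho> y"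
    "\<And>x. x \<in> X \<Longrightarrow> mv_neg C x \<in> X \<Longrightarrow> \<rho> (mv_neg C x) = 1 - \<rho> x"
    "\<And>x y. x \<in> X \<Longrightarrow> y \<in> X \<Longrightarrow> mv_add C x y \<in> X \<Longrightarrow> \<rho> (mv_add C x y) = min (\<rho> x + \<rho> y) 1"
    using C.local_embedding[OF X] by blast
  have XT: "h (cl u) \<in> X" if "u \<in> T" for u using that by (auto simp: X_def)
  define \<phi> where "\<phi> b = \<rho> (h (cl (MV_Gen b)))" for b
  have genT: "MV_Gen b \<in> T" if "b \<in> carrier B" for b using that by (auto simp: T_def)
  have h_neg: "h (cl (MV_Neg u)) = mv_neg C (h (cl u))" if "u \<in> carrier (kleene_terms B)" for u
    using mv_homD(3)[OF h cl_closed[OF that]] free_mv_neg_class[OF B that] by (simp add: cl_def)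
  have h_add: "h (cl (MV_Add u v)) = mv_add C (h (cl u)) (h (cl v))"
    if "u \<in> carrier (kleene_terms B)" "v \<in> carrier (kleene_terms B)" for u v
    using mv_homD(2)[OF h cl_closed[OF that(1)] cl_closed[OF that(2)]] free_mv_add_class[OF B that]
    by (simp add: cl_def)
  have h_zero: "h (cl MV_Zero) = mv_zero C"
    using mv_homD(4)[OF h] free_mv_zero_class[OF B] by (simp add: cl_def)
  have cl_cong: "cl u = cl v" if "(u, v) \<in> free_mv_cong B" for u v
    unfolding cl_def by (rule free_mv_cong_class_eq[OF B that])
  have Gc: "MV_Gen b \<in> carrier (kleene_terms B)" if "b \<in> carrier B" for b
    using that by (simp add: mv_term_algebra_def)
  have eval: "mv_eval unit_interval \<phi> u = \<rho> (h (cl u))" if "subterms u \<subseteq> T" for u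
    using that
  proof (induction u)
    case (MV_Gen a)
    then show ?case by (simp add: \<phi>_def)
  next
    case MV_Zero
    then show ?case by (simp add: h_zero \<rho> unit_interval_def)
  next
    case (MV_Neg u)
    then have u: "subterms u \<subseteq> T" "u \<in> T" "MV_Neg u \<in> T" using self_subterm[of u] by auto
    then have "h (cl (MV_Neg u)) = mv_neg C (h (cl u))" using h_neg Tc by blast
    then show ?case using MV_Neg.IH[OF u(1)] \<rho>(5)[OF XT[OF u(2)]] XT[OF u(3)] by (simp add: unit_interval_def)
  next
    case (MV_Add u v)
    then have u: "subterms u \<subseteq> T" "subterms v \<subseteq> T" "u \<in> T" "v \<in> T" "MV_Add u v \<in> T"
      using self_subterm[of u] self_subterm[of v] by auto
    then have "h (cl (MV_Add u v)) = mv_add C (h (cl u)) (h (cl v))" using h_add Tc by blast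
    then show ?case using MV_Add.IH(1)[OF u(1)] MV_Add.IH(2)[OF u(2)] \<rho>(6)[OF XT[OF u(3)] XT[OF u(4)]] XT[OF u(5)]
      by (simp add: unit_interval_def)
  qed
  show ?thesis
  proof (rule that[of \<phi>])
    show "0 \<le> \<phi> b \<and> \<phi> b \<le> 1" if "b \<in> carrier B" for b
      unfolding \<phi>_def by (intro \<rho>(3) XT genT that)
    show "\<phi> (k_neg B b) = 1 - \<phi> b" if b: "b \<in> carrier B" for b
    proof -
      have "h (cl (MV_Gen (k_neg B b))) = mv_neg C (h (cl (MV_Gen b)))"
        using cl_cong[OF free_mv_cong.gen_neg[OF b]] h_neg[OF Gc[OF b]] by (simp add: kleene_terms_ops[OF B])
      then show ?thesis
        unfolding \<phi>_def using \<rho>(5)[OF XT[OF genT[OF b]]] XT[OF genT[OF B.neg_closed[OF b]]] by simp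
    qed
    have "cl (MV_Gen (k_zero B)) = cl MV_Zero"
      using cl_cong[OF free_mv_cong.gen_zero] by (simp add: kleene_terms_ops[OF B])
    then show "\<phi> (k_zero B) = 0" by (simp add: \<phi>_def h_zero \<rho>)
    show "\<phi> (k_join B a b) = max (\<phi> a) (\<phi> b)" if ab: "a \<in> carrier B" "b \<in> carrier B" for a b
    proof -
      define p where "p = h (cl (MV_Gen a))"
      define q where "q = h (cl (MV_Gen b))"
      have pq: "p \<in> carrier C" "q \<in> carrier C" "p \<in> X" "q \<in> X"
        using h_closed Gc XT genT ab by (auto simp: p_def q_def)
      have "cl (MV_Gen (k_join B a b)) = cl (MV_Add (MV_Neg (MV_Add (MV_Neg (MV_Gen a)) (MV_Gen b))) (MV_Gen b))"
        using cl_cong[OF free_mv_cong.gen_join[OF ab]] by (simp add: mv_join_def kleene_terms_ops[OF B])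
      then have j: "h (cl (MV_Gen (k_join B a b))) = mv_join C p q"
        using Gc ab by (simp add: h_add h_neg kleene_terms_closed[OF B] mv_join_def p_def q_def)
      have le: "\<rho> x \<le> \<rho> y" if "x \<in> X" "y \<in> X" "mv_add C (mv_neg C x) y = mv_one C" for x y
        using \<rho>(4)[OF that] by (cases "x = y") auto
      \<comment> \<open>In a chain the join is one of its arguments, so monotonicity suffices and
        the intermediate terms of the join need not have their values in \<open>X\<close>.\<close>
      consider "mv_add C (mv_neg C p) q = mv_one C" | "mv_add C (mv_neg C q) p = mv_one C"
        using C.total[OF pq(1,2)] by blast
      then have "\<rho> (mv_join C p q) = max (\<rho> p) (\<rho> q)"
      proof cases
        case 1
        then have "mv_join C p q = q" using pq by (simp add: mv_join_def)
        then show ?thesis using le[OF pq(3,4) 1] by simp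
      next
        case 2
        then have "mv_join C p q = p" using pq C.join_comm[of p q] by (simp add: mv_join_def)
        then show ?thesis using le[OF pq(4,3) 2] by simp
      qed
      then show ?thesis by (simp add: \<phi>_def j p_def q_def)
    qed
    have hs: "h (cl s) \<in> X" "h (cl t) \<in> X" "h (cl s) \<in> carrier C" "h (cl t) \<in> carrier C"
      using XT h_closed st self_subterm[of s] self_subterm[of t] by (auto simp: T_def)
    have "\<rho> (h (cl s)) < \<rho> (h (cl t)) \<or> \<rho> (h (cl t)) < \<rho> (h (cl s))"
      using C.total[OF hs(3,4)] \<rho>(4)[OF hs(1,2) _ hne] \<rho>(4)[OF hs(2,1) _ hne[symmetric]] by blast
    then have "\<rho> (h (cl s)) \<noteq> \<rho> (h (cl t))" by auto
    then show "mv_eval unit_interval \<phi> s \<noteq> mv_eval unit_interval \<phi> t"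
      using eval[of s] eval[of t] by (simp add: T_def le_supI1)
  qed
qed

section \<open>Bijectivity of the induced homomorphism\<close>

context dual_kleene_space
begin

abbreviation "Z \<equiv> zmap_algebra d P"

lemma Z_ops:
  "mv_add Z f g = (\<lambda>x\<in>P. min (f x + g x) 1)" "mv_neg Z f = (\<lambda>x\<in>P. 1 - f x)" "mv_zero Z = (\<lambda>x\<in>P. 0)"
  by (simp_all add: zmap_algebra_def)

lemma mv_join_Z: "f \<in> carrier Z \<Longrightarrow> g \<in> carrier Z \<Longrightarrow> mv_join Z f g = (\<lambda>x\<in>P. max (f x) (g x))"
  by (auto simp: mv_join_def Z_ops zmap_algebra_def fun_eq_iff image_subset_iff)

lemma P_subset: "P \<subseteq> topspace (Euclidean_space d)"
  by (auto simp: mem_P_iff topspace_Euclidean_space)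

definition lin_hom :: "'a \<Rightarrow> (nat \<Rightarrow> real) \<Rightarrow> real" where
  "lin_hom = (\<lambda>b\<in>carrier B. restrict (lin b) P)"

lemma lin_hom_closed: "b \<in> carrier B \<Longrightarrow> lin_hom b \<in> carrier Z"
  using lin_int_piecewise_linear lin_range by (auto simp: lin_hom_def zmap_algebra_def)

lemma lin_hom_kleene_hom: "lin_hom \<in> kleene_hom B (underlying_kleene Z)"
proof -
  have neg: "lin_hom (k_neg B b) = mv_neg Z (lin_hom b)" if "b \<in> carrier B" for b
    using that by (auto simp: lin_hom_def Z_ops lin_neg)
  have join: "lin_hom (k_join B a b) = mv_join Z (lin_hom a) (lin_hom b)" if "a \<in> carrier B" "b \<in> carrier B" for a b
    using that by (auto simp: mv_join_Z lin_hom_closed) (auto simp: lin_hom_def lin_join)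
  have meet: "lin_hom (k_meet B a b) = mv_meet Z (lin_hom a) (lin_hom b)" if "a \<in> carrier B" "b \<in> carrier B" for a b
    using that by (simp add: meet_eq neg join mv_meet_def)
  have zero: "lin_hom (k_zero B) = mv_zero Z" by (auto simp: lin_hom_def Z_ops lin_zero)
  have one: "lin_hom (k_one B) = mv_one Z" by (simp add: one_eq neg zero mv_one_def)
  show ?thesis
    using neg join meet zero one lin_hom_closed
    by (auto simp: kleene_hom_def underlying_kleene_def lin_hom_def)
qed

lemma mv_eval_lin_hom:
  assumes "x \<in> P" "s \<in> carrier (kleene_terms B)"
  shows "mv_eval Z lin_hom s x = mv_eval unit_interval (\<lambda>b. lin b x) s"
  using assms(2) by (induction s)
    (use assms(1) in \<open>auto simp: mv_term_algebra_def lin_hom_def Z_ops unit_interval_def\<close>)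

lemma mv_eval_cong_carrier:
  assumes "\<And>b. b \<in> carrier B \<Longrightarrow> f b = g b" "s \<in> carrier (kleene_terms B)"
  shows "mv_eval A f s = mv_eval A g s"
  using assms(2) by (induction s) (auto simp: mv_term_algebra_def assms(1))

lemma free_mv_iso_zmap_algebra: "mv_isomorphic (free_mv B) Z"
proof -
  have B: "kleene_algebra B" by unfold_locales
  obtain h where h: "h \<in> mv_hom (free_mv B) Z" and hu: "\<And>b. b \<in> carrier B \<Longrightarrow> h (free_mv_unit B b) = lin_hom b"
    using free_mv_universal[OF B mv_algebra_zmap_algebra lin_hom_kleene_hom] by blast
  have h_class: "h (free_mv_cong B `` {s}) = mv_eval Z lin_hom s" if "s \<in> carrier (kleene_terms B)" for s
    using mv_hom_free_mv_class[OF B h that] mv_eval_cong_carrier[OF hu that] by simp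
  have "inj_on h (carrier (free_mv B))"
  proof (rule inj_onI, rule ccontr)
    fix X Y assume XY: "X \<in> carrier (free_mv B)" "Y \<in> carrier (free_mv B)" "h X = h Y" "X \<noteq> Y"
    obtain s t where s: "s \<in> carrier (kleene_terms B)" "X = free_mv_cong B `` {s}"
      and t: "t \<in> carrier (kleene_terms B)" "Y = free_mv_cong B `` {t}"
      using XY(1,2) by (metis free_mv_carrierE[OF B])
    obtain \<phi> :: "'a \<Rightarrow> real" where \<phi>:
      "\<And>b. b \<in> carrier B \<Longrightarrow> 0 \<le> \<phi> b \<and> \<phi> b \<le> 1"
      "\<And>a b. a \<in> carrier B \<Longrightarrow> b \<in> carrier B \<Longrightarrow> \<phi> (k_join B a b) = max (\<phi> a) (\<phi> b)"
      "\<And>b. b \<in> carrier B \<Longrightarrow> \<phi> (k_neg B b) = 1 - \<phi> b"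
      "\<phi> (k_zero B) = 0"
      and ne: "mv_eval unit_interval \<phi> s \<noteq> mv_eval unit_interval \<phi> t"
      using free_mv_separated[OF B finite_carrier s(1) t(1) XY(4)[unfolded s(2) t(2)]] by blast
    obtain x where x: "x \<in> P" "\<And>b. b \<in> carrier B \<Longrightarrow> lin b x = \<phi> b"
      using kleene_hom_is_point[OF \<phi>] by blast
    have ev: "mv_eval Z lin_hom u x = mv_eval unit_interval \<phi> u" if u: "u \<in> carrier (kleene_terms B)" for u
      using mv_eval_lin_hom[OF x(1) u] mv_eval_cong_carrier[where A = unit_interval, OF x(2) u] by (rule HOL.trans)
    have "h X x \<noteq> h Y x"
      unfolding s(2) t(2) h_class[OF s(1)] h_class[OF t(1)] ev[OF s(1)] ev[OF t(1)] by (rule ne)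
    then show False using XY(3) by simp
  qed
  moreover have "h ` carrier (free_mv B) = carrier Z"
  proof
    show "h ` carrier (free_mv B) \<subseteq> carrier Z" using mv_homD(1)[OF h] by blast
    let ?H = "h ` carrier (free_mv B)"
    interpret F: mv_algebra "free_mv B" by (rule mv_algebra_free_mv[OF B])
    \<comment> \<open>The operations of \<open>Z\<close> are pointwise, so the image of a
      homomorphism is an algebra of functions, and surjectivity reduces to representing the
      coordinates.\<close>
    have H: "unit_interval_subalgebra P ?H"
    proof
      show "0 \<le> f x \<and> f x \<le> 1" if "f \<in> ?H" "x \<in> P" for f x
        using that mv_homD(1)[OF h] by (force simp: zmap_algebra_def image_subset_iff)
      show "(\<lambda>x\<in>P. 0) \<in> ?H"
        using imageI[OF F.zero_closed, of h] mv_homD(4)[OF h] by (simp only: Z_ops)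
      fix f assume "f \<in> ?H"
      then obtain X where X: "X \<in> carrier (free_mv B)" "f = h X" by blast
      show "(\<lambda>x\<in>P. 1 - f x) \<in> ?H"
        using imageI[OF F.neg_closed[OF X(1)], of h] mv_homD(3)[OF h X(1)] by (simp only: Z_ops X)
      fix g assume "g \<in> ?H"
      then obtain Y where Y: "Y \<in> carrier (free_mv B)" "g = h Y" by blast
      show "(\<lambda>x\<in>P. min (f x + g x) 1) \<in> ?H"
        using imageI[OF F.add_closed[OF X(1) Y(1)], of h] mv_homD(2)[OF h X(1) Y(1)] by (simp only: Z_ops X Y)
    qed
    interpret unit_interval_subalgebra P ?H by (rule H)
    have unit: "free_mv_unit B b \<in> carrier (free_mv B)" if "b \<in> carrier B" for b
      using that by (simp add: free_mv_unit_def free_mv_class_closed[OF B] kleene_terms_closed[OF B])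
    have "represented (lin b)" if "b \<in> carrier B" for b
      unfolding represented_def using hu[OF that] unit[OF that] that by (force simp: lin_hom_def)
    then have coord: "represented (\<lambda>x. x i)" if "i < d" for i
      using represented_coordinate[OF H] that by blast
    show "carrier Z \<subseteq> ?H"
    proof
      fix f assume "f \<in> carrier Z"
      then obtain f' where f': "f = restrict f' P" "int_piecewise_linear d f'" "f' ` P \<subseteq> {0..1}"
        by (auto simp: zmap_algebra_def)
      then show "f \<in> ?H" using represented_int_piecewise_linear[OF coord P_subset] by (simp add: represented_def)
    qed
  qed
  ultimately show ?thesis unfolding mv_isomorphic_def bij_betw_def using h by blast
qed

end

theorem theoremI:
  fixes B :: "'a kleene" and w :: "nat \<Rightarrow> ('a \<Rightarrow> real)" and d :: nat
  assumes "kleene_algebra B"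
    and "finite (carrier B)"
    and "bij_betw w {..<d} (dual_points B)"
  shows "mv_isomorphic (free_mv B)
           (zmap_algebra d
              (companion_polyhedron d w (nerve (dual_points B) (dual_le B)) (dual_weight B)))"
proof -
  interpret dual_kleene_space B w d
    using assms by (intro dual_kleene_space.intro dual_kleene_space_axioms.intro)
  show ?thesis by (rule free_mv_iso_zmap_algebra)
qed

end
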